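(* Let $n\ge 2$, $q\ge 1$, $\mathcal{D}=\mathbb{C}[D_1,\dots,D_n]$, $\mathcal{F}=\mathcal{C}^\infty(\mathsf{T})_{\mathsf{fin}}[x_1,\dots,x_n]$, and let $\mathcal{M}\subset\mathcal{D}^q$ be a submodule. Willems closures $\mathcal{M}^{\perp\perp}$ and behaviors $\mathcal{M}^\perp$ are taken with respect to $\mathcal{F}$. (1) $\mathcal{M}^{\perp\perp}$ consists of the elements $x\in\mathcal{D}^q$ for which the ideal $\{r\in\mathcal{D} : rx\in\mathcal{M}\}$ is not contained in any maximal ideal of the form $(D_1-b_1,\dots,D_n-b_n)$ with $(b_1,\dots,b_n)\in\mathbb{Z}^n$. In other words, $\mathcal{M}^{\perp\perp}$ is the largest submodule $\mathcal{M}^+$ of $\mathcal{D}^q$ containing $\mathcal{M}$ such that the support $S\subset\mathbb{C}^n$ of $\mathcal{M}^+/\mathcal{M}$ satisfies $S\cap\mathbb{Z}^n=\emptyset$. (2) Let $\mathcal{M}=\mathcal{M}_1\cap\dots\cap\mathcal{M}_t$ be an irredundant primary decomposition with $\mathcal{M}_i$ $\mathfrak{p}_i$-primary, and suppose that $\mathcal{V}(\mathfrak{p}_i)$ contains an integral point (a point of $\mathbb{Z}^n$) for $i=1,\dots,r$ and not for $i=r+1,\dots,t$. Then $\mathcal{M}^{\perp\perp}=\mathcal{M}_1\cap\dots\cap\mathcal{M}_r$ (the empty intersection being $\mathcal{D}^q$). Thus $\mathcal{M}=\mathcal{M}^{\perp\perp}$ if and only if every $\mathcal{V}(\mathfrak{p}_i)$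 contains integral points. (3) The behavior $\mathcal{M}^\perp\subset\mathcal{F}^q$ is the image of some morphism $L(D):\mathcal{F}^p\to\mathcal{F}^q$, given by a $q\times p$ matrix with entries in $\mathcal{D}$, if and only if the varieties of the nonzero associated primes of $\mathcal{D}^q/\mathcal{M}$ do not contain integral points.
   Context: $\mathcal{D}=\mathbb{C}[D_1,\dots,D_n]$ is the commutative polynomial ring of constant coefficient differential operators on $\mathbb{R}^n$, with $D_j=\frac{1}{\imath}\frac{\partial}{\partial x_j}$, acting on smooth complex-valued functions on $\mathbb{R}^n$. For an ideal $\mathfrak{i}\subset\mathcal{D}$, $\mathcal{V}(\mathfrak{i})=\{a\in\mathbb{C}^n : L(a)=0 \text{ for all } L\in\mathfrak{i}\}$, with $L(a)$ the evaluation at $D_j=a_j$. The support of a finitely generated module is the variety of its annihilator. $\mathcal{C}^\infty(\mathsf{T})_{\mathsf{fin}}$ is the space of finite sums $\sum_{a\in\mathbb{Z}^n}c_a e^{\imath\langle a,x\rangle}$, $c_a\in\mathbb{C}$, with $\langle a,x\rangle=\sum_j a_jx_j$. $\mathcal{C}^\infty(\mathsf{T})_{\mathsf{fin}}[x_1,\dots,x_n]$ is the $\mathcal{D}$-module of finite sums $\sum_{a\in\mathbb{Z}^n}p_a(x)e^{\imath\langle a,x\rangle}$ with $p_a\in\mathbb{C}[x_1,\dots,x_n]$. For a submodule $\mathcal{M}\subset\mathcal{D}^q$, its behavior is $\mathcal{M}^\perp=\{(f_1,\dots,f_q)\in\mathcal{F}^q : \sum_j r_j(f_j)=0 \text{ for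 all } (r_1,\dots,r_q)\in\mathcal{M}\}$. For a behavior $\mathcal{B}\subset\mathcal{F}^q$, $\mathcal{B}^\perp=\{(r_1,\dots,r_q)\in\mathcal{D}^q : \sum_j r_j(f_j)=0 \text{ for all } (f_1,\dots,f_q)\in\mathcal{B}\}$. The Willems closure of $\mathcal{M}$ is $\mathcal{M}^{\perp\perp}$. A submodule $\mathcal{N}\subset\mathcal{D}^q$ is $\mathfrak{p}$-primary if $\mathrm{Ass}(\mathcal{D}^q/\mathcal{N})=\{\mathfrak{p}\}$. In an irredundant primary decomposition the $\mathfrak{p}_i$ are pairwise distinct, no term can be omitted, and $\{\mathfrak{p}_1,\dots,\mathfrak{p}_t\}=\mathrm{Ass}(\mathcal{D}^q/\mathcal{M})$. *)

theory Defs
  imports "HOL-Analysis.Analysis" "HOL-Library.Poly_Mapping"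
begin

text \<open>
  The index type \<open>'n\<close> plays the role of \<open>{1, ..., n}\<close>. Polynomials over the complex numbers in
  \<open>CARD('n)\<close> commuting variables are finitely supported functions from exponent vectors to
  coefficients, with the convolution product of \<^theory>\<open>HOL-Library.Poly_Mapping\<close>. The same type
  serves for the operator ring (variables \<open>D\<^sub>j\<close>) and for polynomial functions (variables \<open>x\<^sub>j\<close>).
\<close>

type_synonym 'n cpoly = "('n \<Rightarrow>\<^sub>0 nat) \<Rightarrow>\<^sub>0 complex"

definition cpoly_var :: "'n \<Rightarrow> 'n cpoly" where
  "cpoly_var j = Poly_Mapping.single (Poly_Mapping.single j 1) 1"

definition cpoly_const :: "complex \<Rightarrow> 'n cpoly" where
  "cpoly_const c = Poly_Mapping.single 0 c"

definition cpoly_eval :: "'n::finite cpoly \<Rightarrow> complex ^ 'n \<Rightarrow> complex" where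
  "cpoly_eval L a =
     (\<Sum>m\<in>Poly_Mapping.keys L.
        Poly_Mapping.lookup L m * (\<Prod>j\<in>UNIV. (a $ j) ^ Poly_Mapping.lookup m j))"


subsection \<open>Action of constant coefficient operators on functions\<close>

definition D_partial :: "'n::finite \<Rightarrow> (real ^ 'n \<Rightarrow> complex) \<Rightarrow> real ^ 'n \<Rightarrow> complex" where
  "D_partial j f = (\<lambda>x. 1 / \<i> * vector_derivative (\<lambda>t. f (x + t *\<^sub>R axis j 1)) (at 0))"

text \<open>
  An arbitrary enumeration of the variables: partial derivatives of smooth functions commute, so
  its choice does not affect the action of monomial operators on smooth functions.
\<close>

definition var_enum :: "'n::finite list" where
  "var_enum = (SOME js. distinct js \<and> set js = UNIV)"

definition D_monom :: "('n::finite \<Rightarrow>\<^sub>0 nat) \<Rightarrow> (real ^ 'n \<Rightarrow> complex) \<Rightarrow> real ^ 'n \<Rightarrow> complex" where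
  "D_monom m f = foldr (\<lambda>j. D_partial j ^^ Poly_Mapping.lookup m j) var_enum f"

definition D_apply :: "'n::finite cpoly \<Rightarrow> (real ^ 'n \<Rightarrow> complex) \<Rightarrow> real ^ 'n \<Rightarrow> complex" where
  "D_apply r f = (\<lambda>x. \<Sum>m\<in>Poly_Mapping.keys r. Poly_Mapping.lookup r m * D_monom m f x)"


subsection \<open>The signal space\<close>

definition signals :: "(real ^ 'n::finite \<Rightarrow> complex) set" where
  "signals = {f. \<exists>(A :: (int ^ 'n) set) (p :: int ^ 'n \<Rightarrow> 'n cpoly). finite A \<and>
     f = (\<lambda>x. \<Sum>a\<in>A. cpoly_eval (p a) (\<chi> j. complex_of_real (x $ j)) *
                exp (\<i> * complex_of_real (\<Sum>j\<in>UNIV. of_int (a $ j) * x $ j)))}"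


subsection \<open>Behaviors and Willems closure\<close>

definition behavior_of ::
  "('n::finite cpoly ^ 'q::finite) set \<Rightarrow> ((real ^ 'n \<Rightarrow> complex) ^ 'q) set" where
  "behavior_of M = {f. (\<forall>j. f $ j \<in> signals) \<and>
     (\<forall>r\<in>M. (\<lambda>x. \<Sum>j\<in>UNIV. D_apply (r $ j) (f $ j) x) = (\<lambda>x. 0))}"

definition annihilator_of ::
  "((real ^ 'n \<Rightarrow> complex) ^ 'q) set \<Rightarrow> ('n::finite cpoly ^ 'q::finite) set" where
  "annihilator_of B = {r. \<forall>f\<in>B. (\<lambda>x. \<Sum>j\<in>UNIV. D_apply (r $ j) (f $ j) x) = (\<lambda>x. 0)}"

definition willems_closure :: "('n::finite cpoly ^ 'q::finite) set \<Rightarrow> ('n cpoly ^ 'q) set" where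
  "willems_closure M = annihilator_of (behavior_of M)"

text \<open>Image of the map from \<open>p\<close>-tuples to \<open>q\<close>-tuples of signals given by the \<open>q \<times> p\<close> matrix \<open>L\<close>,
  of which only the columns with index below \<open>p\<close> are used.\<close>

definition operator_image ::
  "nat \<Rightarrow> ('q::finite \<Rightarrow> nat \<Rightarrow> 'n::finite cpoly) \<Rightarrow> ((real ^ 'n \<Rightarrow> complex) ^ 'q) set" where
  "operator_image p L = {f. \<exists>g :: nat \<Rightarrow> real ^ 'n \<Rightarrow> complex. (\<forall>k<p. g k \<in> signals) \<and>
     (\<forall>i. f $ i = (\<lambda>x. \<Sum>k<p. D_apply (L i k) (g k) x))}"


subsection \<open>Submodules, ideals and varieties\<close>

lemma module_cpoly_vec: "module ((*s) :: 'a::comm_ring_1 \<Rightarrow> 'a ^ 'q \<Rightarrow> 'a ^ 'q)"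
  by unfold_locales (simp_all add: vec_eq_iff algebra_simps)

lemma module_cpoly_self: "module ((*) :: 'a::comm_ring_1 \<Rightarrow> 'a \<Rightarrow> 'a)"
  by unfold_locales (simp_all add: algebra_simps)

abbreviation is_D_submodule :: "('n::finite cpoly ^ 'q::finite) set \<Rightarrow> bool" where
  "is_D_submodule M \<equiv> module.subspace (*s) M"

abbreviation is_D_ideal :: "'n::finite cpoly set \<Rightarrow> bool" where
  "is_D_ideal I \<equiv> module.subspace (*) I"

definition is_D_prime :: "'n::finite cpoly set \<Rightarrow> bool" where
  "is_D_prime P \<longleftrightarrow> is_D_ideal P \<and> P \<noteq> UNIV \<and> (\<forall>r s. r * s \<in> P \<longrightarrow> r \<in> P \<or> s \<in> P)"

definition D_variety :: "'n::finite cpoly set \<Rightarrow> (complex ^ 'n) set" where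
  "D_variety I = {a. \<forall>L\<in>I. cpoly_eval L a = 0}"

definition integral_points :: "(complex ^ 'n::finite) set" where
  "integral_points = {a. \<forall>j. a $ j \<in> \<int>}"

definition point_ideal :: "complex ^ 'n::finite \<Rightarrow> 'n cpoly set" where
  "point_ideal b = module.span (*) (range (\<lambda>j. cpoly_var j - cpoly_const (b $ j)))"

text \<open>Quotient modules \<open>N / M\<close> are represented by the pair \<open>M \<subseteq> N\<close>: a scalar \<open>r\<close> kills the class
  of \<open>x\<close> iff \<open>r x \<in> M\<close>.\<close>

definition quotient_annihilator ::
  "('n::finite cpoly ^ 'q::finite) set \<Rightarrow> ('n cpoly ^ 'q) set \<Rightarrow> 'n cpoly set" where
  "quotient_annihilator N M = {r. \<forall>x\<in>N. r *s x \<in> M}"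

definition quotient_support ::
  "('n::finite cpoly ^ 'q::finite) set \<Rightarrow> ('n cpoly ^ 'q) set \<Rightarrow> (complex ^ 'n) set" where
  "quotient_support N M = D_variety (quotient_annihilator N M)"

text \<open>Associated primes of the quotient of the full free module by \<open>M\<close>: the prime ideals that are
  annihilators of a single class.\<close>

definition associated_primes ::
  "('n::finite cpoly ^ 'q::finite) set \<Rightarrow> 'n cpoly set set" where
  "associated_primes M = {P. is_D_prime P \<and> (\<exists>x. P = {r. r *s x \<in> M})}"

definition is_primary_submodule ::
  "'n::finite cpoly set \<Rightarrow> ('n cpoly ^ 'q::finite) set \<Rightarrow> bool" where
  "is_primary_submodule P N \<longleftrightarrow> is_D_submodule N \<and> associated_primes N = {P}"

definition irredundant_primary_decomposition ::
  "('n::finite cpoly ^ 'q::finite) set \<Rightarrow> nat \<Rightarrow> (nat \<Rightarrow> ('n cpoly ^ 'q) set) \<Rightarrow>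
   (nat \<Rightarrow> 'n cpoly set) \<Rightarrow> bool" where
  "irredundant_primary_decomposition M t N P \<longleftrightarrow>
     M = (\<Inter>i\<in>{1..t}. N i) \<and>
     (\<forall>i\<in>{1..t}. is_primary_submodule (P i) (N i)) \<and>
     inj_on P {1..t} \<and>
     (\<forall>i\<in>{1..t}. M \<noteq> (\<Inter>k\<in>{1..t} - {i}. N k)) \<and>
     P ` {1..t} = associated_primes M"

end

theory Submission
  imports Defs "HOL-Library.Function_Algebras"
begin

text \<open>
  The signal space splits into the spaces of polynomial multiples of \<open>exp (\<i> \<langle>b, x\<rangle>)\<close>, \<open>b\<close> integral, and
  \<open>g \<mapsto> (r \<mapsto> (r g)(0))\<close> identifies the summand at \<open>b\<close> with the functionals on the operator ring
  that vanish on a power of the maximal ideal of \<open>b\<close>. Under this duality every linear functional on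
  a submodule \<open>U\<close> that vanishes on a submodule \<open>W\<close> with \<open>U / W\<close> nilpotent at \<open>b\<close> comes from a
  signal vector of frequency \<open>b\<close>. This single extension property yields both the
  local description of the Willems closure (with \<open>U = \<D> x + M\<close> and evaluation at \<open>b\<close> as functional)
  and the solvability of \<open>L(D) g = f\<close> under its compatibility conditions (with \<open>U\<close> the row module
  of \<open>L\<close>). If no nonzero associated prime has an integral point, the closure is torsion-closed, hence
  the kernel of a matrix, and the behavior is the image of the transposed operator.
\<close>

subsection \<open>Polynomials as finitely supported functions\<close>

text \<open>Algebraically the summand at b is the injective hull of the simple module D/m_b, with
  m_b the maximal ideal of b, so the extension property is injectivity of these hulls. The obstacle:
  a functional on \<open>U\<close> killed by a power of m_b must be extended to the whole free
  module so that some power still kills it, since only such functionals come from signals. This is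
  where noetherianity enters. The same chain condition takes the place of localization at b: one
  operator not vanishing at b clears all denominators at once, and
  \<open>{z. d *s z \<in> M}\<close> is then the kernel of the map from the free module to the
  localized quotient. In (3) it matters that the integral points are Zariski dense: no nonzero
  operator annihilates all exponentials of integral frequency, so if \<open>r *s x\<close>
  annihilates an image and \<open>r \<noteq> 0\<close>, then \<open>x\<close> does too. Torsion of
  the quotient is therefore compatible with an image only if it dies at every integral
  point.\<close>

lemma poly_mapping_sum_single:
  "(\<Sum>m\<in>Poly_Mapping.keys r. Poly_Mapping.single m (Poly_Mapping.lookup r m)) = r"
  for r :: "'a \<Rightarrow>\<^sub>0 'b::comm_monoid_add"
proof (rule poly_mapping_eqI)
  fix k
  show "Poly_Mapping.lookup (\<Sum>m\<in>Poly_Mapping.keys r. Poly_Mapping.single m (Poly_Mapping.lookup r m)) k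
      = Poly_Mapping.lookup r k"
    by (cases "k \<in> Poly_Mapping.keys r")
       (auto simp: lookup_sum lookup_single when_def sum.delta in_keys_iff)
qed

lemma poly_mapping_single_induct [case_names zero single_add]:
  fixes r :: "'a \<Rightarrow>\<^sub>0 'b::comm_monoid_add"
  assumes "P 0" and "\<And>m c r. P r \<Longrightarrow> P (Poly_Mapping.single m c + r)"
  shows "P r"
proof -
  have "P (\<Sum>m\<in>A. Poly_Mapping.single m (Poly_Mapping.lookup r m))" if "finite A" for A
    using that by (induction A) (auto simp: assms)
  from this[of "Poly_Mapping.keys r"] show ?thesis
    by (simp add: poly_mapping_sum_single)
qed

text \<open>Evaluation at a point and the operator action are both of this shape, the second with
  \<open>\<phi> m = D_monom m f x\<close>, so \<open>lin_ext_mult\<close> serves both product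
  rules.\<close>

definition lin_ext :: "('a \<Rightarrow>\<^sub>0 complex) \<Rightarrow> ('a \<Rightarrow> complex) \<Rightarrow> complex" where
  "lin_ext r \<phi> = (\<Sum>m\<in>Poly_Mapping.keys r. Poly_Mapping.lookup r m * \<phi> m)"

lemma lin_ext_zero [simp]: "lin_ext 0 \<phi> = 0"
  by (simp add: lin_ext_def)

lemma lin_ext_single [simp]: "lin_ext (Poly_Mapping.single m c) \<phi> = c * \<phi> m"
  by (cases "c = 0") (auto simp: lin_ext_def)

lemma lin_ext_add: "lin_ext (r + s) \<phi> = lin_ext r \<phi> + lin_ext s \<phi>"
  unfolding lin_ext_def by (rule setsum_keys_plus_distrib) (auto simp: algebra_simps)

lemma lin_ext_add_fun: "lin_ext r (\<lambda>m. \<phi> m + \<psi> m) = lin_ext r \<phi> + lin_ext r \<psi>"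
  unfolding lin_ext_def by (simp add: sum.distrib algebra_simps)

lemma lin_ext_scale_fun: "lin_ext r (\<lambda>m. c * \<phi> m) = c * lin_ext r \<phi>"
  unfolding lin_ext_def by (simp add: sum_distrib_left algebra_simps)

lemma lin_ext_mult:
  fixes r s :: "'a::comm_monoid_add \<Rightarrow>\<^sub>0 complex"
  shows "lin_ext (r * s) \<phi> = lin_ext r (\<lambda>m. lin_ext s (\<lambda>m'. \<phi> (m + m')))"
proof (induction r rule: poly_mapping_single_induct)
  case (single_add m c r)
  have "lin_ext (Poly_Mapping.single m c * s) \<phi> = c * lin_ext s (\<lambda>m'. \<phi> (m + m'))"
    by (induction s rule: poly_mapping_single_induct)
       (auto simp: algebra_simps lin_ext_add mult_single)
  with single_add show ?case
    by (simp add: algebra_simps lin_ext_add)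
qed simp

lemma cpoly_eval_lin_ext:
  "cpoly_eval L a = lin_ext L (\<lambda>m. \<Prod>j\<in>UNIV. (a $ j) ^ Poly_Mapping.lookup m j)"
  by (simp add: cpoly_eval_def lin_ext_def)

lemma cpoly_eval_add [simp]: "cpoly_eval (r + s) a = cpoly_eval r a + cpoly_eval s a"
  by (simp add: cpoly_eval_lin_ext lin_ext_add)

lemma cpoly_eval_zero [simp]: "cpoly_eval 0 a = 0"
  by (simp add: cpoly_eval_lin_ext)

lemma cpoly_eval_mult [simp]: "cpoly_eval (r * s) a = cpoly_eval r a * cpoly_eval s a"
proof -
  have "cpoly_eval (r * s) a = lin_ext r (\<lambda>m. (\<Prod>j\<in>UNIV. (a $ j) ^ Poly_Mapping.lookup m j) * cpoly_eval s a)"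
    by (simp add: cpoly_eval_lin_ext lin_ext_mult lookup_add power_add prod.distrib lin_ext_scale_fun)
  also have "\<dots> = lin_ext r (\<lambda>m. cpoly_eval s a * (\<Prod>j\<in>UNIV. (a $ j) ^ Poly_Mapping.lookup m j))"
    by (simp add: mult.commute)
  finally show ?thesis
    by (simp add: lin_ext_scale_fun cpoly_eval_lin_ext[symmetric] mult.commute)
qed

lemma cpoly_eval_const [simp]: "cpoly_eval (cpoly_const c) a = c"
  by (simp add: cpoly_const_def cpoly_eval_lin_ext)

lemma cpoly_const_0 [simp]: "cpoly_const 0 = 0"
  by (simp add: cpoly_const_def)

lemma cpoly_const_1 [simp]: "cpoly_const 1 = 1"
  by (simp add: cpoly_const_def)

lemma cpoly_const_add: "cpoly_const (c + d) = cpoly_const c + cpoly_const d"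
  by (simp add: cpoly_const_def single_add)

lemma cpoly_const_mult: "cpoly_const (c * d) = cpoly_const c * cpoly_const d"
  by (simp add: cpoly_const_def mult_single)

lemma cpoly_const_diff: "cpoly_const (c - d) = cpoly_const c - cpoly_const d"
  by (simp add: cpoly_const_def single_diff)

lemma cpoly_eval_one [simp]: "cpoly_eval 1 a = 1"
  using cpoly_eval_const[of 1 a] by simp

lemma cpoly_eval_uminus [simp]: "cpoly_eval (- r) a = - cpoly_eval r a"
  using cpoly_eval_add[of r "- r" a] by (simp add: eq_neg_iff_add_eq_0 add.commute)

lemma cpoly_eval_diff [simp]: "cpoly_eval (r - s) a = cpoly_eval r a - cpoly_eval s a"
  using cpoly_eval_add[of r "- s" a] by simp

lemma cpoly_eval_prod [simp]: "cpoly_eval (\<Prod>x\<in>A. f x) a = (\<Prod>x\<in>A. cpoly_eval (f x) a)"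
  by (induction A rule: infinite_finite_induct) auto

lemma cpoly_eval_power [simp]: "cpoly_eval (r ^ k) a = cpoly_eval r a ^ k"
  by (induction k) auto

lemma cpoly_eval_var [simp]: "cpoly_eval (cpoly_var j) a = a $ j"
proof -
  have "(\<Prod>k\<in>UNIV. (a $ k) ^ (Poly_Mapping.lookup (Poly_Mapping.single j 1) k)) =
        (\<Prod>k\<in>UNIV. if k = j then a $ k else 1)"
    by (rule prod.cong) (auto simp: lookup_single when_def)
  then show ?thesis
    by (simp add: cpoly_var_def cpoly_eval_lin_ext)
qed

lemma cpoly_var_power: "cpoly_var j ^ k = Poly_Mapping.single (Poly_Mapping.single j k) 1"
  by (induction k) (auto simp: cpoly_var_def mult_single single_add[symmetric])

lemma prod_single:
  "(\<Prod>j\<in>A. Poly_Mapping.single (f j) (1::complex)) = Poly_Mapping.single (\<Sum>j\<in>A. f j) 1"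
  by (induction A rule: infinite_finite_induct) (auto simp: mult_single)

lemma sum_single_lookup:
  fixes m :: "'n::finite \<Rightarrow>\<^sub>0 nat"
  shows "(\<Sum>j\<in>UNIV. Poly_Mapping.single j (Poly_Mapping.lookup m j)) = m"
  by (rule poly_mapping_eqI) (auto simp: lookup_sum lookup_single when_def)

lemma single_eq_prod_var:
  fixes m :: "'n::finite \<Rightarrow>\<^sub>0 nat"
  shows "Poly_Mapping.single m c = cpoly_const c * (\<Prod>j\<in>UNIV. cpoly_var j ^ Poly_Mapping.lookup m j)"
  by (simp add: cpoly_var_power prod_single sum_single_lookup cpoly_const_def mult_single)

lemma cpoly_induct [case_names const add mult_var]:
  fixes r :: "'n::finite cpoly"
  assumes const: "\<And>c. P (cpoly_const c)"
    and add: "\<And>r s. P r \<Longrightarrow> P s \<Longrightarrow> P (r + s)"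
    and mult: "\<And>r j. P r \<Longrightarrow> P (r * cpoly_var j)"
  shows "P r"
proof (induction r rule: poly_mapping_single_induct)
  case zero
  show ?case using const[of 0] by simp
next
  case (single_add m c r)
  have pow: "P (s * cpoly_var j ^ k)" if "P s" for s j k
    using that
  proof (induction k)
    case (Suc k)
    then show ?case using mult[of "s * cpoly_var j ^ k" j] by (simp add: algebra_simps)
  qed simp
  have "P (cpoly_const c * (\<Prod>j\<in>A. cpoly_var j ^ Poly_Mapping.lookup m j))" if "finite A" for A
    using that
  proof (induction A)
    case (insert j A)
    then show ?case using pow[OF insert.IH, of j "Poly_Mapping.lookup m j"]
      by (simp add: algebra_simps)
  qed (simp add: const)
  then show ?case
    using add single_add by (simp add: single_eq_prod_var)
qed

subsection \<open>Point ideals\<close>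

interpretation cmod: module "(*) :: 'n::finite cpoly \<Rightarrow> 'n cpoly \<Rightarrow> 'n cpoly"
  by (rule module_cpoly_self)

interpretation vmod: module "(*s) :: 'n::finite cpoly \<Rightarrow> 'n cpoly ^ 'q \<Rightarrow> 'n cpoly ^ 'q"
  by (rule module_cpoly_vec)

lemma point_ideal_eq: "point_ideal b = {r. cpoly_eval r b = 0}"
proof
  have "cmod.subspace {r. cpoly_eval r b = 0}"
    by (auto simp: cmod.subspace_def)
  then show "point_ideal b \<subseteq> {r. cpoly_eval r b = 0}"
    unfolding point_ideal_def by (intro cmod.span_minimal) auto
next
  \<comment> \<open>The remainder of \<open>r\<close> modulo the point ideal is its value at
    \<open>b\<close>. For a product with a variable: r x_j - r(b) b_j = r (x_j - b_j) + b_j (r -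
    r(b)).\<close>
  have "r - cpoly_const (cpoly_eval r b) \<in> point_ideal b" for r
  proof (induction r rule: cpoly_induct)
    case (const c)
    then show ?case by (simp add: point_ideal_def cmod.span_zero)
  next
    case (add r s)
    then have "(r - cpoly_const (cpoly_eval r b)) + (s - cpoly_const (cpoly_eval s b)) \<in> point_ideal b"
      unfolding point_ideal_def by (rule cmod.span_add)
    then show ?case by (simp add: cpoly_const_add algebra_simps)
  next
    case (mult_var r j)
    have "cpoly_var j - cpoly_const (b $ j) \<in> point_ideal b"
      unfolding point_ideal_def by (auto intro: cmod.span_base)
    then have "r * (cpoly_var j - cpoly_const (b $ j))
        + cpoly_const (b $ j) * (r - cpoly_const (cpoly_eval r b)) \<in> point_ideal b"
      using mult_var unfolding point_ideal_def
      by (intro cmod.span_add cmod.span_scale)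
    then show ?case by (simp add: algebra_simps cpoly_const_mult)
  qed
  then show "{r. cpoly_eval r b = 0} \<subseteq> point_ideal b"
    by (metis (mono_tags, lifting) cpoly_const_0 diff_zero mem_Collect_eq subsetI)
qed

subsection \<open>Nonvanishing at integral points\<close>

text \<open>With weights \<open>k ^ ix j\<close> the sum for \<open>v\<close> is the value at
  \<open>k\<close> of a nonzero one-variable polynomial with coefficients \<open>v j\<close>.
  Finitely many such polynomials have finitely many roots, so some natural \<open>k\<close> works
  for all of \<open>V\<close>.\<close>

lemma exists_separating_weight:
  fixes V :: "('n::finite \<Rightarrow> int) set"
  assumes "finite V" and "\<And>v. v \<in> V \<Longrightarrow> \<exists>j. v j \<noteq> 0"
  shows "\<exists>w :: 'n \<Rightarrow> nat. \<forall>v\<in>V. (\<Sum>j\<in>UNIV. v j * int (w j)) \<noteq> 0"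
proof -
  obtain ix :: "'n \<Rightarrow> nat" where ix: "inj ix"
    using finite_imp_inj_to_nat_seg[of "UNIV :: 'n set"] by (auto simp: finite)
  define P where "P v = (\<Sum>j\<in>UNIV. monom (v j) (ix j))" for v :: "'n \<Rightarrow> int"
  have "P v \<noteq> 0" if v: "v \<in> V" for v
  proof -
    obtain j where j: "v j \<noteq> 0" using assms(2)[OF v] by auto
    have "coeff (P v) (ix j) = (\<Sum>k\<in>UNIV. if k = j then v k else 0)"
      unfolding P_def coeff_sum by (rule sum.cong) (auto simp: inj_eq[OF ix])
    with j have "coeff (P v) (ix j) \<noteq> 0" by simp
    then show ?thesis by auto
  qed
  then have "finite (\<Union>v\<in>V. {t. poly (P v) t = 0})"
    using assms(1) by (auto intro!: poly_roots_finite)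
  moreover have "infinite (range int)"
    by (simp add: finite_image_iff)
  ultimately obtain t where t: "t \<in> range int" "t \<notin> (\<Union>v\<in>V. {t. poly (P v) t = 0})"
    by (meson finite_subset subsetI)
  then obtain k where k: "t = int k" by auto
  have "(\<Sum>j\<in>UNIV. v j * int (k ^ ix j)) = poly (P v) t" for v
    by (simp add: P_def poly_sum poly_monom k)
  with t(2) show ?thesis by (intro exI[of _ "\<lambda>j. k ^ ix j"]) auto
qed

text \<open>Restrict both polynomials to a monomial curve with coordinates \<open>t ^ w j\<close>.
  The weights keep distinct exponents distinct, so both restrictions stay nonzero in one variable,
  and integers \<open>t\<close> give integral points. A common point for two polynomials also shows
  that the ring has no zero divisors.\<close>

lemma cpoly_nonvanishing_pair:
  fixes r s :: "'n::finite cpoly"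
  assumes "r \<noteq> 0" and "s \<noteq> 0"
  shows "\<exists>a\<in>integral_points. cpoly_eval r a \<noteq> 0 \<and> cpoly_eval s a \<noteq> 0"
proof -
  \<comment> \<open>Differences of distinct exponents of \<open>q\<close>: if their weighted sums do
    not vanish, the weighted degree \<open>W\<close> is injective on the keys and no two
    coefficients merge in \<open>K q\<close>.\<close>
  define diffs where "diffs q = (\<lambda>(m, m') j. int (Poly_Mapping.lookup m j) - int (Poly_Mapping.lookup m' j))
      ` {(m, m'). m \<in> Poly_Mapping.keys q \<and> m' \<in> Poly_Mapping.keys q \<and> m \<noteq> m'}"
    for q :: "'n cpoly"
  have fin: "finite (diffs q)" for q
    unfolding diffs_def
    by (rule finite_imageI, rule finite_subset[of _ "Poly_Mapping.keys q \<times> Poly_Mapping.keys q"]) auto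
  have ne: "\<exists>j. v j \<noteq> 0" if "v \<in> diffs q" for q v
    using that unfolding diffs_def by (auto simp: poly_mapping_eq_iff fun_eq_iff)
  obtain w :: "'n \<Rightarrow> nat" where w: "\<And>v. v \<in> diffs r \<union> diffs s \<Longrightarrow> (\<Sum>j\<in>UNIV. v j * int (w j)) \<noteq> 0"
    using exists_separating_weight[of "diffs r \<union> diffs s"] fin ne by blast
  define W where "W m = (\<Sum>j\<in>UNIV. Poly_Mapping.lookup m j * w j)" for m :: "'n \<Rightarrow>\<^sub>0 nat"
  define K where "K q = (\<Sum>m\<in>Poly_Mapping.keys q. monom (Poly_Mapping.lookup q m) (W m))" for q :: "'n cpoly"
  have K_nz: "K q \<noteq> 0" if "q \<noteq> 0" "diffs q \<subseteq> diffs r \<union> diffs s" for q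
  proof -
    obtain m where m: "m \<in> Poly_Mapping.keys q"
      using \<open>q \<noteq> 0\<close> by (auto simp: poly_mapping_eq_iff fun_eq_iff in_keys_iff)
    have inj: "m' = m" if "m' \<in> Poly_Mapping.keys q" "W m' = W m" for m'
    proof (rule ccontr)
      assume "m' \<noteq> m"
      then have "(\<lambda>j. int (Poly_Mapping.lookup m' j) - int (Poly_Mapping.lookup m j)) \<in> diffs q"
        using m that(1) unfolding diffs_def by auto
      with \<open>diffs q \<subseteq> _\<close> have "(\<Sum>j\<in>UNIV. (int (Poly_Mapping.lookup m' j) - int (Poly_Mapping.lookup m j)) * int (w j)) \<noteq> 0"
        using w by blast
      moreover have "(\<Sum>j\<in>UNIV. (int (Poly_Mapping.lookup m' j) - int (Poly_Mapping.lookup m j)) * int (w j)) = int (W m') - int (W m)"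
        by (simp add: W_def algebra_simps sum_subtractf)
      ultimately show False using that(2) by simp
    qed
    have "coeff (K q) (W m) = (\<Sum>m'\<in>Poly_Mapping.keys q. if m' = m then Poly_Mapping.lookup q m' else 0)"
      unfolding K_def coeff_sum by (rule sum.cong) (auto dest: inj)
    with m have "coeff (K q) (W m) \<noteq> 0" by (simp add: in_keys_iff)
    then show ?thesis by auto
  qed
  have "K r * K s \<noteq> 0" using K_nz[of r] K_nz[of s] assms by auto
  then have "finite {t. poly (K r * K s) t = 0}" by (rule poly_roots_finite)
  moreover have "infinite (range (of_int :: int \<Rightarrow> complex))"
    by (simp add: finite_image_iff inj_on_def)
  ultimately obtain t where t: "t \<in> range (of_int :: int \<Rightarrow> complex)" "poly (K r * K s) t \<noteq> 0"
    by (metis (mono_tags, lifting) finite_subset mem_Collect_eq subsetI)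
  have ev: "cpoly_eval q (\<chi> j. t ^ w j) = poly (K q) t" for q
    by (simp add: cpoly_eval_def K_def poly_sum poly_monom W_def power_sum power_mult[symmetric] mult.commute)
  have "(\<chi> j. t ^ w j) \<in> integral_points"
    using t(1) by (auto simp: integral_points_def)
  then show ?thesis using t(2) ev by (intro bexI[of _ "\<chi> j. t ^ w j"]) auto
qed

lemma cpoly_mult_nonzero: "r \<noteq> 0 \<Longrightarrow> s \<noteq> 0 \<Longrightarrow> r * s \<noteq> 0" for r s :: "'n::finite cpoly"
  using cpoly_nonvanishing_pair[of r s] by (metis cpoly_eval_mult cpoly_eval_zero mult_eq_0_iff)

lemma cpoly_prod_nonzero: "(\<And>x. x \<in> A \<Longrightarrow> f x \<noteq> 0) \<Longrightarrow> (\<Prod>x\<in>A. f x) \<noteq> (0 :: 'n::finite cpoly)"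
proof (induction A rule: infinite_finite_induct)
  case (insert x F)
  then show ?case by (simp add: cpoly_mult_nonzero)
qed auto

subsection \<open>Polynomial-exponential functions\<close>

lemma sum_fun_apply: "(\<Sum>a\<in>A. h a) x = (\<Sum>a\<in>A. h a x)"
  for h :: "'i \<Rightarrow> 'a \<Rightarrow> 'b::comm_monoid_add"
  by (induction A rule: infinite_finite_induct) auto

definition pexp :: "int ^ 'n::finite \<Rightarrow> ('n \<Rightarrow>\<^sub>0 nat) \<Rightarrow> real ^ 'n \<Rightarrow> complex" where
  "pexp a m x = (\<Prod>j\<in>UNIV. complex_of_real (x $ j) ^ Poly_Mapping.lookup m j) *
     exp (\<i> * complex_of_real (\<Sum>j\<in>UNIV. of_int (a $ j) * x $ j))"

text \<open>Generation one term at a time provides the induction along which derivatives and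
  frequency decompositions of signals are built.\<close>

inductive_set polyexp :: "(real ^ 'n::finite \<Rightarrow> complex) set" where
  zero: "0 \<in> polyexp"
| add_pexp: "f \<in> polyexp \<Longrightarrow> f + (\<lambda>x. c * pexp a m x) \<in> polyexp"

lemma polyexp_add:
  assumes "f \<in> polyexp" "g \<in> polyexp"
  shows "f + g \<in> polyexp"
  using assms(2)
proof induction
  case (add_pexp g c a m)
  show ?case using polyexp.add_pexp[OF add_pexp.IH, of c a m] by (metis add.assoc)
qed (simp add: assms(1))

lemma scaled_pexp_in_polyexp: "(\<lambda>x. c * pexp a m x) \<in> polyexp"
  using polyexp.add_pexp[OF polyexp.zero, of c a m] by simp

lemma pexp_in_polyexp: "pexp a m \<in> polyexp"
  using scaled_pexp_in_polyexp[of 1] by simp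

lemma polyexp_scale:
  assumes "f \<in> polyexp"
  shows "(\<lambda>x. c * f x) \<in> polyexp"
  using assms
proof induction
  case zero
  show ?case using polyexp.zero by (simp add: zero_fun_def)
next
  case (add_pexp f d a m)
  have "(\<lambda>x. c * (f + (\<lambda>x. d * pexp a m x)) x) = (\<lambda>x. c * f x) + (\<lambda>x. (c * d) * pexp a m x)"
    by (rule ext) (simp add: distrib_left)
  then show ?case using polyexp.add_pexp[OF add_pexp.IH] by metis
qed

lemma polyexp_sum: "(\<And>a. a \<in> A \<Longrightarrow> h a \<in> polyexp) \<Longrightarrow> (\<Sum>a\<in>A. h a) \<in> polyexp"
  by (induction A rule: infinite_finite_induct) (auto intro: polyexp.zero polyexp_add)

lemma signals_eq_polyexp: "signals = polyexp"
proof
  have *: "(\<lambda>x. cpoly_eval p (\<chi> j. complex_of_real (x $ j)) *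
        exp (\<i> * complex_of_real (\<Sum>j\<in>UNIV. of_int (a $ j) * x $ j))) \<in> polyexp"
    for p :: "'a cpoly" and a
  proof (induction p rule: poly_mapping_single_induct)
    case zero
    then show ?case using polyexp.zero by (simp add: zero_fun_def)
  next
    case (single_add m c r)
    have "(\<lambda>x. cpoly_eval (Poly_Mapping.single m c + r) (\<chi> j. complex_of_real (x $ j)) *
        exp (\<i> * complex_of_real (\<Sum>j\<in>UNIV. of_int (a $ j) * x $ j))) =
      (\<lambda>x. cpoly_eval r (\<chi> j. complex_of_real (x $ j)) *
        exp (\<i> * complex_of_real (\<Sum>j\<in>UNIV. of_int (a $ j) * x $ j))) + (\<lambda>x. c * pexp a m x)"
      by (rule ext) (simp add: pexp_def cpoly_eval_lin_ext lin_ext_add distrib_right mult.assoc)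
    then show ?case using polyexp.add_pexp[OF single_add, of c a m] by simp
  qed
  show "signals \<subseteq> (polyexp :: (real ^ 'a \<Rightarrow> complex) set)"
  proof
    fix f :: "real ^ 'a \<Rightarrow> complex" assume "f \<in> signals"
    then obtain A p where A: "finite A" and f: "f = (\<lambda>x. \<Sum>a\<in>A. cpoly_eval (p a) (\<chi> j. complex_of_real (x $ j)) *
                exp (\<i> * complex_of_real (\<Sum>j\<in>UNIV. of_int (a $ j) * x $ j)))"
      unfolding signals_def by blast
    have "f = (\<Sum>a\<in>A. (\<lambda>x. cpoly_eval (p a) (\<chi> j. complex_of_real (x $ j)) *
                exp (\<i> * complex_of_real (\<Sum>j\<in>UNIV. of_int (a $ j) * x $ j))))"
      unfolding f by (rule ext) (simp add: sum_fun_apply)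
    also have "\<dots> \<in> polyexp" by (intro polyexp_sum *)
    finally show "f \<in> polyexp" .
  qed
  show "polyexp \<subseteq> (signals :: (real ^ 'a \<Rightarrow> complex) set)"
  proof
    fix f :: "real ^ 'a \<Rightarrow> complex" assume "f \<in> polyexp"
    then show "f \<in> signals"
    proof induction
      case zero
      show ?case unfolding signals_def
        by (intro CollectI exI[of _ "{}"] exI[of _ "\<lambda>_. 0"]) (auto simp: zero_fun_def)
    next
      case (add_pexp f c a m)
      then obtain A p where A: "finite A" and f: "f = (\<lambda>x. \<Sum>a\<in>A. cpoly_eval (p a) (\<chi> j. complex_of_real (x $ j)) *
                exp (\<i> * complex_of_real (\<Sum>j\<in>UNIV. of_int (a $ j) * x $ j)))"
        unfolding signals_def by blast
      \<comment> \<open>Padding by 0 allows the frequency \<open>a\<close> to be inserted whether or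
        not it already occurs in \<open>A\<close>.\<close>
      define q where "q b = (if b \<in> A then p b else 0)" for b
      define e where "e b x = exp (\<i> * complex_of_real (\<Sum>j\<in>UNIV. of_int (b $ j) * x $ j))"
        for b :: "int ^ 'a" and x :: "real ^ 'a"
      define X where "X x = (\<chi> j. complex_of_real (x $ j))" for x :: "real ^ 'a"
      have "f x = (\<Sum>b\<in>insert a A. cpoly_eval (q b) (X x) * e b x)" for x
      proof -
        have "(\<Sum>b\<in>insert a A. cpoly_eval (q b) (X x) * e b x) = (\<Sum>b\<in>A. cpoly_eval (q b) (X x) * e b x)"
          using A by (intro sum.mono_neutral_right) (auto simp: q_def)
        also have "\<dots> = f x"
          unfolding f X_def e_def by (rule sum.cong) (auto simp: q_def)
        finally show ?thesis by simp
      qed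
      moreover have "c * pexp a m x = (\<Sum>b\<in>insert a A. cpoly_eval (if b = a then Poly_Mapping.single m c else 0) (X x) * e b x)" for x
      proof -
        have "(\<Sum>b\<in>insert a A. cpoly_eval (if b = a then Poly_Mapping.single m c else 0) (X x) * e b x) =
            (\<Sum>b\<in>insert a A. if b = a then c * pexp a m x else 0)"
          by (rule sum.cong) (auto simp: cpoly_eval_lin_ext pexp_def X_def e_def)
        then show ?thesis using A by simp
      qed
      ultimately have "f + (\<lambda>x. c * pexp a m x) = (\<lambda>x. \<Sum>b\<in>insert a A.
          cpoly_eval (q b + (if b = a then Poly_Mapping.single m c else 0)) (X x) * e b x)"
        by (intro ext) (simp only: plus_fun_apply cpoly_eval_add distrib_right sum.distrib)
      then show ?case
        unfolding signals_def X_def e_def using A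
        by (intro CollectI exI[of _ "insert a A"]
            exI[of _ "\<lambda>b. q b + (if b = a then Poly_Mapping.single m c else 0)"]) simp
    qed
  qed
qed

lemma signals_zero: "0 \<in> signals"
  and signals_add: "f \<in> signals \<Longrightarrow> g \<in> signals \<Longrightarrow> f + g \<in> signals"
  and signals_scale: "f \<in> signals \<Longrightarrow> (\<lambda>x. c * f x) \<in> signals"
  and signals_sum: "(\<And>a. a \<in> A \<Longrightarrow> h a \<in> signals) \<Longrightarrow> (\<Sum>a\<in>A. h a) \<in> signals"
  and pexp_in_signals: "pexp a m \<in> signals"
  unfolding signals_eq_polyexp
  by (fact polyexp.zero polyexp_add polyexp_scale pexp_in_polyexp, simp_all add: polyexp_add polyexp_scale polyexp_sum pexp_in_polyexp)

lemma signals_induct [consumes 1, case_names zero add_pexp]: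
  assumes "f \<in> signals" and "P 0"
    and "\<And>f c a m. f \<in> signals \<Longrightarrow> P f \<Longrightarrow> P (f + (\<lambda>x. c * pexp a m x))"
  shows "P f"
  using assms(1) unfolding signals_eq_polyexp
proof induction
  case zero
  show ?case using assms(2) unfolding zero_fun_def .
next
  case (add_pexp f c a m)
  then show ?case using assms(3)[of f c a m] unfolding signals_eq_polyexp plus_fun_def by blast
qed

subsection \<open>Partial derivatives of polynomial-exponential functions\<close>

text \<open>Records existence of the derivative together with its value: \<open>D_partial\<close>
  alone is a choice that need not obey a sum rule where the derivative does not exist.\<close>

definition has_partial where
  "has_partial j f f' \<longleftrightarrow>
     (\<forall>x. ((\<lambda>t. f (x + t *\<^sub>R axis j 1)) has_vector_derivative f' x) (at 0))"
  for f :: "real ^ 'n::finite \<Rightarrow> complex"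

lemma D_partial_eq: "has_partial j f f' \<Longrightarrow> D_partial j f = (\<lambda>x. - \<i> * f' x)"
  unfolding has_partial_def D_partial_def by (auto simp: vector_derivative_at fun_eq_iff)

lemma has_partial_pexp:
  "has_partial j (pexp a m) (\<lambda>x. of_nat (Poly_Mapping.lookup m j) * pexp a (m - Poly_Mapping.single j 1) x
      + \<i> * of_int (a $ j) * pexp a m x)"
  unfolding has_partial_def
proof
  fix x :: "real ^ 'a"
  let ?k = "Poly_Mapping.lookup m j"
  define C where "C = (\<Prod>k\<in>UNIV - {j}. complex_of_real (x $ k) ^ Poly_Mapping.lookup m k)"
  define S where "S = (\<Sum>k\<in>UNIV. of_int (a $ k) * x $ k)"
  \<comment> \<open>On the \<open>j\<close>-th coordinate line the function is the restriction to
    real arguments of the entire function \<open>F\<close>, so complex differentiation rules apply.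
    If the exponent of \<open>j\<close> is 0, the truncated subtractions are harmless because the
    first summand carries the factor 0.\<close>
  define F where "F z = C * (complex_of_real (x $ j) + z) ^ ?k * exp (\<i> * (of_real S + of_int (a $ j) * z))" for z
  have "pexp a m (x + t *\<^sub>R axis j 1) = F (of_real t)" for t
  proof -
    have "(\<Prod>k\<in>UNIV. complex_of_real ((x + t *\<^sub>R axis j 1) $ k) ^ Poly_Mapping.lookup m k) =
          (complex_of_real (x $ j) + of_real t) ^ ?k * C"
      unfolding C_def by (subst prod.remove[of _ j]) (auto simp: axis_def intro!: prod.cong)
    moreover have "(\<Sum>k\<in>UNIV. of_int (a $ k) * (x + t *\<^sub>R axis j 1) $ k) = S + of_int (a $ j) * t"
    proof -
      have "(\<Sum>k\<in>UNIV. of_int (a $ k) * (x + t *\<^sub>R axis j 1) $ k) =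
            S + (\<Sum>k\<in>UNIV. if k = j then of_int (a $ j) * t else 0)"
        unfolding S_def sum.distrib[symmetric] by (rule sum.cong) (auto simp: axis_def algebra_simps)
      then show ?thesis by simp
    qed
    ultimately show ?thesis by (simp add: pexp_def F_def mult.commute)
  qed
  moreover have "(F has_field_derivative
      (of_nat ?k * (C * complex_of_real (x $ j) ^ (?k - 1) * exp (\<i> * of_real S)) + \<i> * of_int (a $ j) * F 0)) (at (of_real 0))"
    unfolding F_def by (auto intro!: derivative_eq_intros simp: algebra_simps)
  then have "((\<lambda>t. F (of_real t)) has_vector_derivative
      (of_nat ?k * (C * complex_of_real (x $ j) ^ (?k - 1) * exp (\<i> * of_real S)) + \<i> * of_int (a $ j) * F 0)) (at 0)"
    by (rule has_vector_derivative_real_field)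
  moreover have "F 0 = pexp a m x"
    unfolding F_def C_def S_def pexp_def
    by (subst (2) prod.remove[of _ j]) (auto simp: algebra_simps)
  moreover have "C * complex_of_real (x $ j) ^ (?k - 1) * exp (\<i> * of_real S) =
      pexp a (m - Poly_Mapping.single j 1) x"
    unfolding C_def S_def pexp_def
    by (subst (2) prod.remove[of _ j]) (auto simp: lookup_minus lookup_single when_def intro!: prod.cong)
  ultimately show "((\<lambda>t. pexp a m (x + t *\<^sub>R axis j 1)) has_vector_derivative
      of_nat ?k * pexp a (m - Poly_Mapping.single j 1) x + \<i> * of_int (a $ j) * pexp a m x) (at 0)"
    by simp
qed

lemma has_partial_add:
  "has_partial j f f' \<Longrightarrow> has_partial j g g' \<Longrightarrow> has_partial j (f + g) (f' + g')"
  unfolding has_partial_def by (auto intro!: derivative_intros)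

lemma has_partial_scale: "has_partial j f f' \<Longrightarrow> has_partial j (\<lambda>x. c * f x) (\<lambda>x. c * f' x)"
  unfolding has_partial_def by (auto intro!: derivative_intros)

lemma signals_has_partial:
  assumes "f \<in> signals"
  shows "\<exists>f'\<in>signals. has_partial j f f'"
  using assms
proof (induction rule: signals_induct)
  case zero
  have "has_partial j 0 0" by (simp add: has_partial_def)
  then show ?case using signals_zero by blast
next
  case (add_pexp f c a m)
  then obtain f' where f': "f' \<in> signals" "has_partial j f f'" by blast
  let ?g = "\<lambda>x. of_nat (Poly_Mapping.lookup m j) * pexp a (m - Poly_Mapping.single j 1) x
      + \<i> * of_int (a $ j) * pexp a m x"
  have "?g \<in> signals"
    using signals_add[OF signals_scale[OF pexp_in_signals] signals_scale[OF pexp_in_signals]]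
    by (simp add: plus_fun_def)
  then show ?case
    by (intro bexI[where x = "f' + (\<lambda>x. c * ?g x)"] has_partial_add has_partial_scale has_partial_pexp
        signals_add signals_scale f')
qed

lemma D_partial_signals:
  assumes "f \<in> signals"
  shows "D_partial j f \<in> signals"
proof -
  obtain f' where f': "f' \<in> signals" "has_partial j f f'"
    using signals_has_partial assms by blast
  show ?thesis unfolding D_partial_eq[OF f'(2)] by (rule signals_scale[OF f'(1)])
qed

lemma D_partial_add:
  assumes "f \<in> signals" "g \<in> signals"
  shows "D_partial j (f + g) = D_partial j f + D_partial j g"
proof -
  obtain f' g' where *: "has_partial j f f'" "has_partial j g g'"
    using signals_has_partial assms by blast
  show ?thesis
    unfolding D_partial_eq[OF *(1)] D_partial_eq[OF *(2)] D_partial_eq[OF has_partial_add[OF *]]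
    by (rule ext) (simp add: algebra_simps)
qed

lemma D_partial_scale:
  assumes "f \<in> signals"
  shows "D_partial j (\<lambda>x. c * f x) = (\<lambda>x. c * D_partial j f x)"
proof -
  obtain f' where *: "has_partial j f f'"
    using signals_has_partial assms by blast
  show ?thesis
    unfolding D_partial_eq[OF *] D_partial_eq[OF has_partial_scale[OF *]] by (rule ext) simp
qed

lemma D_partial_pexp:
  "D_partial j (pexp a m) = (\<lambda>x. of_int (a $ j) * pexp a m x)
     + (\<lambda>x. - \<i> * of_nat (Poly_Mapping.lookup m j) * pexp a (m - Poly_Mapping.single j 1) x)"
  unfolding D_partial_eq[OF has_partial_pexp] by (rule ext) (simp add: algebra_simps)

lemma D_partial_pexp_commute:
  "D_partial j (D_partial k (pexp a m)) = D_partial k (D_partial j (pexp a m))"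
proof (cases "j = k")
  case False
  then show ?thesis
    by (simp only: D_partial_pexp D_partial_add D_partial_scale signals_scale pexp_in_signals)
       (rule ext, simp add: algebra_simps lookup_minus lookup_single_not_eq diff_right_commute)
qed simp

lemma D_partial_commute:
  assumes "f \<in> signals"
  shows "D_partial j (D_partial k f) = D_partial k (D_partial j f)"
  using assms
proof (induction rule: signals_induct)
  case zero
  have "D_partial i (\<lambda>x. 0) = (\<lambda>x. 0)" for i :: 'a
    using D_partial_scale[OF signals_zero, of i 0] by (simp add: zero_fun_def)
  then show ?case by (simp add: zero_fun_def)
next
  case (add_pexp f c a m)
  show ?case
    by (simp only: D_partial_add D_partial_scale signals_scale pexp_in_signals D_partial_signals
        D_partial_pexp_commute[of j k] add_pexp)
qed

subsection \<open>The operator ring acts on signals\<close>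

text \<open>Commutation is demanded only on an invariant set \<open>S\<close>, because partial
  derivatives commute on signals but not on arbitrary functions. The second claim turns addition of
  exponents into composition of monomial operators.\<close>

lemma foldr_commuting_operators:
  fixes T :: "'j \<Rightarrow> 'a \<Rightarrow> 'a"
  assumes cl: "\<And>j x. x \<in> S \<Longrightarrow> T j x \<in> S"
    and comm: "\<And>j k x. x \<in> S \<Longrightarrow> T j (T k x) = T k (T j x)"
    and "x \<in> S"
  shows "foldr (\<lambda>j. T j ^^ m j) js x \<in> S"
    and "foldr (\<lambda>j. T j ^^ (m j + m' j)) js x
       = foldr (\<lambda>j. T j ^^ m j) js (foldr (\<lambda>j. T j ^^ m' j) js x)"
proof -
  have pow: "(T j ^^ k) x \<in> S" if "x \<in> S" for j k x
    using that by (induction k) (auto simp: cl)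
  have fold: "foldr (\<lambda>j. T j ^^ m j) js x \<in> S" if "x \<in> S" for js x and m :: "'j \<Rightarrow> nat"
    using that by (induction js) (auto simp: pow)
  show "foldr (\<lambda>j. T j ^^ m j) js x \<in> S" by (rule fold[OF \<open>x \<in> S\<close>])
  have c1: "T j ((T k ^^ n) x) = (T k ^^ n) (T j x)" if "x \<in> S" for j k n x
    using that
  proof (induction n)
    case (Suc n)
    then show ?case using comm[of "(T k ^^ n) x" j k] by (simp add: pow)
  qed simp
  have c2: "(T j ^^ l) ((T k ^^ n) x) = (T k ^^ n) ((T j ^^ l) x)" if "x \<in> S" for j k l n x
    using that by (induction l) (auto simp: c1 pow)
  have c3: "(T j ^^ l) (foldr (\<lambda>j. T j ^^ m j) js x) = foldr (\<lambda>j. T j ^^ m j) js ((T j ^^ l) x)"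
    if "x \<in> S" for j l js x and m :: "'j \<Rightarrow> nat"
    using that
  proof (induction js)
    case (Cons k js)
    then show ?case using c2[OF fold[OF Cons.prems, of m js], where j = j and k = k and l = l and n = "m k"] by simp
  qed simp
  show "foldr (\<lambda>j. T j ^^ (m j + m' j)) js x
       = foldr (\<lambda>j. T j ^^ m j) js (foldr (\<lambda>j. T j ^^ m' j) js x)"
    using \<open>x \<in> S\<close> by (induction js) (auto simp: funpow_add c3 fold)
qed

lemma var_enum: "distinct (var_enum :: 'n::finite list)" "set (var_enum :: 'n list) = UNIV"
proof -
  have "\<exists>js :: 'n list. distinct js \<and> set js = UNIV"
    using finite_distinct_list[of "UNIV :: 'n set"] by auto
  then have "distinct (var_enum :: 'n list) \<and> set (var_enum :: 'n list) = UNIV"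
    unfolding var_enum_def by (rule someI_ex)
  then show "distinct (var_enum :: 'n list)" "set (var_enum :: 'n list) = UNIV" by auto
qed

lemma D_monom_signals: "f \<in> signals \<Longrightarrow> D_monom m f \<in> signals"
  unfolding D_monom_def
  by (rule foldr_commuting_operators(1)[where S = signals]) (auto simp: D_partial_signals D_partial_commute)

lemma D_monom_plus: "f \<in> signals \<Longrightarrow> D_monom (m + m') f = D_monom m (D_monom m' f)"
  unfolding D_monom_def lookup_add
  by (rule foldr_commuting_operators(2)[where S = signals]) (auto simp: D_partial_signals D_partial_commute)

lemma D_monom_zero [simp]: "D_monom 0 f = f"
proof -
  have "foldr (\<lambda>j. D_partial j ^^ 0) js f = f" for js by (induction js) auto
  then show ?thesis by (simp add: D_monom_def)
qed

lemma D_monom_single: "D_monom (Poly_Mapping.single j 1) f = D_partial j f"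
proof -
  have "foldr (\<lambda>i. D_partial i ^^ Poly_Mapping.lookup (Poly_Mapping.single j 1) i) js f =
      (if j \<in> set js then D_partial j f else f)" if "distinct js" for js
    using that by (induction js) (auto simp: lookup_single when_def)
  then show ?thesis by (simp add: D_monom_def var_enum)
qed

lemma D_monom_linear:
  assumes "f \<in> signals" "g \<in> signals"
  shows "D_monom m (f + (\<lambda>x. c * g x)) = D_monom m f + (\<lambda>x. c * D_monom m g x)"
proof -
  have pow: "(D_partial j ^^ k) f \<in> signals" if "f \<in> signals" for j k and f :: "real ^ 'a \<Rightarrow> complex"
    using that by (induction k) (auto simp: D_partial_signals)
  have fold: "foldr (\<lambda>j. D_partial j ^^ Poly_Mapping.lookup m j) js f \<in> signals" if "f \<in> signals"
    for js and f :: "real ^ 'a \<Rightarrow> complex"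
    using that by (induction js) (auto simp: pow)
  have lin: "(D_partial j ^^ k) (f + (\<lambda>x. c * g x)) = (D_partial j ^^ k) f + (\<lambda>x. c * (D_partial j ^^ k) g x)"
    if "f \<in> signals" "g \<in> signals" for j k and f g :: "real ^ 'a \<Rightarrow> complex"
    using that by (induction k) (auto simp: D_partial_add D_partial_scale signals_scale pow)
  have "foldr (\<lambda>j. D_partial j ^^ Poly_Mapping.lookup m j) js (f + (\<lambda>x. c * g x)) =
      foldr (\<lambda>j. D_partial j ^^ Poly_Mapping.lookup m j) js f +
      (\<lambda>x. c * foldr (\<lambda>j. D_partial j ^^ Poly_Mapping.lookup m j) js g x)" for js
    using assms by (induction js) (auto simp: lin fold)
  then show ?thesis by (simp add: D_monom_def)
qed

lemma D_apply_lin_ext: "D_apply r f x = lin_ext r (\<lambda>m. D_monom m f x)"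
  by (simp add: D_apply_def lin_ext_def)

lemma D_apply_zero [simp]: "D_apply 0 f = 0"
  by (auto simp: D_apply_lin_ext)

lemma D_apply_plus: "D_apply (r + s) f = D_apply r f + D_apply s f"
  by (rule ext) (simp add: D_apply_lin_ext lin_ext_add)

lemma D_apply_sum: "D_apply (\<Sum>x\<in>A. r x) f = (\<Sum>x\<in>A. D_apply (r x) f)"
  by (induction A rule: infinite_finite_induct) (auto simp: D_apply_plus)

lemma D_apply_single: "D_apply (Poly_Mapping.single m c) f = (\<lambda>x. c * D_monom m f x)"
  by (auto simp: D_apply_lin_ext)

lemma D_apply_const: "D_apply (cpoly_const c) f = (\<lambda>x. c * f x)"
  by (simp add: cpoly_const_def D_apply_single)

lemma D_apply_one [simp]: "D_apply 1 f = f"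
  using D_apply_const[of 1 f] by simp

lemma D_apply_var: "D_apply (cpoly_var j) f = D_partial j f"
  using D_monom_single[of j f] by (simp add: cpoly_var_def D_apply_single)

lemma D_apply_signals: "f \<in> signals \<Longrightarrow> D_apply r f \<in> signals"
  by (induction r rule: poly_mapping_single_induct)
     (auto simp: signals_zero D_apply_plus D_apply_single D_monom_signals signals_add signals_scale)

lemma D_apply_mult:
  assumes f: "f \<in> signals"
  shows "D_apply (r * s) f = D_apply r (D_apply s f)"
proof
  fix x
  \<comment> \<open>Linearity for \<open>c = -1\<close> and both signals 0 gives
    \<open>D_monom m 0 = D_monom m 0 - D_monom m 0\<close>.\<close>
  have D_monom_zero_fun: "D_monom m 0 = 0" for m :: "'a \<Rightarrow>\<^sub>0 nat"
    using D_monom_linear[OF signals_zero signals_zero, of m "-1"] by (auto simp: fun_eq_iff zero_fun_def plus_fun_def)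
  have *: "D_monom m (D_apply s f) x = lin_ext s (\<lambda>m'. D_monom m (D_monom m' f) x)" for m
  proof (induction s rule: poly_mapping_single_induct)
    case (single_add m' c s)
    have eq: "D_apply (Poly_Mapping.single m' c + s) f = D_apply s f + (\<lambda>x. c * D_monom m' f x)"
      by (simp add: D_apply_plus D_apply_single add.commute)
    show ?case
      unfolding eq D_monom_linear[OF D_apply_signals[OF f] D_monom_signals[OF f]]
      by (simp add: lin_ext_add single_add)
  next
    case zero
    show ?case unfolding D_apply_zero D_monom_zero_fun by simp
  qed
  show "D_apply (r * s) f x = D_apply r (D_apply s f) x"
    by (simp add: D_apply_lin_ext[of _ _ x] lin_ext_mult D_monom_plus[OF f] *)
qed

lemma D_apply_fun_add:
  assumes "f \<in> signals" "g \<in> signals"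
  shows "D_apply r (f + g) = D_apply r f + D_apply r g"
proof -
  have "D_monom m (f + g) = D_monom m f + D_monom m g" for m
    using D_monom_linear[OF assms, of m 1] by simp
  then show ?thesis
    by (intro ext) (simp add: D_apply_lin_ext lin_ext_add_fun)
qed

lemma D_apply_fun_zero [simp]: "D_apply r 0 = 0"
proof -
  have "D_apply r 0 = D_apply r (D_apply 0 0)" by simp
  also have "\<dots> = D_apply (r * 0) 0" by (rule D_apply_mult[symmetric]) (rule signals_zero)
  finally show ?thesis by simp
qed

lemma D_apply_fun_sum:
  "(\<And>a. a \<in> A \<Longrightarrow> h a \<in> signals) \<Longrightarrow> D_apply r (\<Sum>a\<in>A. h a) = (\<Sum>a\<in>A. D_apply r (h a))"
  by (induction A rule: infinite_finite_induct) (auto simp: D_apply_fun_add signals_sum)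

lemma D_apply_uminus: "D_apply (- r) f = - D_apply r f"
  using D_apply_plus[of r "- r" f] by (simp add: eq_neg_iff_add_eq_0 add.commute)

lemma D_apply_minus: "D_apply (r - s) f = D_apply r f - D_apply s f"
  using D_apply_plus[of r "- s" f] by (simp add: D_apply_uminus)

lemma D_apply_commute: "f \<in> signals \<Longrightarrow> D_apply r (D_apply s f) = D_apply s (D_apply r f)"
  by (simp add: D_apply_mult[symmetric] mult.commute)

lemma D_apply_fun_scale: "f \<in> signals \<Longrightarrow> D_apply r (\<lambda>x. c * f x) = (\<lambda>x. c * D_apply r f x)"
  using D_apply_commute[of f r "cpoly_const c"] by (simp add: D_apply_const)

lemma D_apply_power_zero_mono:
  assumes "f \<in> signals" "D_apply (r ^ k) f = 0" "k \<le> l"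
  shows "D_apply (r ^ l) f = 0"
proof -
  have "r ^ l = r ^ (l - k) * r ^ k" using \<open>k \<le> l\<close> by (simp add: power_add[symmetric])
  then show ?thesis using assms by (simp add: D_apply_mult)
qed

text \<open>From here on, equations between signals are kept as equations between functions instead
  of being unfolded pointwise.\<close>

declare plus_fun_apply [simp del] zero_fun_apply [simp del]

subsection \<open>Generalized eigenspaces of signals\<close>

definition dvar :: "complex ^ 'n::finite \<Rightarrow> 'n \<Rightarrow> 'n cpoly" where
  "dvar b j = cpoly_var j - cpoly_const (b $ j)"

lemma cpoly_eval_dvar [simp]: "cpoly_eval (dvar b j) a = a $ j - b $ j"
  by (simp add: dvar_def)

text \<open>The signals killed by a power of the maximal ideal of \<open>b\<close>, tested one
  variable at a time. In this form stability under every operator is just commutativity.\<close>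

definition gen_signals :: "complex ^ 'n::finite \<Rightarrow> (real ^ 'n \<Rightarrow> complex) set" where
  "gen_signals b = {f \<in> signals. \<forall>j. \<exists>k. D_apply (dvar b j ^ k) f = 0}"

lemma gen_signals_signals: "f \<in> gen_signals b \<Longrightarrow> f \<in> signals"
  by (simp add: gen_signals_def)

lemma gen_signals_nilpotent:
  assumes "f \<in> gen_signals b"
  obtains k where "D_apply (dvar b j ^ k) f = 0"
  using assms unfolding gen_signals_def by blast

lemma gen_signals_zero: "0 \<in> gen_signals b"
  by (simp add: gen_signals_def signals_zero)

lemma gen_signals_add:
  assumes "f \<in> gen_signals b" "g \<in> gen_signals b"
  shows "f + g \<in> gen_signals b"
proof -
  have f: "f \<in> signals" and g: "g \<in> signals" using assms by (auto simp: gen_signals_def)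
  have "\<exists>k. D_apply (dvar b j ^ k) (f + g) = 0" for j
  proof -
    obtain k where k: "D_apply (dvar b j ^ k) f = 0" using assms(1) gen_signals_nilpotent by blast
    obtain l where l: "D_apply (dvar b j ^ l) g = 0" using assms(2) gen_signals_nilpotent by blast
    have "D_apply (dvar b j ^ max k l) (f + g) = 0 + 0"
      unfolding D_apply_fun_add[OF f g]
      using D_apply_power_zero_mono[OF f k, of "max k l"] D_apply_power_zero_mono[OF g l, of "max k l"]
      by simp
    then show ?thesis by (metis add.right_neutral)
  qed
  then show ?thesis using signals_add[OF f g] by (simp add: gen_signals_def)
qed

lemma gen_signals_sum: "(\<And>a. a \<in> A \<Longrightarrow> h a \<in> gen_signals b) \<Longrightarrow> (\<Sum>a\<in>A. h a) \<in> gen_signals b"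
  by (induction A rule: infinite_finite_induct)
     (auto simp: gen_signals_zero gen_signals_add)

lemma gen_signals_D_apply:
  assumes "f \<in> gen_signals b"
  shows "D_apply r f \<in> gen_signals b"
proof -
  have f: "f \<in> signals" using assms by (rule gen_signals_signals)
  have "\<exists>k. D_apply (dvar b j ^ k) (D_apply r f) = 0" for j
  proof -
    obtain k where k: "D_apply (dvar b j ^ k) f = 0" using assms gen_signals_nilpotent by blast
    have "D_apply (dvar b j ^ k) (D_apply r f) = D_apply r 0"
      unfolding k[symmetric] by (rule D_apply_commute[OF f])
    then show ?thesis by (metis D_apply_fun_zero)
  qed
  then show ?thesis using D_apply_signals[OF f] by (simp add: gen_signals_def)
qed

lemma gen_signals_scale: "f \<in> gen_signals b \<Longrightarrow> (\<lambda>x. c * f x) \<in> gen_signals b"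
  using gen_signals_D_apply[of f b "cpoly_const c"] by (simp add: D_apply_const)

text \<open>If \<open>D_j - c\<close> kills \<open>g\<close>, then \<open>D_j - a_j\<close> acts on
  \<open>g\<close> as the nonzero scalar \<open>c - a $ j\<close>; a power of it also kills
  \<open>g\<close>, which forces \<open>g = 0\<close>. Higher powers are peeled off one factor at a
  time.\<close>

lemma eigen_shift_injective:
  assumes g: "g \<in> gen_signals a" and "a $ j \<noteq> c"
    and "D_apply ((cpoly_var j - cpoly_const c) ^ k) g = 0"
  shows "g = 0"
  using assms(3) g
proof (induction k arbitrary: g)
  case (Suc k)
  let ?v = "cpoly_var j - cpoly_const c :: 'a cpoly"
  have gs: "g \<in> signals" using Suc.prems(2) by (rule gen_signals_signals)
  let ?h = "D_apply ?v g"
  have "D_apply (?v ^ k) ?h = 0"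
    unfolding D_apply_mult[OF gs, symmetric] using Suc.prems(1) by (simp add: mult.commute)
  then have h0: "?h = 0" using Suc.IH gen_signals_D_apply[OF Suc.prems(2)] by blast
  have dv: "D_apply (dvar a j) g = (\<lambda>x. (c - a $ j) * g x)"
  proof -
    have "dvar a j = ?v + cpoly_const (c - a $ j)"
      by (simp add: dvar_def cpoly_const_diff)
    then show ?thesis
      by (simp only: D_apply_plus D_apply_const h0 add_0_left)
  qed
  have pw: "D_apply (dvar a j ^ l) g = (\<lambda>x. (c - a $ j) ^ l * g x)" for l
  proof (induction l)
    case (Suc l)
    have "D_apply (dvar a j ^ Suc l) g = D_apply (dvar a j) (D_apply (dvar a j ^ l) g)"
      using gs by (simp add: D_apply_mult)
    also have "\<dots> = (\<lambda>x. (c - a $ j) ^ l * D_apply (dvar a j) g x)"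
      unfolding Suc.IH by (rule D_apply_fun_scale[OF gs])
    also have "\<dots> = (\<lambda>x. (c - a $ j) ^ Suc l * g x)"
      unfolding dv by (simp add: mult_ac)
    finally show ?case .
  qed simp
  obtain l where "D_apply (dvar a j ^ l) g = 0" using Suc.prems(2) gen_signals_nilpotent by blast
  then have "(c - a $ j) ^ l * g x = 0" for x unfolding pw by (metis zero_fun_apply)
  then show ?case using \<open>a $ j \<noteq> c\<close> by (auto simp: fun_eq_iff zero_fun_apply)
qed simp

text \<open>A power of \<open>dvar a' j\<close> killing \<open>F a'\<close> removes one summand, and
  induction applies to the rest. That power is injective on the component at \<open>a\<close> when
  \<open>a\<close> and \<open>a'\<close> differ in coordinate \<open>j\<close>, so \<open>j\<close>
  is chosen afresh for each \<open>a\<close>.\<close>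

lemma gen_signals_independent:
  assumes "finite A" and "\<And>a. a \<in> A \<Longrightarrow> F a \<in> gen_signals a" and "(\<Sum>a\<in>A. F a) = 0"
  shows "\<forall>a\<in>A. F a = 0"
  using assms
proof (induction A arbitrary: F)
  case (insert a' A)
  have F: "F a' \<in> signals" "\<And>a. a \<in> A \<Longrightarrow> F a \<in> signals"
    using insert.prems(1) gen_signals_signals by blast+
  have A0: "F a = 0" if "a \<in> A" for a
  proof -
    have "a \<noteq> a'" using that insert.hyps by auto
    then obtain j where j: "a $ j \<noteq> a' $ j" by (auto simp: vec_eq_iff)
    obtain k where k: "D_apply (dvar a' j ^ k) (F a') = 0"
      using insert.prems(1)[of a'] gen_signals_nilpotent by blast
    let ?r = "dvar a' j ^ k"
    have "D_apply ?r (F a' + (\<Sum>a\<in>A. F a)) = D_apply ?r 0"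
      using insert.prems(2) insert.hyps by (simp del: D_apply_fun_zero)
    then have "D_apply ?r (F a') + D_apply ?r (\<Sum>a\<in>A. F a) = 0"
      using F signals_sum[of A F] by (simp add: D_apply_fun_add)
    then have "(\<Sum>a\<in>A. D_apply ?r (F a)) = 0"
      unfolding k by (simp add: D_apply_fun_sum F(2))
    then have "\<forall>a\<in>A. D_apply ?r (F a) = 0"
      using insert.IH[of "\<lambda>a. D_apply ?r (F a)"] insert.prems(1) gen_signals_D_apply by blast
    then have "D_apply ?r (F a) = 0" using that by blast
    then show ?thesis
      using eigen_shift_injective[of "F a" a j "a' $ j" k] j insert.prems(1)[of a] that
      unfolding dvar_def by blast
  qed
  then have "(\<Sum>a\<in>A. F a) = 0" by (rule sum.neutral[OF ballI])
  then have "F a' = 0" using insert.prems(2) insert.hyps by simp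
  with A0 show ?case by blast
qed simp

subsection \<open>Polynomial-exponentials and their Taylor pairing\<close>

definition cpt :: "int ^ 'n::finite \<Rightarrow> complex ^ 'n" where
  "cpt a = (\<chi> j. of_int (a $ j))"

lemma cpt_nth [simp]: "cpt a $ j = of_int (a $ j)"
  by (simp add: cpt_def)

lemma integral_points_eq: "(integral_points :: (complex ^ 'n::finite) set) = range cpt"
proof
  show "(integral_points :: (complex ^ 'n) set) \<subseteq> range cpt"
  proof
    fix b :: "complex ^ 'n" assume "b \<in> integral_points"
    then have "\<forall>j. \<exists>z. b $ j = of_int z" unfolding integral_points_def Ints_def by blast
    then obtain z where "\<And>j. b $ j = of_int (z j)" by metis
    then have "b = cpt (\<chi> j. z j)" by (simp add: vec_eq_iff)
    then show "b \<in> range cpt" by blast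
  qed
qed (auto simp: integral_points_def)

text \<open>The scalar (-\<i>)^k m (m-1) ... (m-k+1) produced by applying (1/\<i>) d/dx
  \<open>k\<close> times to x^m; for \<open>k > m\<close> the factor with index \<open>m\<close> is
  0.\<close>

definition taylor_factor :: "nat \<Rightarrow> nat \<Rightarrow> complex" where
  "taylor_factor m k = (\<Prod>i<k. - \<i> * of_nat (m - i))"

lemma D_apply_dvar_power_pexp:
  "D_apply (dvar (cpt a) j ^ k) (pexp a m) =
     (\<lambda>x. taylor_factor (Poly_Mapping.lookup m j) k * pexp a (m - Poly_Mapping.single j k) x)"
proof (induction k)
  case 0
  then show ?case by (simp add: taylor_factor_def)
next
  case (Suc k)
  have step: "D_apply (dvar (cpt a) j) (pexp a m) =
      (\<lambda>x. - \<i> * of_nat (Poly_Mapping.lookup m j) * pexp a (m - Poly_Mapping.single j 1) x)" for m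
    by (rule ext) (simp add: dvar_def D_apply_minus D_apply_var D_partial_pexp D_apply_const)
  have "D_apply (dvar (cpt a) j ^ Suc k) (pexp a m) =
      D_apply (dvar (cpt a) j) (D_apply (dvar (cpt a) j ^ k) (pexp a m))"
    by (simp add: D_apply_mult[OF pexp_in_signals])
  also have "\<dots> = (\<lambda>x. taylor_factor (Poly_Mapping.lookup m j) k *
      (- \<i> * of_nat (Poly_Mapping.lookup m j - k) * pexp a (m - Poly_Mapping.single j k - Poly_Mapping.single j 1) x))"
    unfolding Suc.IH D_apply_fun_scale[OF pexp_in_signals] step by (simp add: lookup_minus)
  also have "\<dots> = (\<lambda>x. taylor_factor (Poly_Mapping.lookup m j) (Suc k) * pexp a (m - Poly_Mapping.single j (Suc k)) x)"
    by (rule ext) (simp add: taylor_factor_def diff_diff_add single_add[symmetric] mult_ac)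
  finally show ?case .
qed

lemma taylor_factor_zero: "m < k \<Longrightarrow> taylor_factor m k = 0"
  unfolding taylor_factor_def by (rule prod_zero) auto

lemma taylor_factor_self: "taylor_factor m m \<noteq> 0"
  unfolding taylor_factor_def by auto

lemma pexp_gen_signals: "pexp a m \<in> gen_signals (cpt a)"
proof -
  have "D_apply (dvar (cpt a) j ^ Suc (Poly_Mapping.lookup m j)) (pexp a m) = 0" for j
    unfolding D_apply_dvar_power_pexp by (simp add: taylor_factor_zero zero_fun_def del: power_Suc)
  then show ?thesis unfolding gen_signals_def using pexp_in_signals by blast
qed

text \<open>A complex basis of the operator ring adapted to \<open>b\<close>, dual up to scalars to
  the functions \<open>pexp\<close> of frequency \<open>b\<close> under the pairing by the value at
  the origin.\<close>

definition taylor_monom :: "complex ^ 'n::finite \<Rightarrow> ('n \<Rightarrow>\<^sub>0 nat) \<Rightarrow> 'n cpoly" where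
  "taylor_monom b \<alpha> = (\<Prod>j\<in>UNIV. dvar b j ^ Poly_Mapping.lookup \<alpha> j)"

lemma taylor_monom_zero [simp]: "taylor_monom b 0 = 1"
  by (simp add: taylor_monom_def)

lemma taylor_monom_add_single:
  "taylor_monom b (\<alpha> + Poly_Mapping.single j k) = dvar b j ^ k * taylor_monom b \<alpha>"
proof -
  have "(\<Prod>i\<in>UNIV. dvar b i ^ Poly_Mapping.lookup (Poly_Mapping.single j k) i) =
      (\<Prod>i\<in>UNIV. if i = j then dvar b i ^ k else 1)"
    by (rule prod.cong) (auto simp: lookup_single when_def)
  then show ?thesis
    by (simp add: taylor_monom_def lookup_add power_add prod.distrib mult.commute)
qed

lemma pexp_at_zero: "pexp a m 0 = (if m = 0 then 1 else 0)"
  by (auto simp: pexp_def power_0_left prod_zero_iff poly_mapping_eq_iff fun_eq_iff)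

lemma D_apply_taylor_monom_pexp:
  "D_apply (taylor_monom (cpt a) \<alpha>) (pexp a m) 0 =
     (if \<alpha> = m then \<Prod>j\<in>UNIV. taylor_factor (Poly_Mapping.lookup m j) (Poly_Mapping.lookup m j) else 0)"
proof -
  have *: "D_apply (\<Prod>j\<in>A. dvar (cpt a) j ^ Poly_Mapping.lookup \<alpha> j) (pexp a m) =
      (\<lambda>x. (\<Prod>j\<in>A. taylor_factor (Poly_Mapping.lookup m j) (Poly_Mapping.lookup \<alpha> j)) *
        pexp a (m - (\<Sum>j\<in>A. Poly_Mapping.single j (Poly_Mapping.lookup \<alpha> j))) x)" if "finite A" for A
    using that
  proof (induction A)
    case (insert j A)
    \<comment> \<open>The factors in \<open>A\<close> leave the exponent of \<open>j\<close> alone,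
      so the new factor still meets the full exponent of \<open>j\<close> in
      \<open>m\<close>.\<close>
    have lk: "Poly_Mapping.lookup (\<Sum>j\<in>A. Poly_Mapping.single j (Poly_Mapping.lookup \<alpha> j)) j = 0"
      using insert.hyps by (auto simp: lookup_sum lookup_single when_def)
    let ?S = "\<Sum>j\<in>A. Poly_Mapping.single j (Poly_Mapping.lookup \<alpha> j)"
    have "D_apply (\<Prod>j\<in>insert j A. dvar (cpt a) j ^ Poly_Mapping.lookup \<alpha> j) (pexp a m) =
       D_apply (dvar (cpt a) j ^ Poly_Mapping.lookup \<alpha> j)
         (D_apply (\<Prod>j\<in>A. dvar (cpt a) j ^ Poly_Mapping.lookup \<alpha> j) (pexp a m))"
      using insert.hyps by (simp add: D_apply_mult[OF pexp_in_signals])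
    also have "\<dots> = (\<lambda>x. (\<Prod>j\<in>A. taylor_factor (Poly_Mapping.lookup m j) (Poly_Mapping.lookup \<alpha> j)) *
        (taylor_factor (Poly_Mapping.lookup m j) (Poly_Mapping.lookup \<alpha> j) *
          pexp a (m - ?S - Poly_Mapping.single j (Poly_Mapping.lookup \<alpha> j)) x))"
      unfolding insert.IH D_apply_fun_scale[OF pexp_in_signals] D_apply_dvar_power_pexp
      by (simp add: lookup_minus lk)
    also have "\<dots> = (\<lambda>x. (\<Prod>j\<in>insert j A. taylor_factor (Poly_Mapping.lookup m j) (Poly_Mapping.lookup \<alpha> j)) *
        pexp a (m - (\<Sum>j\<in>insert j A. Poly_Mapping.single j (Poly_Mapping.lookup \<alpha> j))) x)"
      using insert.hyps by (intro ext) (simp add: diff_diff_add add.commute mult_ac)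
    finally show ?case .
  qed simp
  have val: "D_apply (taylor_monom (cpt a) \<alpha>) (pexp a m) 0 =
      (\<Prod>j\<in>UNIV. taylor_factor (Poly_Mapping.lookup m j) (Poly_Mapping.lookup \<alpha> j)) * (if m - \<alpha> = 0 then 1 else 0)"
    unfolding taylor_monom_def *[OF finite] sum_single_lookup pexp_at_zero by simp
  show ?thesis
  proof (cases "\<alpha> = m")
    case False
    \<comment> \<open>At a differing coordinate, either the exponent in \<open>\<alpha>\<close> is
      too large and its Taylor factor vanishes, or a positive power of a variable survives and
      vanishes at the origin.\<close>
    then obtain j where j: "Poly_Mapping.lookup \<alpha> j \<noteq> Poly_Mapping.lookup m j"
      using poly_mapping_eqI[of \<alpha> m] by blast
    show ?thesis
    proof (cases "Poly_Mapping.lookup m j < Poly_Mapping.lookup \<alpha> j")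
      case True
      then have "(\<Prod>j\<in>UNIV. taylor_factor (Poly_Mapping.lookup m j) (Poly_Mapping.lookup \<alpha> j)) = 0"
        using taylor_factor_zero[of "Poly_Mapping.lookup m j"] by (auto simp: prod_zero_iff)
      with val False show ?thesis by simp
    next
      case F: False
      then have "Poly_Mapping.lookup (m - \<alpha>) j \<noteq> 0" using j by (simp add: lookup_minus)
      then have "m - \<alpha> \<noteq> 0" by auto
      with val False show ?thesis by simp
    qed
  next
    case True
    show ?thesis using val unfolding True by simp
  qed
qed

lemma taylor_monom_spans:
  assumes add: "\<And>r s. r \<in> Z \<Longrightarrow> s \<in> Z \<Longrightarrow> r + s \<in> Z"
    and scale: "\<And>c r. r \<in> Z \<Longrightarrow> cpoly_const c * r \<in> Z"
    and monom: "\<And>\<alpha>. taylor_monom b \<alpha> \<in> Z"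
  shows "r \<in> Z"
proof -
  \<comment> \<open>The claim carries a Taylor monomial along because
    \<open>cpoly_var j = dvar b j + cpoly_const (b $ j)\<close> trades a variable for a larger
    \<open>\<alpha>\<close>.\<close>
  have "r * taylor_monom b \<alpha> \<in> Z" for \<alpha>
  proof (induction r arbitrary: \<alpha> rule: cpoly_induct)
    case (const c)
    then show ?case by (intro scale monom)
  next
    case (add r s)
    then show ?case by (simp add: distrib_right assms(1))
  next
    case (mult_var r j)
    have v: "cpoly_var j = dvar b j + cpoly_const (b $ j)" by (simp add: dvar_def)
    have "r * cpoly_var j * taylor_monom b \<alpha> =
        r * taylor_monom b (\<alpha> + Poly_Mapping.single j 1) + cpoly_const (b $ j) * (r * taylor_monom b \<alpha>)"
      unfolding v taylor_monom_add_single power_one_right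
      by (simp only: distrib_left distrib_right mult.assoc mult.left_commute)
    then show ?case using mult_var assms(1) scale by (simp only:)
  qed
  from this[of 0] show ?thesis by simp
qed

text \<open>Macaulay duality: the functionals on the operator ring that vanish on a power of the ideal of
  a point are exactly the functionals \<open>r \<mapsto> (r g)(0)\<close> of signals \<open>g\<close> with that single frequency.\<close>

lemma functional_representation:
  fixes \<phi> :: "'n::finite cpoly \<Rightarrow> complex"
  assumes b: "b \<in> integral_points"
    and add: "\<And>r s. \<phi> (r + s) = \<phi> r + \<phi> s"
    and scale: "\<And>c r. \<phi> (cpoly_const c * r) = c * \<phi> r"
    and vanish: "\<And>j r. \<phi> (dvar b j ^ K * r) = 0"
  shows "\<exists>g\<in>gen_signals b. \<forall>r. D_apply r g 0 = \<phi> r"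
proof -
  obtain a where a: "b = cpt a" using b by (auto simp: integral_points_eq)
  \<comment> \<open>Outside this finite box some exponent reaches \<open>K\<close>, so the Taylor
    monomial is a multiple of \<open>dvar b j ^ K\<close> and both functionals vanish on it.\<close>
  define B :: "('n \<Rightarrow>\<^sub>0 nat) set" where "B = {m. \<forall>j. Poly_Mapping.lookup m j < K}"
  have "B \<subseteq> (\<lambda>f. \<Sum>j\<in>UNIV. Poly_Mapping.single j (f j)) ` (PiE UNIV (\<lambda>_. {..<K}))"
  proof
    fix m assume "m \<in> B"
    then show "m \<in> (\<lambda>f. \<Sum>j\<in>UNIV. Poly_Mapping.single j (f j)) ` (PiE UNIV (\<lambda>_. {..<K}))"
      by (intro image_eqI[where x = "Poly_Mapping.lookup m"])
         (auto simp: sum_single_lookup B_def)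
  qed
  then have finB: "finite B" by (rule finite_subset) (intro finite_imageI finite_PiE, auto)
  define \<kappa> where "\<kappa> m = (\<Prod>j\<in>UNIV. taylor_factor (Poly_Mapping.lookup m j) (Poly_Mapping.lookup m j))" for m :: "'n \<Rightarrow>\<^sub>0 nat"
  have \<kappa>: "\<kappa> m \<noteq> 0" for m unfolding \<kappa>_def by (simp add: prod_zero_iff taylor_factor_self)
  \<comment> \<open>Dual basis coefficients: \<open>\<kappa> m\<close> is the pairing of the Taylor
    monomial \<open>m\<close> with \<open>pexp a m\<close>, and all other pairings are 0.\<close>
  define c where "c m = \<phi> (taylor_monom b m) / \<kappa> m" for m
  define g where "g = (\<Sum>m\<in>B. (\<lambda>x. c m * pexp a m x))"
  have g: "g \<in> gen_signals b"
    unfolding g_def a by (intro gen_signals_sum gen_signals_scale pexp_gen_signals)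
  have gs: "D_apply r g 0 = (\<Sum>m\<in>B. c m * D_apply r (pexp a m) 0)" for r
    unfolding g_def
    by (simp add: D_apply_fun_sum signals_scale pexp_in_signals D_apply_fun_scale sum_fun_apply)
  have "r \<in> {r. D_apply r g 0 = \<phi> r}" for r
  proof (rule taylor_monom_spans[where b = b])
    fix \<alpha>
    have "D_apply (taylor_monom b \<alpha>) g 0 = (\<Sum>m\<in>B. if \<alpha> = m then c m * \<kappa> m else 0)"
      unfolding gs unfolding a D_apply_taylor_monom_pexp \<kappa>_def by (rule sum.cong) auto
    also have "\<dots> = (if \<alpha> \<in> B then c \<alpha> * \<kappa> \<alpha> else 0)" using finB by simp
    also have "\<dots> = \<phi> (taylor_monom b \<alpha>)"
    proof (cases "\<alpha> \<in> B")
      case True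
      then show ?thesis using \<kappa>[of \<alpha>] by (simp add: c_def)
    next
      case False
      then obtain j where j: "K \<le> Poly_Mapping.lookup \<alpha> j" by (auto simp: B_def not_less)
      have "\<alpha> = (\<alpha> - Poly_Mapping.single j K) + Poly_Mapping.single j K"
        using j by (intro poly_mapping_eqI) (auto simp: lookup_add lookup_minus lookup_single when_def)
      then have "taylor_monom b \<alpha> = dvar b j ^ K * taylor_monom b (\<alpha> - Poly_Mapping.single j K)"
        using taylor_monom_add_single by metis
      then show ?thesis using False by (simp add: vanish)
    qed
    finally show "taylor_monom b \<alpha> \<in> {r. D_apply r g 0 = \<phi> r}" by simp
  next
    fix d r assume "r \<in> {r. D_apply r g 0 = \<phi> r}"
    then show "cpoly_const d * r \<in> {r. D_apply r g 0 = \<phi> r}"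
      using gen_signals_signals[OF g] by (simp add: D_apply_mult D_apply_const scale)
  qed (simp add: D_apply_plus add plus_fun_apply)
  then show ?thesis using g by blast
qed

subsection \<open>Evaluation at the origin separates signals of one frequency\<close>

text \<open>Along the line, \<open>h\<close> solves the linear equation u' = \<i> b_j u, and
  multiplication by exp(-\<i> b_j s) makes it constant.\<close>

lemma eigensignal_zero_on_line:
  assumes h: "h \<in> signals" and e: "D_apply (dvar b j) h = 0" and x: "h x = 0"
  shows "h (x + t *\<^sub>R axis j 1) = 0"
proof -
  obtain h' where h': "has_partial j h h'" using signals_has_partial[OF h] by blast
  have "D_partial j h y = b $ j * h y" for y
    using fun_cong[OF e, of y] by (simp add: dvar_def D_apply_minus D_apply_var D_apply_const zero_fun_apply)
  then have "- \<i> * h' y = b $ j * h y" for y unfolding D_partial_eq[OF h'] .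
  then have h'_eq: "h' y = \<i> * b $ j * h y" for y
    by (metis (no_types, lifting) complex_i_mult_minus minus_mult_commute minus_minus mult.assoc)
  define u where "u s = h (x + s *\<^sub>R axis j 1)" for s
  have du: "(u has_vector_derivative \<i> * b $ j * u s) (at s)" for s
  proof -
    have "((\<lambda>t. h ((x + s *\<^sub>R axis j 1) + t *\<^sub>R axis j 1)) has_vector_derivative \<i> * b $ j * u s) (at (s - s))"
      using h' unfolding has_partial_def h'_eq u_def by simp
    then have "((\<lambda>t. h ((x + s *\<^sub>R axis j 1) + t *\<^sub>R axis j 1)) \<circ> (\<lambda>t. t - s) has_vector_derivative
        1 *\<^sub>R (\<i> * b $ j * u s)) (at s)"
      by (intro vector_diff_chain_at) (auto intro!: derivative_eq_intros)
    moreover have "(\<lambda>t. h ((x + s *\<^sub>R axis j 1) + t *\<^sub>R axis j 1)) \<circ> (\<lambda>t. t - s) = u"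
      by (auto simp: u_def fun_eq_iff algebra_simps)
    ultimately show ?thesis by simp
  qed
  define v where "v s = u s * exp (- \<i> * b $ j * complex_of_real s)" for s
  have de: "((\<lambda>s. exp (- \<i> * b $ j * complex_of_real s)) has_vector_derivative
      (- \<i> * b $ j) * exp (- \<i> * b $ j * complex_of_real s)) (at s)" for s
    by (rule has_vector_derivative_real_field) (auto intro!: derivative_eq_intros)
  have "(v has_vector_derivative 0) (at s within UNIV)" for s
    unfolding v_def using has_vector_derivative_mult[OF du[of s] de[of s]] by (simp add: algebra_simps)
  then obtain c where c: "\<And>s. v s = c"
    using has_vector_derivative_zero_constant[of UNIV v] by auto
  have "v 0 = 0" by (simp add: v_def u_def x)
  then have "v t = 0" using c by metis
  then show ?thesis by (simp add: v_def u_def)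
qed

lemma eigensignal_zero:
  fixes h :: "real ^ 'n::finite \<Rightarrow> complex"
  assumes h: "h \<in> signals" and e: "\<And>j. D_apply (dvar b j) h = 0" and "h 0 = 0"
  shows "h = 0"
proof
  \<comment> \<open>Walk from the origin to \<open>x\<close> one coordinate at a time;
    \<open>A\<close> holds the coordinates that may already be nonzero.\<close>
  have "\<forall>x. (\<forall>j. j \<notin> A \<longrightarrow> x $ j = 0) \<longrightarrow> h x = 0" if "finite A" for A
    using that
  proof (induction A)
    case empty
    have "x = 0" if "\<forall>j. x $ j = 0" for x :: "real ^ 'n" using that by (simp add: vec_eq_iff)
    then show ?case using \<open>h 0 = 0\<close> by auto
  next
    case (insert j A)
    show ?case
    proof (intro allI impI)
      fix x :: "real ^ 'n" assume x: "\<forall>k. k \<notin> insert j A \<longrightarrow> x $ k = 0"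
      have "\<forall>k. k \<notin> A \<longrightarrow> (x - (x $ j) *\<^sub>R axis j 1) $ k = 0"
        using x by (auto simp: axis_def)
      then have "h (x - (x $ j) *\<^sub>R axis j 1) = 0" using insert.IH by blast
      then show "h x = 0"
        using eigensignal_zero_on_line[OF h e[of j], of "x - (x $ j) *\<^sub>R axis j 1" "x $ j"] by simp
    qed
  qed
  from this[of UNIV] show "h x = 0 x" for x by (simp add: zero_fun_apply)
qed

lemma eigensignal_eval:
  assumes h: "h \<in> signals" and e: "\<And>j. D_apply (dvar b j) h = 0"
  shows "D_apply r h = (\<lambda>x. cpoly_eval r b * h x)"
proof -
  have sub: "cmod.subspace {s. D_apply s h = 0}"
    by (auto simp: cmod.subspace_def D_apply_plus D_apply_mult[OF h])
  have "r - cpoly_const (cpoly_eval r b) \<in> point_ideal b"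
    by (simp add: point_ideal_eq)
  also have "point_ideal b \<subseteq> {s. D_apply s h = 0}"
    unfolding point_ideal_def using e by (intro cmod.span_minimal sub) (auto simp: dvar_def)
  finally have "D_apply (r - cpoly_const (cpoly_eval r b)) h = 0" by simp
  then show ?thesis by (simp add: D_apply_minus D_apply_const)
qed

text \<open>For one variable after another, multiply by the last power of \<open>dvar b j\<close>
  that does not kill the signal. Conditions already reached persist because operators
  commute.\<close>

lemma gen_signals_socle:
  fixes f :: "real ^ 'n::finite \<Rightarrow> complex"
  assumes f: "f \<in> gen_signals b" and "f \<noteq> 0"
  shows "\<exists>r. D_apply r f \<noteq> 0 \<and> (\<forall>j. D_apply (dvar b j) (D_apply r f) = 0)"
proof -
  have fs: "f \<in> signals" using f by (rule gen_signals_signals)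
  have "\<exists>r. D_apply r f \<noteq> 0 \<and> (\<forall>j\<in>A. D_apply (dvar b j) (D_apply r f) = 0)" if "finite A" for A
    using that
  proof (induction A)
    case empty
    show ?case using \<open>f \<noteq> 0\<close> by (intro exI[of _ 1]) simp
  next
    case (insert j A)
    then obtain r where r: "D_apply r f \<noteq> 0" "\<And>i. i \<in> A \<Longrightarrow> D_apply (dvar b i) (D_apply r f) = 0" by blast
    let ?g = "D_apply r f"
    have gs: "?g \<in> signals" using D_apply_signals[OF fs] .
    define k where "k = (LEAST k. D_apply (dvar b j ^ k) ?g = 0)"
    have "\<exists>k. D_apply (dvar b j ^ k) ?g = 0"
      using gen_signals_D_apply[OF f, of r] gen_signals_nilpotent by blast
    then have k: "D_apply (dvar b j ^ k) ?g = 0" unfolding k_def by (rule LeastI_ex)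
    have kmin: "D_apply (dvar b j ^ l) ?g \<noteq> 0" if "l < k" for l
      using that not_less_Least unfolding k_def by blast
    have "k \<noteq> 0" using k r(1) by (metis D_apply_one power_0)
    then obtain l where l: "k = Suc l" by (cases k) auto
    show ?case
    proof (intro exI[of _ "dvar b j ^ l * r"] conjI ballI)
      show "D_apply (dvar b j ^ l * r) f \<noteq> 0"
        unfolding D_apply_mult[OF fs] using kmin l by simp
      fix i assume "i \<in> insert j A"
      then consider "i = j" | "i \<in> A" by blast
      then show "D_apply (dvar b i) (D_apply (dvar b j ^ l * r) f) = 0"
      proof cases
        case 1
        have "D_apply (dvar b j) (D_apply (dvar b j ^ l) ?g) = D_apply (dvar b j ^ k) ?g"
          unfolding l by (simp add: D_apply_mult[OF gs])
        then show ?thesis unfolding 1 D_apply_mult[OF fs] k .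
      next
        case 2
        show ?thesis
          unfolding D_apply_mult[OF fs] D_apply_commute[OF gs, of "dvar b i"] r(2)[OF 2] D_apply_fun_zero ..
      qed
    qed
  qed
  from this[OF finite[of UNIV]] show ?thesis by blast
qed

text \<open>A nonzero \<open>f\<close> would have a nonzero multiple that is a common eigenfunction,
  and such a function cannot vanish at the origin. This upgrades identities of values at the origin
  to identities of signals.\<close>

lemma gen_signals_separated:
  assumes f: "f \<in> gen_signals b" and "\<And>r. D_apply r f 0 = 0"
  shows "f = 0"
proof (rule ccontr)
  assume "f \<noteq> 0"
  then obtain r where r: "D_apply r f \<noteq> 0" "\<And>j. D_apply (dvar b j) (D_apply r f) = 0"
    using gen_signals_socle[OF f] by blast
  with eigensignal_zero[OF D_apply_signals[OF gen_signals_signals[OF f]] r(2) assms(2)]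
  show False by blast
qed

text \<open>\<open>F\<close> is total with value 0 off \<open>A\<close>, so the decompositions of
  several signals can later be summed over one common set of frequencies.\<close>

lemma signals_decomposition:
  assumes "f \<in> signals"
  shows "\<exists>A F. finite A \<and> A \<subseteq> integral_points \<and> (\<forall>a. F a \<in> gen_signals a) \<and>
     (\<forall>a. a \<notin> A \<longrightarrow> F a = 0) \<and> f = (\<Sum>a\<in>A. F a)"
  using assms
proof (induction rule: signals_induct)
  case zero
  show ?case by (intro exI[of _ "{}"] exI[of _ "\<lambda>_. 0"]) (simp add: gen_signals_zero)
next
  case (add_pexp f c a m)
  then obtain A F where A: "finite A" "A \<subseteq> integral_points" and F: "\<And>a. F a \<in> gen_signals a"
    "\<And>a. a \<notin> A \<Longrightarrow> F a = 0" and f: "f = (\<Sum>a\<in>A. F a)" by blast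
  let ?e = "\<lambda>x. c * pexp a m x"
  let ?E = "\<lambda>b. if b = cpt a then ?e else 0"
  have e: "?e \<in> gen_signals (cpt a)" by (intro gen_signals_scale pexp_gen_signals)
  have "(\<Sum>b\<in>insert (cpt a) A. F b) = f"
    unfolding f using A F(2) by (intro sum.mono_neutral_right) auto
  moreover have "(\<Sum>b\<in>insert (cpt a) A. ?E b) = ?e" using A by (subst sum.delta) auto
  ultimately have "f + ?e = (\<Sum>b\<in>insert (cpt a) A. F b + ?E b)"
    by (simp only: sum.distrib)
  moreover have "F b + ?E b \<in> gen_signals b" for b
    using F(1) e by (auto intro!: gen_signals_add gen_signals_zero)
  moreover have "F b + ?E b = 0" if "b \<notin> insert (cpt a) A" for b
    using that F(2) by auto
  ultimately show ?case
    using A by (intro exI[of _ "insert (cpt a) A"] exI[of _ "\<lambda>b. F b + ?E b"])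
      (auto simp: integral_points_eq)
qed

subsection \<open>Submodules satisfy the ascending chain condition\<close>

text \<open>Injectivity is unique factorization: the exponent of \<open>j\<close> is recovered as
  the multiplicity of the prime \<open>p j\<close>.\<close>

lemma exists_monomial_code:
  "\<exists>N :: ('n::finite \<Rightarrow>\<^sub>0 nat) \<Rightarrow> nat. inj N \<and> (\<forall>m m'. N (m + m') = N m * N m') \<and> (\<forall>m. N m > 0)"
proof -
  obtain ix :: "'n \<Rightarrow> nat" where ix: "inj ix"
    using finite_imp_inj_to_nat_seg[of "UNIV :: 'n set"] by (auto simp: finite)
  obtain pr :: "nat \<Rightarrow> nat" where pr: "inj pr" "range pr \<subseteq> {p. prime p}"
    using infinite_countable_subset[OF primes_infinite] by blast
  define p where "p j = pr (ix j)" for j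
  have p: "inj p" "\<And>j. prime (p j)"
    using pr(1) ix rangeI[of pr, THEN subsetD[OF pr(2)]] by (auto simp: p_def inj_def)
  define N where "N m = (\<Prod>j\<in>UNIV. p j ^ Poly_Mapping.lookup m j)" for m
  have mult: "multiplicity (p j) (N m) = Poly_Mapping.lookup m j" for m j
  proof -
    have "N m = (\<Prod>x\<in>range p. x ^ Poly_Mapping.lookup m (inv p x))"
      unfolding N_def using p(1) by (simp add: prod.reindex)
    then show ?thesis
      using multiplicity_prod_prime_powers[of "range p" "p j" "\<lambda>x. Poly_Mapping.lookup m (inv p x)"] p
      by auto
  qed
  have "inj N"
    by (rule injI) (metis mult poly_mapping_eqI)
  moreover have "N (m + m') = N m * N m'" for m m'
    by (simp add: N_def lookup_add power_add prod.distrib)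
  moreover have "N m > 0" for m
    unfolding N_def using p(2) by (intro prod_pos) (auto simp: prime_gt_0_nat)
  ultimately show ?thesis by blast
qed

text \<open>A position-over-term order on the terms of a free module, realised by natural numbers: sending
  the variables to distinct primes makes the monomial order multiplicative, total and well-founded.\<close>

lemma exists_term_code:
  "\<exists>T :: ('n::finite \<Rightarrow>\<^sub>0 nat) \<Rightarrow> 'q::finite \<Rightarrow> nat.
     (\<forall>m i m' i'. T m i = T m' i' \<longrightarrow> m = m' \<and> i = i') \<and>
     (\<forall>u m i m' i'. T m i \<le> T m' i' \<longrightarrow> T (u + m) i \<le> T (u + m') i')"
proof -
  obtain N :: "('n \<Rightarrow>\<^sub>0 nat) \<Rightarrow> nat" where N: "inj N" "\<And>m m'. N (m + m') = N m * N m'" "\<And>m. N m > 0"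
    using exists_monomial_code by blast
  obtain ix :: "'q \<Rightarrow> nat" and Q where ix: "inj ix" "range ix = {i. i < Q}"
    using finite_imp_inj_to_nat_seg[of "UNIV :: 'q set"] by (auto simp: finite)
  have lt: "ix i < Q" for i using ix(2) by auto
  \<comment> \<open>\<open>Q\<close> exceeds every position index, so division with remainder by
    \<open>Q\<close> recovers monomial and position; the monomial is compared first and the position
    breaks ties.\<close>
  define T where "T m i = N m * Q + ix i" for m i
  have div: "T m i div Q = N m" "T m i mod Q = ix i" for m i
    using lt[of i] by (simp_all add: T_def)
  have "m = m' \<and> i = i'" if "T m i = T m' i'" for m i m' i'
    using that div[of m i] div[of m' i'] N(1) ix(1) by (auto dest: injD)
  moreover have "T (u + m) i \<le> T (u + m') i'" if le: "T m i \<le> T m' i'" for u m i m' i'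
  proof -
    have "N m \<le> N m'" using div_le_mono[OF le, of Q] div by simp
    show ?thesis
    proof (cases "N m = N m'")
      case True
      then show ?thesis using le by (simp add: T_def N(2))
    next
      case False
      with \<open>N m \<le> N m'\<close> have "N u * N m < N u * N m'" using N(3)[of u] by simp
      then have "N (u + m) + 1 \<le> N (u + m')" unfolding N(2) by linarith
      then have "(N (u + m) + 1) * Q \<le> N (u + m') * Q" by (rule mult_le_mono1)
      then show ?thesis using lt[of i] by (simp add: T_def)
    qed
  qed
  ultimately show ?thesis by blast
qed

text \<open>A monotone subsequence is increasing or decreasing, and a decreasing sequence of
  naturals is constant once it has reached its least value.\<close>

lemma nat_seq_mono_subseq: "\<exists>r. strict_mono (r :: nat \<Rightarrow> nat) \<and> incseq (\<lambda>k. s (r k))"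
  for s :: "nat \<Rightarrow> nat"
proof -
  obtain r where r: "strict_mono (r :: nat \<Rightarrow> nat)" "monoseq (\<lambda>k. s (r k))"
    using seq_monosub by blast
  show ?thesis
  proof (cases "incseq (\<lambda>k. s (r k))")
    case False
    with r(2) have dec: "decseq (\<lambda>k. s (r k))" by (auto simp: monoseq_iff)
    define l where "l = (LEAST y. y \<in> range (\<lambda>k. s (r k)))"
    have "l \<in> range (\<lambda>k. s (r k))" unfolding l_def by (rule LeastI) (rule rangeI)
    then obtain k0 where k0: "s (r k0) = l" by auto
    have "s (r (k + k0)) = l" for k
    proof (rule antisym)
      show "s (r (k + k0)) \<le> l" using decseqD[OF dec, of k0 "k + k0"] k0 by simp
      show "l \<le> s (r (k + k0))" unfolding l_def by (rule Least_le) (rule rangeI)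
    qed
    moreover have "strict_mono (\<lambda>k. r (k + k0))" using r(1) by (simp add: strict_mono_def)
    ultimately show ?thesis by (intro exI[of _ "\<lambda>k. r (k + k0)"]) (simp add: incseq_def)
  qed (use r in blast)
qed

text \<open>Dickson's lemma with positions: thin out to a subsequence nondecreasing in every
  exponent, then find two members in the same position by the pigeonhole principle; the earlier
  divides the later.\<close>

lemma dickson_term:
  fixes m :: "nat \<Rightarrow> 'n::finite \<Rightarrow>\<^sub>0 nat" and i :: "nat \<Rightarrow> 'q::finite"
  shows "\<exists>k l u. k < l \<and> i k = i l \<and> m l = u + m k"
proof -
  have "\<exists>r. strict_mono (r :: nat \<Rightarrow> nat) \<and> (\<forall>j\<in>A. incseq (\<lambda>k. Poly_Mapping.lookup (m (r k)) j))"
    if "finite A" for A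
    using that
  proof (induction A)
    case empty
    show ?case by (intro exI[of _ id]) (simp add: strict_mono_def)
  next
    case (insert j A)
    then obtain r where r: "strict_mono (r :: nat \<Rightarrow> nat)"
      "\<And>j. j \<in> A \<Longrightarrow> incseq (\<lambda>k. Poly_Mapping.lookup (m (r k)) j)" by blast
    obtain r' where r': "strict_mono (r' :: nat \<Rightarrow> nat)" "incseq (\<lambda>k. Poly_Mapping.lookup (m (r (r' k))) j)"
      using nat_seq_mono_subseq[of "\<lambda>k. Poly_Mapping.lookup (m (r k)) j"] by blast
    have "incseq (\<lambda>k. Poly_Mapping.lookup (m (r (r' k))) j')" if "j' \<in> A" for j'
      using r(2)[OF that] strict_mono_mono[OF r'(1)] by (simp add: incseq_def mono_def)
    moreover have "strict_mono (\<lambda>k. r (r' k))"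
      using r(1) r'(1) by (simp add: strict_mono_def)
    ultimately show ?case using r'(2) by (intro exI[of _ "\<lambda>k. r (r' k)"]) auto
  qed
  from this[of UNIV] obtain r where r: "strict_mono (r :: nat \<Rightarrow> nat)"
    "\<And>j. incseq (\<lambda>k. Poly_Mapping.lookup (m (r k)) j)" by auto
  have "\<exists>k0. infinite {k. i (r k) = i (r k0)}"
    using pigeonhole_infinite[of "UNIV :: nat set" "\<lambda>k. i (r k)"] by (auto simp: finite)
  then obtain k0 where k0: "infinite {k. i (r k) = i (r k0)}" by blast
  obtain k where k: "i (r k) = i (r k0)" using k0 by blast
  obtain l where l: "k < l" "i (r l) = i (r k0)"
    using k0 unfolding infinite_nat_iff_unbounded by blast
  have "m (r l) = (m (r l) - m (r k)) + m (r k)"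
    using incseqD[OF r(2) less_imp_le[OF l(1)]] by (intro poly_mapping_eqI) (simp add: lookup_add lookup_minus)
  then show ?thesis
    using l k strict_monoD[OF r(1) l(1)] by metis
qed

lemma lookup_single_mult_add:
  "Poly_Mapping.lookup (Poly_Mapping.single u c * p) (u + m) = c * Poly_Mapping.lookup p m"
  for p :: "'n cpoly"
  by (induction p rule: poly_mapping_single_induct)
     (auto simp: distrib_left lookup_add mult_single lookup_single when_def)

lemma lookup_single_mult_nonzero:
  fixes p :: "'n cpoly"
  assumes "Poly_Mapping.lookup (Poly_Mapping.single u c * p) m' \<noteq> 0"
  shows "\<exists>m. m' = u + m \<and> Poly_Mapping.lookup p m \<noteq> 0"
proof -
  have "m' \<in> {a + b |a b. a \<in> Poly_Mapping.keys (Poly_Mapping.single u c) \<and> b \<in> Poly_Mapping.keys p}"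
    using keys_mult[of "Poly_Mapping.single u c" p] assms by (auto simp: in_keys_iff)
  then show ?thesis by (auto simp: in_keys_iff lookup_single when_def split: if_splits)
qed

text \<open>Take \<open>g k\<close> new at step \<open>k\<close> with least leading code. By
  Dickson's lemma the leading term of some \<open>g k\<close> divides that of a later
  \<open>g l\<close>. Cancelling it with a multiple of \<open>g k\<close>, which lies in
  \<open>N l\<close>, leaves an element still new at step \<open>l\<close> but with smaller
  code.\<close>

lemma no_ascending_submodule_chain:
  fixes N :: "nat \<Rightarrow> ('n::finite cpoly ^ 'q::finite) set"
  assumes sub: "\<And>k. is_D_submodule (N k)" and strict: "\<And>k. N k \<subset> N (Suc k)"
  shows False
proof -
  obtain T :: "('n \<Rightarrow>\<^sub>0 nat) \<Rightarrow> 'q \<Rightarrow> nat" where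
    T_inj: "\<And>m i m' i'. T m i = T m' i' \<Longrightarrow> m = m' \<and> i = i'" and
    T_mono: "\<And>u m i m' i'. T m i \<le> T m' i' \<Longrightarrow> T (u + m) i \<le> T (u + m') i'"
    using exists_term_code[where 'n = 'n and 'q = 'q] by blast
  define codes where "codes v = (\<Union>i. (\<lambda>m. T m i) ` Poly_Mapping.keys (v $ i))" for v :: "'n cpoly ^ 'q"
  define code where "code v = Max (codes v)" for v
  have fin: "finite (codes v)" for v by (simp add: codes_def)
  have ne: "codes v \<noteq> {}" if "v \<noteq> 0" for v
    using that by (auto simp: codes_def vec_eq_iff)
  have le_code: "T m i \<le> code v" if "Poly_Mapping.lookup (v $ i) m \<noteq> 0" for v m i
    unfolding code_def codes_def[of v] using that
    by (intro Max_ge fin[unfolded codes_def]) (blast intro: in_keys_iff[THEN iffD2])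
  have code_attained: "\<exists>m i. Poly_Mapping.lookup (v $ i) m \<noteq> 0 \<and> T m i = code v" if v: "v \<noteq> 0" for v
  proof -
    obtain m i where "m \<in> Poly_Mapping.keys (v $ i)" "T m i = code v"
      using Max_in[OF fin ne[OF v]] unfolding code_def[symmetric] by (auto simp: codes_def)
    then show ?thesis by (auto simp: in_keys_iff)
  qed
  have "\<exists>g. g \<in> N (Suc k) - N k \<and> (\<forall>h \<in> N (Suc k) - N k. code g \<le> code h)" for k
    using strict[of k] ex_has_least_nat[of "\<lambda>g. g \<in> N (Suc k) - N k" _ code] by blast
  then obtain g where g: "\<And>k. g k \<in> N (Suc k) - N k"
    and gmin: "\<And>k h. h \<in> N (Suc k) - N k \<Longrightarrow> code (g k) \<le> code h" by metis
  have nz: "v \<noteq> 0" if "v \<notin> N k" for v k using that vmod.subspace_0[OF sub] by auto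
  have "\<exists>m i. Poly_Mapping.lookup (g k $ i) m \<noteq> 0 \<and> T m i = code (g k)" for k
    using code_attained nz g by blast
  then obtain m i where lead: "\<And>k. Poly_Mapping.lookup (g k $ i k) (m k) \<noteq> 0"
    and lcode: "\<And>k. T (m k) (i k) = code (g k)" by metis
  obtain k l u where kl: "k < l" "i k = i l" and u: "m l = u + m k"
    using dickson_term[of i m] by (elim exE conjE)
  define c where "c = Poly_Mapping.lookup (g l $ i l) (m l) / Poly_Mapping.lookup (g k $ i k) (m k)"
  define h where "h = g l - Poly_Mapping.single u c *s g k"
  have mono: "N a \<subseteq> N b" if "a \<le> b" for a b
    by (rule lift_Suc_mono_le[of N, OF psubset_imp_subset[OF strict] that])
  have gk: "Poly_Mapping.single u c *s g k \<in> N l"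
    using g[of k] mono[of "Suc k" l] kl(1) by (intro vmod.subspace_scale[OF sub]) auto
  have "h \<in> N (Suc l)"
    unfolding h_def using g[of l] gk mono[of l "Suc l"] by (intro vmod.subspace_diff[OF sub]) auto
  moreover have "h \<notin> N l"
    using vmod.subspace_add[OF sub _ gk, of h] g[of l] by (auto simp: h_def)
  ultimately have hN: "h \<in> N (Suc l) - N l" by blast
  then obtain m' i' where hm: "Poly_Mapping.lookup (h $ i') m' \<noteq> 0" "T m' i' = code h"
    using code_attained[of h] nz by blast
  have hl: "Poly_Mapping.lookup (h $ i') m' = Poly_Mapping.lookup (g l $ i') m'
      - Poly_Mapping.lookup (Poly_Mapping.single u c * g k $ i') m'"
    by (simp add: h_def lookup_minus)
  have "T m' i' \<le> code (g l)"
  proof (cases "Poly_Mapping.lookup (g l $ i') m' = 0")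
    case True
    then obtain m0 where m0: "m' = u + m0" "Poly_Mapping.lookup (g k $ i') m0 \<noteq> 0"
      using hm(1) hl lookup_single_mult_nonzero[of u c "g k $ i'" m'] by auto
    have "T m0 i' \<le> T (m k) (i k)" using le_code[OF m0(2)] lcode by simp
    then have "T m' i' \<le> T (m l) (i l)" using T_mono u kl(2) m0(1) by metis
    then show ?thesis by (simp add: lcode)
  qed (rule le_code)
  moreover have "T m' i' \<noteq> code (g l)"
  proof
    assume "T m' i' = code (g l)"
    then have eq: "m' = m l" "i' = i l" using T_inj[of m' i' "m l" "i l"] lcode by auto
    have "Poly_Mapping.lookup (h $ i') m' = 0"
      unfolding hl unfolding eq unfolding u lookup_single_mult_add
      using lead[of k] kl(2) by (simp add: c_def u)
    with hm(1) show False by simp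
  qed
  ultimately show False using gmin[OF hN] hm(2) by simp
qed

lemma exists_maximal_submodule:
  fixes S :: "('n::finite cpoly ^ 'q::finite) set set"
  assumes "N0 \<in> S" and sub: "\<And>N. N \<in> S \<Longrightarrow> is_D_submodule N"
  shows "\<exists>N\<in>S. \<forall>N'\<in>S. N \<subseteq> N' \<longrightarrow> N' = N"
proof -
  have "wf {(B, A). A \<subset> B \<and> A \<in> S \<and> B \<in> S}"
    unfolding wf_iff_no_infinite_down_chain
    using no_ascending_submodule_chain sub by (metis (mono_tags, lifting) case_prodD mem_Collect_eq)
  from wfE_min[OF this \<open>N0 \<in> S\<close>] obtain N where N: "N \<in> S"
    and max: "\<And>y. (y, N) \<in> {(B, A). A \<subset> B \<and> A \<in> S \<and> B \<in> S} \<Longrightarrow> y \<notin> S" by blast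
  have "N' = N" if "N' \<in> S" "N \<subseteq> N'" for N'
  proof (rule ccontr)
    assume "N' \<noteq> N"
    then have "(N', N) \<in> {(B, A). A \<subset> B \<and> A \<in> S \<and> B \<in> S}" using that N by blast
    then show False using max that(1) by blast
  qed
  then show ?thesis using N by blast
qed

text \<open>An ideal is a submodule of the free module of rank one, realised by vectors over the
  one-element index type.\<close>

lemma exists_maximal_ideal:
  fixes S :: "'n::finite cpoly set set"
  assumes "I0 \<in> S" and sub: "\<And>I. I \<in> S \<Longrightarrow> is_D_ideal I"
  shows "\<exists>I\<in>S. \<forall>I'\<in>S. I \<subseteq> I' \<longrightarrow> I' = I"
proof -
  define E :: "'n cpoly set \<Rightarrow> ('n cpoly ^ 1) set" where "E I = {v. \<forall>j. v $ j \<in> I}" for I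
  have E: "E I \<subseteq> E I' \<longleftrightarrow> I \<subseteq> I'" for I I'
  proof
    assume *: "E I \<subseteq> E I'"
    show "I \<subseteq> I'"
    proof
      fix r assume "r \<in> I"
      then have "(\<chi> j. r) \<in> E I" by (simp add: E_def)
      then have "(\<chi> j. r) \<in> E I'" using * by blast
      then show "r \<in> I'" by (simp add: E_def)
    qed
  qed (auto simp: E_def)
  have "\<exists>N\<in>E ` S. \<forall>N'\<in>E ` S. N \<subseteq> N' \<longrightarrow> N' = N"
  proof (rule exists_maximal_submodule)
    show "E I0 \<in> E ` S" using assms(1) by blast
    fix N assume "N \<in> E ` S"
    then obtain I where "I \<in> S" "N = E I" by blast
    then show "is_D_submodule N"
      using sub[of I] by (auto simp: vmod.subspace_def cmod.subspace_def E_def)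
  qed
  then obtain N where "N \<in> E ` S" and N: "\<And>N'. N' \<in> E ` S \<Longrightarrow> N \<subseteq> N' \<Longrightarrow> N' = N" by metis
  then obtain I where I: "I \<in> S" "N = E I" by blast
  have "I' = I" if "I' \<in> S" "I \<subseteq> I'" for I'
  proof -
    have "E I' = E I" using N[OF imageI[OF that(1)]] that(2) unfolding I(2) E .
    then show ?thesis using E[of I' I] that(2) by simp
  qed
  then show ?thesis using I(1) by blast
qed

subsection \<open>Associated primes\<close>

lemma subspace_preimage_scale:
  fixes N :: "('n::finite cpoly ^ 'q) set"
  assumes N: "is_D_submodule N"
  shows "is_D_submodule {x. r *s x \<in> N}"
proof (rule vmod.subspaceI)
  fix c x assume "x \<in> {x. r *s x \<in> N}"
  then show "c *s x \<in> {x. r *s x \<in> N}"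
    using vmod.subspace_scale[OF N, of "r *s x" c] by (simp add: mult.commute)
qed (auto simp: vmod.scale_right_distrib vmod.subspace_0[OF N] vmod.subspace_add[OF N])

lemma ideal_quotient:
  fixes N :: "('n::finite cpoly ^ 'q) set"
  assumes N: "is_D_submodule N"
  shows "is_D_ideal {r. r *s x \<in> N}"
proof (rule cmod.subspaceI)
  fix c r assume "r \<in> {r. r *s x \<in> N}"
  then show "c * r \<in> {r. r *s x \<in> N}"
    using vmod.subspace_scale[OF N, of "r *s x" c] by simp
qed (auto simp: vmod.scale_left_distrib vmod.subspace_0[OF N] vmod.subspace_add[OF N])

text \<open>The submodules \<open>{x. f ^ k *s x \<in> N}\<close> increase with \<open>k\<close>, so
  a maximal one absorbs them all.\<close>

lemma power_stabilizes:
  fixes N :: "('n::finite cpoly ^ 'q::finite) set"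
  assumes N: "is_D_submodule N"
  shows "\<exists>k. \<forall>l x. f ^ l *s x \<in> N \<longrightarrow> f ^ k *s x \<in> N"
proof -
  have "\<exists>A\<in>range (\<lambda>k. {x. f ^ k *s x \<in> N}). \<forall>A'\<in>range (\<lambda>k. {x. f ^ k *s x \<in> N}). A \<subseteq> A' \<longrightarrow> A' = A"
    by (rule exists_maximal_submodule) (auto intro: subspace_preimage_scale N)
  then obtain A where "A \<in> range (\<lambda>k. {x. f ^ k *s x \<in> N})"
    and A: "\<And>A'. A' \<in> range (\<lambda>k. {x. f ^ k *s x \<in> N}) \<Longrightarrow> A \<subseteq> A' \<Longrightarrow> A' = A" by metis
  then obtain k where Ak: "A = {x. f ^ k *s x \<in> N}" by blast
  have k: "{x. f ^ l *s x \<in> N} = {x. f ^ k *s x \<in> N}"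
    if "{x. f ^ k *s x \<in> N} \<subseteq> {x. f ^ l *s x \<in> N}" for l
    using A[OF rangeI[of _ l]] that unfolding Ak .
  have up: "f ^ (l + d) *s x \<in> N" if "f ^ l *s x \<in> N" for l d x
    using vmod.subspace_scale[OF N that, of "f ^ d"] by (simp add: power_add mult.commute)
  have "f ^ k *s x \<in> N" if "f ^ l *s x \<in> N" for l x
    using k[of "k + l"] up[of k _ l] up[OF that, of k] by (auto simp: add.commute)
  then show ?thesis by blast
qed

text \<open>For operators nonzero at \<open>b\<close> the submodules
  \<open>{x. s *s x \<in> M}\<close> are directed, the one for \<open>t * s\<close> containing those
  for \<open>t\<close> and \<open>s\<close>, so a maximal one is the largest: the kernel of the map
  into the localization at \<open>b\<close> of the quotient by \<open>M\<close>.\<close>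

lemma uniform_denominator:
  fixes M :: "('n::finite cpoly ^ 'q::finite) set"
  assumes M: "is_D_submodule M"
  shows "\<exists>s. cpoly_eval s b \<noteq> 0 \<and> (\<forall>t x. cpoly_eval t b \<noteq> 0 \<longrightarrow> t *s x \<in> M \<longrightarrow> s *s x \<in> M)"
proof -
  let ?S = "(\<lambda>s. {x. s *s x \<in> M}) ` {s. cpoly_eval s b \<noteq> 0}"
  have "\<exists>A\<in>?S. \<forall>A'\<in>?S. A \<subseteq> A' \<longrightarrow> A' = A"
    by (rule exists_maximal_submodule[where ?N0.0 = "{x. 1 *s x \<in> M}"])
       (auto intro!: subspace_preimage_scale M image_eqI[where x = 1])
  then obtain A where "A \<in> ?S" and A: "\<And>A'. A' \<in> ?S \<Longrightarrow> A \<subseteq> A' \<Longrightarrow> A' = A" by metis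
  then obtain s where s: "cpoly_eval s b \<noteq> 0" and As: "A = {x. s *s x \<in> M}" by blast
  have max: "{x. t *s x \<in> M} = {x. s *s x \<in> M}"
    if "cpoly_eval t b \<noteq> 0" "{x. s *s x \<in> M} \<subseteq> {x. t *s x \<in> M}" for t
    using A[OF imageI, of t] that unfolding As by simp
  have "s *s x \<in> M" if t: "cpoly_eval t b \<noteq> 0" and x: "t *s x \<in> M" for t x
  proof -
    have "{x. s *s x \<in> M} \<subseteq> {x. (t * s) *s x \<in> M}"
      using vmod.subspace_scale[OF M, of "s *s _" t] by auto
    moreover have "(t * s) *s x \<in> M"
      using vmod.subspace_scale[OF M x, of s] by (simp add: mult.commute)
    ultimately show ?thesis using max[of "t * s"] s t by auto
  qed
  then show ?thesis using s by blast
qed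

text \<open>Among the annihilators of nonzero multiples of the class of \<open>x\<close>, a maximal
  one is prime. Staying with multiples of \<open>x\<close> ensures that this prime contains every
  operator that annihilates \<open>x\<close>, which later arguments exploit.\<close>

lemma exists_associated_prime:
  fixes N :: "('n::finite cpoly ^ 'q::finite) set"
  assumes N: "is_D_submodule N" and x: "x \<notin> N"
  shows "\<exists>u. {r. r *s (u *s x) \<in> N} \<in> associated_primes N"
proof -
  let ?S = "(\<lambda>u. {r. r *s (u *s x) \<in> N}) ` {u. u *s x \<notin> N}"
  have "\<exists>I\<in>?S. \<forall>I'\<in>?S. I \<subseteq> I' \<longrightarrow> I' = I"
  proof (rule exists_maximal_ideal)
    show "{r. r *s (1 *s x) \<in> N} \<in> ?S" using x by (intro imageI) simp
    fix I assume "I \<in> ?S"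
    then obtain u where "I = {r. r *s (u *s x) \<in> N}" by (rule imageE)
    then show "is_D_ideal I" using ideal_quotient[OF N] by metis
  qed
  then obtain I where "I \<in> ?S" and I: "\<And>I'. I' \<in> ?S \<Longrightarrow> I \<subseteq> I' \<Longrightarrow> I' = I" by metis
  then obtain u where u: "u *s x \<notin> N" and Iu: "I = {r. r *s (u *s x) \<in> N}" by blast
  have max: "{r. r *s (v *s x) \<in> N} = {r. r *s (u *s x) \<in> N}"
    if "v *s x \<notin> N" "{r. r *s (u *s x) \<in> N} \<subseteq> {r. r *s (v *s x) \<in> N}" for v
    using I[OF imageI, of v] that unfolding Iu by simp
  let ?P = "{r. r *s (u *s x) \<in> N}"
  have "is_D_prime ?P"
    unfolding is_D_prime_def
  proof (intro conjI allI impI)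
    show "is_D_ideal ?P" by (rule ideal_quotient[OF N])
    have "1 \<notin> ?P" using u by simp
    then show "?P \<noteq> UNIV" by blast
    fix r s assume rs: "r * s \<in> ?P"
    show "r \<in> ?P \<or> s \<in> ?P"
    proof (rule disjCI)
      assume "s \<notin> ?P"
      then have "(s * u) *s x \<notin> N" by (simp)
      moreover have "?P \<subseteq> {r. r *s ((s * u) *s x) \<in> N}"
      proof
        fix p assume "p \<in> ?P"
        then have "s *s (p *s (u *s x)) \<in> N" using vmod.subspace_scale[OF N] by blast
        then show "p \<in> {r. r *s ((s * u) *s x) \<in> N}"
          by (simp only: mem_Collect_eq vmod.scale_scale mult.assoc mult.commute mult.left_commute)
      qed
      ultimately have "{r. r *s ((s * u) *s x) \<in> N} = ?P" by (rule max)
      moreover have "r \<in> {r. r *s ((s * u) *s x) \<in> N}"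
        using rs by (simp only: mem_Collect_eq vmod.scale_scale mult.assoc)
      ultimately show "r \<in> ?P" by simp
    qed
  qed
  then show ?thesis unfolding associated_primes_def
    by (intro exI[where x = u] CollectI conjI exI[where x = "u *s x"] refl)
qed

text \<open>If \<open>x\<close> were outside \<open>N\<close>, then \<open>P\<close> would be the
  annihilator of a multiple of \<open>x\<close> modulo \<open>N\<close> and would contain
  \<open>s\<close>.\<close>

lemma primary_nonzerodivisor:
  assumes "is_primary_submodule P N" and "s \<notin> P" and "s *s x \<in> N"
  shows "x \<in> N"
proof (rule ccontr)
  assume "x \<notin> N"
  have N: "is_D_submodule N" and ass: "associated_primes N = {P}"
    using assms(1) by (auto simp: is_primary_submodule_def)
  obtain u where "{r. r *s (u *s x) \<in> N} = P"
    using exists_associated_prime[OF N \<open>x \<notin> N\<close>] unfolding ass by (elim exE) (auto dest: singletonD)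
  moreover have "s *s (u *s x) \<in> N"
    using vmod.subspace_scale[OF N assms(3), of u] by (simp add: mult.commute)
  ultimately show False using \<open>s \<notin> P\<close> by blast
qed

text \<open>Choose \<open>k\<close> where the \<open>f\<close>-power torsion modulo \<open>N\<close>
  stabilizes. If \<open>f ^ k *s x\<close> survived, \<open>P\<close> would be the annihilator of a
  nonzero multiple \<open>u *s (f ^ k *s x)\<close>. As \<open>f \<in> P\<close>, the vector
  \<open>u *s x\<close> is \<open>f\<close>-power torsion, so \<open>f ^ k\<close> already kills it,
  a contradiction.\<close>

lemma primary_power_in:
  assumes "is_primary_submodule P N" and "f \<in> P"
  shows "\<exists>k. f ^ k *s x \<in> N"
proof -
  have N: "is_D_submodule N" and ass: "associated_primes N = {P}"
    using assms(1) by (auto simp: is_primary_submodule_def)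
  obtain k where k: "\<And>l x. f ^ l *s x \<in> N \<Longrightarrow> f ^ k *s x \<in> N"
    using power_stabilizes[OF N] by blast
  have "f ^ k *s x \<in> N"
  proof (rule ccontr)
    assume notin: "f ^ k *s x \<notin> N"
    obtain u where u: "{r. r *s (u *s (f ^ k *s x)) \<in> N} \<in> associated_primes N"
      using exists_associated_prime[OF N notin] by (elim exE)
    then have P: "{r. r *s (u *s (f ^ k *s x)) \<in> N} = P" unfolding ass by (rule singletonD)
    have "f \<in> {r. r *s (u *s (f ^ k *s x)) \<in> N}" unfolding P by fact
    then have "f *s (u *s (f ^ k *s x)) \<in> N" by (rule CollectD)
    moreover have "f *s (u *s (f ^ k *s x)) = f ^ Suc k *s (u *s x)"
      by (simp only: vmod.scale_scale power_Suc mult.commute mult.left_commute)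
    ultimately have "f ^ k *s (u *s x) \<in> N" using k by metis
    moreover have "1 *s (u *s (f ^ k *s x)) = f ^ k *s (u *s x)"
      by (simp add: mult.commute)
    ultimately have "1 \<in> {r. r *s (u *s (f ^ k *s x)) \<in> N}" by simp
    then have "1 \<in> P" unfolding P .
    moreover have prime: "is_D_prime P" using u P by (simp add: associated_primes_def)
    ultimately have "r \<in> P" for r
      using cmod.subspace_scale[of P 1 r] by (simp add: is_D_prime_def)
    then show False using prime by (auto simp: is_D_prime_def)
  qed
  then show ?thesis by blast
qed

subsection \<open>Pairing of operator vectors with signal vectors\<close>

definition vapply :: "'n::finite cpoly ^ 'q::finite \<Rightarrow> (real ^ 'n \<Rightarrow> complex) ^ 'q \<Rightarrow> real ^ 'n \<Rightarrow> complex" where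
  "vapply r f = (\<Sum>j\<in>UNIV. D_apply (r $ j) (f $ j))"

lemma vapply_zero_iff:
  "(\<lambda>x. \<Sum>j\<in>UNIV. D_apply (r $ j) (f $ j) x) = (\<lambda>x. 0) \<longleftrightarrow> vapply r f = 0"
proof -
  have "(\<lambda>x. \<Sum>j\<in>UNIV. D_apply (r $ j) (f $ j) x) = vapply r f"
    by (rule ext) (simp add: vapply_def sum_fun_apply)
  then show ?thesis by (simp add: zero_fun_def)
qed

lemma vapply_zero [simp]: "vapply 0 f = 0"
  by (simp add: vapply_def)

lemma vapply_add: "vapply (r + s) f = vapply r f + vapply s f"
  by (simp add: vapply_def D_apply_plus sum.distrib)

lemma vapply_diff: "vapply (r - s) f = vapply r f - vapply s f"
  by (simp add: vapply_def D_apply_minus sum_subtractf)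

lemma vapply_signals: "(\<And>j. f $ j \<in> signals) \<Longrightarrow> vapply r f \<in> signals"
  unfolding vapply_def by (intro signals_sum D_apply_signals)

lemma vapply_gen_signals: "(\<And>j. f $ j \<in> gen_signals b) \<Longrightarrow> vapply r f \<in> gen_signals b"
  unfolding vapply_def by (intro gen_signals_sum gen_signals_D_apply)

lemma vapply_scale:
  assumes "\<And>j. f $ j \<in> signals"
  shows "vapply (c *s r) f = D_apply c (vapply r f)"
proof -
  have "D_apply c (vapply r f) = (\<Sum>j\<in>UNIV. D_apply c (D_apply (r $ j) (f $ j)))"
    unfolding vapply_def by (intro D_apply_fun_sum D_apply_signals assms)
  also have "\<dots> = vapply (c *s r) f"
    unfolding vapply_def by (intro sum.cong refl) (simp add: D_apply_mult[OF assms])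
  finally show ?thesis by simp
qed

lemma vapply_axis: "vapply (axis i r) f = D_apply r (f $ i)"
proof -
  have "vapply (axis i r) f = (\<Sum>j\<in>UNIV. if j = i then D_apply r (f $ j) else 0)"
    unfolding vapply_def by (intro sum.cong refl) (simp add: axis_def)
  then show ?thesis by simp
qed

lemma behavior_of_iff:
  "f \<in> behavior_of M \<longleftrightarrow> (\<forall>j. f $ j \<in> signals) \<and> (\<forall>r\<in>M. vapply r f = 0)"
  by (simp add: behavior_of_def vapply_zero_iff)

lemma annihilator_of_iff: "r \<in> annihilator_of B \<longleftrightarrow> (\<forall>f\<in>B. vapply r f = 0)"
  by (simp add: annihilator_of_def vapply_zero_iff)

lemma willems_closure_iff:
  "r \<in> willems_closure M \<longleftrightarrow> (\<forall>f\<in>behavior_of M. vapply r f = 0)"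
  by (simp add: willems_closure_def annihilator_of_iff)

lemma behavior_signals: "f \<in> behavior_of M \<Longrightarrow> f $ j \<in> signals"
  by (simp add: behavior_of_iff)

subsection \<open>Extending functionals to signals\<close>

text \<open>Constant polynomials make the free module a complex vector space; composing with
  \<open>\<pi>\<close> extends a complex-linear functional from \<open>S\<close> to the whole
  module.\<close>

lemma complex_subspace_projection:
  fixes S :: "('n::finite cpoly ^ 'q::finite) set"
  assumes "0 \<in> S" and "\<And>u v. u \<in> S \<Longrightarrow> v \<in> S \<Longrightarrow> u + v \<in> S"
    and "\<And>c v. v \<in> S \<Longrightarrow> cpoly_const c *s v \<in> S"
  shows "\<exists>\<pi>. (\<forall>u v. \<pi> (u + v) = \<pi> u + \<pi> v) \<and> (\<forall>c v. \<pi> (cpoly_const c *s v) = cpoly_const c *s \<pi> v) \<and>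
    (\<forall>v. \<pi> v \<in> S) \<and> (\<forall>v\<in>S. \<pi> v = v)"
proof -
  define sc where "sc c v = cpoly_const c *s v" for c and v :: "'n cpoly ^ 'q"
  interpret V: vector_space sc
    by unfold_locales
       (simp_all add: sc_def vmod.scale_right_distrib vmod.scale_left_distrib cpoly_const_add cpoly_const_mult)
  interpret P: vector_space_pair sc sc ..
  have S: "V.subspace S"
    by (rule V.subspaceI) (auto simp: sc_def assms)
  have "\<exists>g. g ` UNIV \<subseteq> S \<and> Vector_Spaces.linear sc sc g \<and> (\<forall>v\<in>S. g (id v) = v)"
    using P.linear_exists_left_inverse_on[OF V.linear_id S] by simp
  then obtain g where g: "range g \<subseteq> S" "Vector_Spaces.linear sc sc g" "\<And>v. v \<in> S \<Longrightarrow> g v = v" by auto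
  have "g (u + v) = g u + g v" for u v by (rule P.linear_add[OF g(2)])
  moreover have "g (cpoly_const c *s v) = cpoly_const c *s g v" for c v
    using P.linear_scale[OF g(2), of c v] unfolding sc_def .
  moreover have "g v \<in> S" for v using g(1) rangeI[of g v] by (rule subsetD)
  ultimately show ?thesis using g(3) by (intro exI[where x = g] conjI allI ballI)
qed

text \<open>The argument that replaces the Artin-Rees lemma: by maximality, a submodule \<open>N\<close> maximal with
  \<open>N \<inter> U = W\<close> absorbs \<open>f\<^sup>i\<close> times the whole module whenever \<open>f\<close> is nilpotent on \<open>U / W\<close>.\<close>

lemma maximal_complement_nilpotent:
  fixes U W :: "('n::finite cpoly ^ 'q::finite) set"
  assumes U: "is_D_submodule U" and W: "is_D_submodule W" and "W \<subseteq> U"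
  obtains N where "is_D_submodule N" "N \<inter> U = W"
    "\<And>f k. (\<And>u. u \<in> U \<Longrightarrow> f ^ k *s u \<in> W) \<Longrightarrow> \<exists>i. \<forall>v. f ^ i *s v \<in> N"
proof -
  define S where "S = {N. is_D_submodule N \<and> N \<inter> U = W}"
  have "W \<in> S" using W \<open>W \<subseteq> U\<close> by (auto simp: S_def)
  moreover have "\<And>N. N \<in> S \<Longrightarrow> is_D_submodule N" by (simp add: S_def)
  ultimately obtain N where "N \<in> S" and max: "\<And>N'. N' \<in> S \<Longrightarrow> N \<subseteq> N' \<Longrightarrow> N' = N"
    using exists_maximal_submodule[of W S] by metis
  then have N: "is_D_submodule N" and NU: "N \<inter> U = W" by (auto simp: S_def)
  have "\<exists>i. \<forall>v. f ^ i *s v \<in> N" if nil: "\<And>u. u \<in> U \<Longrightarrow> f ^ k *s u \<in> W" for f k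
  proof -
    obtain i where i: "\<forall>l x. f ^ l *s x \<in> N \<longrightarrow> f ^ i *s x \<in> N"
      using power_stabilizes[OF N, of f] by (elim exE)
    \<comment> \<open>\<open>N\<close> enlarged by \<open>f ^ i\<close> times the whole module. If
      \<open>y \<in> U\<close> is congruent to \<open>f ^ i *s z\<close> modulo \<open>N\<close>,
      then \<open>f ^ k *s y \<in> N\<close> makes \<open>z\<close> an \<open>f\<close>-power
      torsion element modulo \<open>N\<close>; hence \<open>f ^ i *s z \<in> N\<close> by the choice
      of \<open>i\<close>, and \<open>y\<close> lies in \<open>N \<inter> U = W\<close>.\<close>
    define N' where "N' = {y. \<exists>z. y - f ^ i *s z \<in> N}"
    have N': "is_D_submodule N'"
    proof (rule vmod.subspaceI)
      have "0 - f ^ i *s 0 \<in> N" by (simp add: vmod.subspace_0[OF N])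
      then show "0 \<in> N'" unfolding N'_def by (intro CollectI exI)
    next
      fix x y assume "x \<in> N'" "y \<in> N'"
      then obtain z w where "x - f ^ i *s z \<in> N" "y - f ^ i *s w \<in> N" unfolding N'_def by auto
      then have "(x - f ^ i *s z) + (y - f ^ i *s w) \<in> N" by (rule vmod.subspace_add[OF N])
      moreover have "(x - f ^ i *s z) + (y - f ^ i *s w) = (x + y) - f ^ i *s (z + w)"
        by (simp add: vmod.scale_right_distrib)
      ultimately show "x + y \<in> N'" unfolding N'_def by (intro CollectI exI[where x = "z + w"]) (simp only:)
    next
      fix c x assume "x \<in> N'"
      then obtain z where "x - f ^ i *s z \<in> N" unfolding N'_def by auto
      then have "c *s (x - f ^ i *s z) \<in> N" by (rule vmod.subspace_scale[OF N])
      moreover have "c *s (x - f ^ i *s z) = c *s x - f ^ i *s (c *s z)"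
        by (simp only: vmod.scale_right_diff_distrib vmod.scale_scale mult.commute)
      ultimately show "c *s x \<in> N'" unfolding N'_def by (intro CollectI exI[where x = "c *s z"]) (simp only:)
    qed
    have sub: "N \<subseteq> N'"
    proof
      fix x assume "x \<in> N"
      then have "x - f ^ i *s 0 \<in> N" by simp
      then show "x \<in> N'" unfolding N'_def by (intro CollectI exI)
    qed
    have "y \<in> W" if "y \<in> N'" "y \<in> U" for y
    proof -
      obtain z where z: "y - f ^ i *s z \<in> N" using \<open>y \<in> N'\<close> unfolding N'_def by auto
      have "f ^ k *s y \<in> N" using nil[OF \<open>y \<in> U\<close>] NU by auto
      moreover have "f ^ k *s (y - f ^ i *s z) \<in> N" by (rule vmod.subspace_scale[OF N z])
      ultimately have "f ^ k *s y - f ^ k *s (y - f ^ i *s z) \<in> N" by (rule vmod.subspace_diff[OF N])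
      moreover have "f ^ k *s y - f ^ k *s (y - f ^ i *s z) = f ^ (k + i) *s z"
        by (simp add: vmod.scale_right_diff_distrib power_add)
      ultimately have "f ^ i *s z \<in> N" using i by metis
      then have "(y - f ^ i *s z) + f ^ i *s z \<in> N" by (rule vmod.subspace_add[OF N z])
      then show ?thesis using NU \<open>y \<in> U\<close> by auto
    qed
    then have "N' \<inter> U = W" using sub NU by blast
    then have "N' = N" using max[of N'] N' sub by (simp add: S_def)
    moreover have "f ^ i *s v \<in> N'" for v
    proof -
      have "f ^ i *s v - f ^ i *s v \<in> N" by (simp add: vmod.subspace_0[OF N])
      then show ?thesis unfolding N'_def by (intro CollectI exI)
    qed
    ultimately show ?thesis by blast
  qed
  then show thesis using that N NU by blast
qed

text \<open>Extend \<open>\<phi>\<close> by 0 on a maximal \<open>N\<close> with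
  \<open>N \<inter> U = W\<close>, which is consistent because \<open>\<phi>\<close> vanishes on
  \<open>W\<close>, and then to the whole module by linear algebra. Each coordinate functional now
  vanishes on the multiples of a power of every \<open>dvar b j\<close>, so Macaulay duality turns
  it into a signal.\<close>

lemma signal_extension:
  fixes U W :: "('n::finite cpoly ^ 'q::finite) set"
  assumes b: "b \<in> integral_points"
    and U: "is_D_submodule U" and W: "is_D_submodule W" and "W \<subseteq> U"
    and add: "\<And>u v. u \<in> U \<Longrightarrow> v \<in> U \<Longrightarrow> \<phi> (u + v) = \<phi> u + \<phi> v"
    and scale: "\<And>c u. u \<in> U \<Longrightarrow> \<phi> (cpoly_const c *s u) = c * \<phi> u"
    and zero: "\<And>u. u \<in> W \<Longrightarrow> \<phi> u = (0::complex)"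
    and nil: "\<And>j. \<exists>k. \<forall>u\<in>U. dvar b j ^ k *s u \<in> W"
  shows "\<exists>f. (\<forall>i. f $ i \<in> gen_signals b) \<and> (\<forall>s\<in>U. vapply s f 0 = \<phi> s)"
proof -
  obtain N where N: "is_D_submodule N" and NU: "N \<inter> U = W" and
    Nnil: "\<And>f k. (\<And>u. u \<in> U \<Longrightarrow> f ^ k *s u \<in> W) \<Longrightarrow> \<exists>i. \<forall>v. f ^ i *s v \<in> N"
    using maximal_complement_nilpotent[OF U W \<open>W \<subseteq> U\<close>] by metis
  have "\<exists>i. \<forall>v. dvar b j ^ i *s v \<in> N" for j
  proof -
    obtain k where "\<And>u. u \<in> U \<Longrightarrow> dvar b j ^ k *s u \<in> W" using nil by metis
    then show ?thesis by (rule Nnil)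
  qed
  then obtain e where e: "\<And>j v. dvar b j ^ e j *s v \<in> N" by metis
  \<comment> \<open>The duality asks for one exponent for all variables; the sum dominates each
    \<open>e j\<close>.\<close>
  define K where "K = (\<Sum>j\<in>UNIV. e j)"
  have K: "dvar b j ^ K *s v \<in> N" for j v
  proof -
    have "e j \<le> K" unfolding K_def by (rule member_le_sum) auto
    then have "dvar b j ^ K *s v = dvar b j ^ (K - e j) *s (dvar b j ^ e j *s v)"
      by (simp add: power_add[symmetric])
    then show ?thesis using vmod.subspace_scale[OF N e] by metis
  qed
  define S where "S = {u + n |u n. u \<in> U \<and> n \<in> N}"
  have S0: "0 \<in> S" unfolding S_def using vmod.subspace_0[OF U] vmod.subspace_0[OF N] by force
  have Sadd: "x + y \<in> S" if xS: "x \<in> S" and yS: "y \<in> S" for x y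
  proof -
    obtain u n where x: "x = u + n" "u \<in> U" "n \<in> N" using xS unfolding S_def by auto
    obtain u' n' where y: "y = u' + n'" "u' \<in> U" "n' \<in> N" using yS unfolding S_def by auto
    have "x + y = (u + u') + (n + n')" by (simp add: x y)
    then show ?thesis unfolding S_def
      using vmod.subspace_add[OF U x(2) y(2)] vmod.subspace_add[OF N x(3) y(3)] by blast
  qed
  have Sscale: "cpoly_const c *s x \<in> S" if xS: "x \<in> S" for c x
  proof -
    obtain u n where x: "x = u + n" "u \<in> U" "n \<in> N" using xS unfolding S_def by auto
    have "cpoly_const c *s x = cpoly_const c *s u + cpoly_const c *s n"
      by (simp add: x vmod.scale_right_distrib)
    then show ?thesis unfolding S_def
      using vmod.subspace_scale[OF U x(2)] vmod.subspace_scale[OF N x(3)] by blast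
  qed
  obtain \<pi> where \<pi>: "\<And>u v. \<pi> (u + v) = \<pi> u + \<pi> v" "\<And>c v. \<pi> (cpoly_const c *s v) = cpoly_const c *s \<pi> v"
    "\<And>v. \<pi> v \<in> S" "\<And>v. v \<in> S \<Longrightarrow> \<pi> v = v"
    using complex_subspace_projection[OF S0 Sadd Sscale] by metis
  have well: "\<phi> u = \<phi> u'" if "u \<in> U" "n \<in> N" "u' \<in> U" "n' \<in> N" "u + n = u' + n'" for u n u' n'
  proof -
    have "u - u' = n' - n" using that(5) by (simp add: algebra_simps)
    moreover have "u - u' \<in> U" "n' - n \<in> N"
      using vmod.subspace_diff[OF U] vmod.subspace_diff[OF N] that by blast+
    ultimately have "u - u' \<in> W" using NU by auto
    then have "\<phi> (u' + (u - u')) = \<phi> u' + 0"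
      using add[OF that(3) \<open>u - u' \<in> U\<close>] zero by simp
    then show ?thesis by simp
  qed
  define val where "val x = (SOME y. \<exists>u n. u \<in> U \<and> n \<in> N \<and> x = u + n \<and> y = \<phi> u)" for x
  have val: "val (u + n) = \<phi> u" if "u \<in> U" "n \<in> N" for u n
    unfolding val_def
  proof (rule some_equality)
    show "\<exists>ua na. ua \<in> U \<and> na \<in> N \<and> u + n = ua + na \<and> \<phi> u = \<phi> ua" using that by blast
    show "y = \<phi> u" if "\<exists>ua na. ua \<in> U \<and> na \<in> N \<and> u + n = ua + na \<and> y = \<phi> ua" for y
      using that well \<open>u \<in> U\<close> \<open>n \<in> N\<close> by metis
  qed
  have val_add: "val (x + y) = val x + val y" if xS: "x \<in> S" and yS: "y \<in> S" for x y
  proof -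
    obtain u n where x: "x = u + n" "u \<in> U" "n \<in> N" using xS unfolding S_def by auto
    obtain u' n' where y: "y = u' + n'" "u' \<in> U" "n' \<in> N" using yS unfolding S_def by auto
    have "x + y = (u + u') + (n + n')" by (simp add: x y)
    then have "val (x + y) = \<phi> (u + u')"
      using val[OF vmod.subspace_add[OF U x(2) y(2)] vmod.subspace_add[OF N x(3) y(3)]] by simp
    then show ?thesis using add[OF x(2) y(2)] val[OF x(2,3)] val[OF y(2,3)] x(1) y(1) by simp
  qed
  have val_scale: "val (cpoly_const c *s x) = c * val x" if xS: "x \<in> S" for c x
  proof -
    obtain u n where x: "x = u + n" "u \<in> U" "n \<in> N" using xS unfolding S_def by auto
    have "cpoly_const c *s x = cpoly_const c *s u + cpoly_const c *s n"
      by (simp add: x vmod.scale_right_distrib)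
    then have "val (cpoly_const c *s x) = \<phi> (cpoly_const c *s u)"
      using val[OF vmod.subspace_scale[OF U x(2)] vmod.subspace_scale[OF N x(3)]] by simp
    then show ?thesis using scale[OF x(2)] val[OF x(2,3)] x(1) by simp
  qed
  define \<psi> where "\<psi> v = val (\<pi> v)" for v
  have \<psi>_add: "\<psi> (u + v) = \<psi> u + \<psi> v" for u v
    unfolding \<psi>_def \<pi>(1) by (rule val_add[OF \<pi>(3) \<pi>(3)])
  have \<psi>_scale: "\<psi> (cpoly_const c *s v) = c * \<psi> v" for c v
    unfolding \<psi>_def \<pi>(2) by (rule val_scale[OF \<pi>(3)])
  have \<psi>_S: "\<psi> (u + n) = \<phi> u" if "u \<in> U" "n \<in> N" for u n
  proof -
    have "u + n \<in> S" unfolding S_def using that by blast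
    then show ?thesis unfolding \<psi>_def using \<pi>(4) val[OF that] by simp
  qed
  have \<psi>_U: "\<psi> u = \<phi> u" if "u \<in> U" for u
    using \<psi>_S[OF that vmod.subspace_0[OF N]] by simp
  have \<psi>_N: "\<psi> n = 0" if "n \<in> N" for n
    using \<psi>_S[OF vmod.subspace_0[OF U] that] zero[OF vmod.subspace_0[OF W]] by simp
  have "\<exists>g\<in>gen_signals b. \<forall>r. D_apply r g 0 = \<psi> (axis i r)" for i
  proof (rule functional_representation[OF b])
    show "\<psi> (axis i (r + s)) = \<psi> (axis i r) + \<psi> (axis i s)" for r s
    proof -
      have "axis i (r + s) = axis i r + axis i s" by (simp add: axis_def vec_eq_iff)
      then show ?thesis by (simp only: \<psi>_add)
    qed
    show "\<psi> (axis i (cpoly_const c * r)) = c * \<psi> (axis i r)" for c r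
    proof -
      have "axis i (cpoly_const c * r) = cpoly_const c *s axis i r" by (simp add: axis_def vec_eq_iff)
      then show ?thesis by (simp only: \<psi>_scale)
    qed
    show "\<psi> (axis i (dvar b j ^ K * r)) = 0" for j r
    proof -
      have "axis i (dvar b j ^ K * r) = dvar b j ^ K *s axis i r" by (simp add: axis_def vec_eq_iff)
      then show ?thesis using \<psi>_N[OF K] by simp
    qed
  qed
  then obtain g where g: "\<And>i. g i \<in> gen_signals b" "\<And>i r. D_apply r (g i) 0 = \<psi> (axis i r)" by metis
  have \<psi>_sum: "\<psi> (\<Sum>i\<in>A. v i) = (\<Sum>i\<in>A. \<psi> (v i))" if "finite A" for A and v :: "'q \<Rightarrow> 'n cpoly ^ 'q"
    using that by (induction A) (auto simp: \<psi>_add \<psi>_N[OF vmod.subspace_0[OF N]])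
  have "vapply s (\<chi> i. g i) 0 = \<phi> s" if "s \<in> U" for s
  proof -
    have s: "s = (\<Sum>i\<in>UNIV. axis i (s $ i))" by (simp add: vec_eq_iff axis_def sum.delta)
    have "vapply s (\<chi> i. g i) 0 = (\<Sum>i\<in>UNIV. \<psi> (axis i (s $ i)))"
      by (simp add: vapply_def sum_fun_apply g(2))
    also have "\<dots> = \<psi> s" using \<psi>_sum[of UNIV "\<lambda>i. axis i (s $ i)"] s by simp
    finally show ?thesis using \<psi>_U[OF that] by simp
  qed
  then show ?thesis using g(1) by (intro exI[of _ "\<chi> i. g i"]) simp
qed

subsection \<open>The Willems closure\<close>

text \<open>Any frequency \<open>b\<close> occurring in \<open>f\<close> works: an operator killing
  \<open>f\<close> kills the component at \<open>b\<close>, hence also a common eigenfunction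
  derived from it, on which it acts as the scalar \<open>cpoly_eval r b\<close>.\<close>

lemma evaluation_nonzero_decomposition:
  assumes f: "f \<in> signals" and "f \<noteq> 0"
  shows "\<exists>b\<in>integral_points. \<forall>r. D_apply r f = 0 \<longrightarrow> cpoly_eval r b = 0"
proof -
  obtain A F where A: "finite A" "A \<subseteq> integral_points" and F: "\<And>a. F a \<in> gen_signals a"
    and fF: "f = (\<Sum>a\<in>A. F a)" using signals_decomposition[OF f] by blast
  obtain b where b: "b \<in> A" "F b \<noteq> 0" using \<open>f \<noteq> 0\<close> fF sum.neutral[of A F] by metis
  have "cpoly_eval r b = 0" if r: "D_apply r f = 0" for r
  proof -
    have "(\<Sum>a\<in>A. D_apply r (F a)) = 0"
      using r unfolding fF using D_apply_fun_sum[of A F r] gen_signals_signals[OF F] by simp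
    then have rF: "D_apply r (F b) = 0"
      using gen_signals_independent[OF A(1), of "\<lambda>a. D_apply r (F a)"] gen_signals_D_apply[OF F] b(1) by blast
    obtain r' where r': "D_apply r' (F b) \<noteq> 0" "\<And>j. D_apply (dvar b j) (D_apply r' (F b)) = 0"
      using gen_signals_socle[OF F b(2)] by blast
    have Fs: "F b \<in> signals" using gen_signals_signals[OF F] .
    have "D_apply r (D_apply r' (F b)) = D_apply r' 0"
      unfolding rF[symmetric] by (rule D_apply_commute[OF Fs])
    then have "(\<lambda>x. cpoly_eval r b * D_apply r' (F b) x) = 0"
      using eigensignal_eval[OF D_apply_signals[OF Fs] r'(2), of r] by simp
    then show ?thesis using r'(1) by (auto simp: fun_eq_iff zero_fun_apply)
  qed
  then show ?thesis using A b by blast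
qed

lemma mem_willems_closure_iff:
  fixes M :: "('n::finite cpoly ^ 'q::finite) set"
  assumes M: "is_D_submodule M"
  shows "x \<in> willems_closure M \<longleftrightarrow>
     (\<forall>b\<in>integral_points. \<exists>r. r *s x \<in> M \<and> cpoly_eval r b \<noteq> 0)"
proof
  assume x: "x \<in> willems_closure M"
  show "\<forall>b\<in>integral_points. \<exists>r. r *s x \<in> M \<and> cpoly_eval r b \<noteq> 0"
  proof (rule ballI, rule ccontr)
    fix b :: "complex ^ 'n" assume b: "b \<in> integral_points"
      and "\<not> (\<exists>r. r *s x \<in> M \<and> cpoly_eval r b \<noteq> 0)"
    then have ev: "\<And>r. r *s x \<in> M \<Longrightarrow> cpoly_eval r b = 0" by metis
    define U where "U = {u *s x + m |u m. m \<in> M}"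
    \<comment> \<open>This is m_b x + M, with m_b the ideal of \<open>b\<close>, so
      \<open>dvar b j\<close> maps \<open>U\<close> into \<open>W\<close> and the nilpotency
      exponent is 1.\<close>
    define W where "W = {u *s x + m |u m. m \<in> M \<and> cpoly_eval u b = 0}"
    define \<phi> where "\<phi> v = (SOME c. \<exists>u m. m \<in> M \<and> v = u *s x + m \<and> c = cpoly_eval u b)" for v
    have UI: "u *s x + m \<in> U" if "m \<in> M" for u m unfolding U_def using that by auto
    have UE: "\<exists>u m. m \<in> M \<and> v = u *s x + m" if "v \<in> U" for v using that unfolding U_def by auto
    have WI: "u *s x + m \<in> W" if "m \<in> M" "cpoly_eval u b = 0" for u m unfolding W_def using that by auto
    have WE: "\<exists>u m. m \<in> M \<and> v = u *s x + m \<and> cpoly_eval u b = 0" if "v \<in> W" for v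
      using that unfolding W_def by auto
    \<comment> \<open>Two representations of the same vector have coefficients of \<open>x\<close>
      differing by an operator that carries \<open>x\<close> into \<open>M\<close>, and such
      operators vanish at \<open>b\<close> by \<open>ev\<close>.\<close>
    have \<phi>: "\<phi> (u *s x + m) = cpoly_eval u b" if m: "m \<in> M" for u m
      unfolding \<phi>_def
    proof (rule some_equality)
      show "\<exists>ua ma. ma \<in> M \<and> u *s x + m = ua *s x + ma \<and> cpoly_eval u b = cpoly_eval ua b"
        using m by (intro exI[where x = u] exI[where x = m] conjI refl)
      fix c assume "\<exists>ua ma. ma \<in> M \<and> u *s x + m = ua *s x + ma \<and> c = cpoly_eval ua b"
      then obtain ua ma where *: "ma \<in> M" "u *s x + m = ua *s x + ma" "c = cpoly_eval ua b"
        by (elim exE conjE)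
      have "(u - ua) *s x = ma - m"
        using *(2) by (simp add: vmod.scale_left_diff_distrib algebra_simps)
      then have "(u - ua) *s x \<in> M" using vmod.subspace_diff[OF M *(1) m] by (simp only:)
      then have "cpoly_eval (u - ua) b = 0" by (rule ev)
      then show "c = cpoly_eval u b" using *(3) by simp
    qed
    have sum_eq: "(u *s x + m) + (u' *s x + m') = (u + u') *s x + (m + m')" for u m u' m'
      by (simp add: vmod.scale_left_distrib)
    have scale_eq: "c *s (u *s x + m) = (c * u) *s x + c *s m" for c u m
      by (simp add: vmod.scale_right_distrib)
    have zero_eq: "0 *s x + 0 = 0" by simp
    have U: "is_D_submodule U"
    proof (rule vmod.subspaceI)
      show "0 \<in> U" using UI[OF vmod.subspace_0[OF M], of 0] unfolding zero_eq .
    next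
      fix v w assume v: "v \<in> U" and w: "w \<in> U"
      obtain u m where um: "m \<in> M" "v = u *s x + m" using UE[OF v] by (elim exE conjE)
      obtain u' m' where um': "m' \<in> M" "w = u' *s x + m'" using UE[OF w] by (elim exE conjE)
      show "v + w \<in> U"
        unfolding um(2) um'(2) sum_eq by (rule UI[OF vmod.subspace_add[OF M um(1) um'(1)]])
    next
      fix c v assume v: "v \<in> U"
      obtain u m where um: "m \<in> M" "v = u *s x + m" using UE[OF v] by (elim exE conjE)
      show "c *s v \<in> U"
        unfolding um(2) scale_eq by (rule UI[OF vmod.subspace_scale[OF M um(1)]])
    qed
    have W: "is_D_submodule W"
    proof (rule vmod.subspaceI)
      show "0 \<in> W" using WI[OF vmod.subspace_0[OF M], of 0] unfolding zero_eq by simp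
    next
      fix v w assume v: "v \<in> W" and w: "w \<in> W"
      obtain u m where um: "m \<in> M" "v = u *s x + m" "cpoly_eval u b = 0"
        using WE[OF v] by (elim exE conjE)
      obtain u' m' where um': "m' \<in> M" "w = u' *s x + m'" "cpoly_eval u' b = 0"
        using WE[OF w] by (elim exE conjE)
      show "v + w \<in> W"
        unfolding um(2) um'(2) sum_eq
        by (rule WI[OF vmod.subspace_add[OF M um(1) um'(1)]]) (simp add: um(3) um'(3))
    next
      fix c v assume v: "v \<in> W"
      obtain u m where um: "m \<in> M" "v = u *s x + m" "cpoly_eval u b = 0"
        using WE[OF v] by (elim exE conjE)
      show "c *s v \<in> W"
        unfolding um(2) scale_eq by (rule WI[OF vmod.subspace_scale[OF M um(1)]]) (simp add: um(3))
    qed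
    have "W \<subseteq> U" unfolding U_def W_def by auto
    have "\<exists>f. (\<forall>i. f $ i \<in> gen_signals b) \<and> (\<forall>s\<in>U. vapply s f 0 = \<phi> s)"
    proof (rule signal_extension[OF b U W \<open>W \<subseteq> U\<close>])
      fix v w assume v: "v \<in> U" and w: "w \<in> U"
      obtain u m where um: "m \<in> M" "v = u *s x + m" using UE[OF v] by (elim exE conjE)
      obtain u' m' where um': "m' \<in> M" "w = u' *s x + m'" using UE[OF w] by (elim exE conjE)
      show "\<phi> (v + w) = \<phi> v + \<phi> w"
        unfolding um(2) um'(2) sum_eq \<phi>[OF vmod.subspace_add[OF M um(1) um'(1)]] \<phi>[OF um(1)] \<phi>[OF um'(1)]
        by simp
    next
      fix c v assume v: "v \<in> U"
      obtain u m where um: "m \<in> M" "v = u *s x + m" using UE[OF v] by (elim exE conjE)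
      show "\<phi> (cpoly_const c *s v) = c * \<phi> v"
        unfolding um(2) scale_eq \<phi>[OF vmod.subspace_scale[OF M um(1)]] \<phi>[OF um(1)] by simp
    next
      fix v assume v: "v \<in> W"
      obtain u m where um: "m \<in> M" "v = u *s x + m" "cpoly_eval u b = 0"
        using WE[OF v] by (elim exE conjE)
      show "\<phi> v = 0" unfolding um(2) \<phi>[OF um(1)] um(3) ..
    next
      fix j
      have "dvar b j ^ 1 *s v \<in> W" if v: "v \<in> U" for v
      proof -
        obtain u m where um: "m \<in> M" "v = u *s x + m" using UE[OF v] by (elim exE conjE)
        show ?thesis
          unfolding um(2) scale_eq by (rule WI[OF vmod.subspace_scale[OF M um(1)]]) simp
      qed
      then show "\<exists>k. \<forall>u\<in>U. dvar b j ^ k *s u \<in> W" by (intro exI[where x = 1] ballI)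
    qed
    then obtain f where f: "\<And>i. f $ i \<in> gen_signals b" and fU: "\<And>s. s \<in> U \<Longrightarrow> vapply s f 0 = \<phi> s"
      by (elim exE conjE) metis
    have fs: "f $ i \<in> signals" for i using gen_signals_signals[OF f] .
    have fM: "vapply m f 0 = 0" if m: "m \<in> M" for m
    proof -
      have "vapply m f 0 = \<phi> m" using UI[OF m, of 0] by (intro fU) simp
      also have "\<dots> = 0" using \<phi>[OF m, of 0] by simp
      finally show ?thesis .
    qed
    \<comment> \<open>The extension controls only values at the origin; since \<open>M\<close> is a
      submodule, applying this to all \<open>r *s m\<close> makes the whole signal vanish.\<close>
    have "vapply m f = 0" if m: "m \<in> M" for m
    proof (rule gen_signals_separated[OF vapply_gen_signals[OF f]])
      fix r
      show "D_apply r (vapply m f) 0 = 0"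
        unfolding vapply_scale[OF fs, symmetric] by (rule fM[OF vmod.subspace_scale[OF M m]])
    qed
    then have "f \<in> behavior_of M" unfolding behavior_of_iff using fs by (intro conjI allI ballI)
    then have "vapply x f = 0" using x unfolding willems_closure_iff by (rule bspec[rotated])
    moreover have "vapply x f 0 = 1"
    proof -
      have "vapply (1 *s x + 0) f 0 = \<phi> (1 *s x + 0)"
        by (rule fU[OF UI[OF vmod.subspace_0[OF M]]])
      then show ?thesis unfolding \<phi>[OF vmod.subspace_0[OF M]] by simp
    qed
    ultimately show False by (simp add: zero_fun_apply)
  qed
next
  assume H: "\<forall>b\<in>integral_points. \<exists>r. r *s x \<in> M \<and> cpoly_eval r b \<noteq> 0"
  show "x \<in> willems_closure M"
    unfolding willems_closure_iff
  proof (rule ballI, rule ccontr)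
    fix f assume f: "f \<in> behavior_of M" and nz: "vapply x f \<noteq> 0"
    have fs: "f $ i \<in> signals" for i using behavior_signals[OF f] .
    obtain b where b: "b \<in> integral_points"
      and ev: "\<And>r. D_apply r (vapply x f) = 0 \<Longrightarrow> cpoly_eval r b = 0"
      using evaluation_nonzero_decomposition[OF vapply_signals[OF fs] nz] by metis
    obtain r where r: "r *s x \<in> M" "cpoly_eval r b \<noteq> 0" using H b by metis
    have "vapply (r *s x) f = 0" using f r(1) unfolding behavior_of_iff by metis
    then show False using ev[of r] r(2) unfolding vapply_scale[OF fs] by simp
  qed
qed

lemma willems_closure_submodule: "is_D_submodule (willems_closure M)"
proof (rule vmod.subspaceI)
  show "0 \<in> willems_closure M" by (simp add: willems_closure_iff)
next
  fix x y assume "x \<in> willems_closure M" "y \<in> willems_closure M"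
  then show "x + y \<in> willems_closure M" by (simp add: willems_closure_iff vapply_add)
next
  fix c x assume "x \<in> willems_closure M"
  then show "c *s x \<in> willems_closure M"
    by (auto simp: willems_closure_iff vapply_scale[OF behavior_signals])
qed

lemma subset_willems_closure: "M \<subseteq> willems_closure M"
  by (auto simp: willems_closure_iff behavior_of_iff)

text \<open>The support is the variety of a common annihilator, so one denominator for the entire
  closure is required, not one for each element.\<close>

lemma closure_support_avoids_integral_points:
  assumes M: "is_D_submodule M"
  shows "quotient_support (willems_closure M) M \<inter> integral_points = {}"
proof -
  have False if "b \<in> quotient_support (willems_closure M) M" and b: "b \<in> integral_points" for b
  proof -
    obtain s where s: "cpoly_eval s b \<noteq> 0"
      and u: "\<And>t x. cpoly_eval t b \<noteq> 0 \<Longrightarrow> t *s x \<in> M \<Longrightarrow> s *s x \<in> M"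
      using uniform_denominator[OF M, of b] by metis
    have "s *s x \<in> M" if x: "x \<in> willems_closure M" for x
    proof -
      obtain r where "r *s x \<in> M" "cpoly_eval r b \<noteq> 0"
        using x b unfolding mem_willems_closure_iff[OF M] by metis
      then show ?thesis using u by metis
    qed
    then have "s \<in> quotient_annihilator (willems_closure M) M"
      unfolding quotient_annihilator_def by (intro CollectI ballI)
    then show False using that(1) s unfolding quotient_support_def D_variety_def by blast
  qed
  then show ?thesis by blast
qed

lemma closure_largest:
  assumes M: "is_D_submodule M" and "quotient_support M' M \<inter> integral_points = {}"
  shows "M' \<subseteq> willems_closure M"
proof
  fix x assume x: "x \<in> M'"
  show "x \<in> willems_closure M"
    unfolding mem_willems_closure_iff[OF M]
  proof
    fix b :: "complex ^ 'a" assume "b \<in> integral_points"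
    then have "b \<notin> D_variety (quotient_annihilator M' M)"
      using assms(2) unfolding quotient_support_def by blast
    then obtain r where "r \<in> quotient_annihilator M' M" "cpoly_eval r b \<noteq> 0"
      unfolding D_variety_def by blast
    then show "\<exists>r. r *s x \<in> M \<and> cpoly_eval r b \<noteq> 0"
      using x unfolding quotient_annihilator_def by (intro exI[where x = r]) simp
  qed
qed

subsection \<open>Primary decompositions\<close>

text \<open>If an integral \<open>b\<close> lies on the variety of \<open>P i\<close>, an operator
  nonzero at \<open>b\<close> is outside \<open>P i\<close> and can be cancelled modulo
  \<open>N i\<close>. If there is no such point, each integral \<open>b\<close> has an
  \<open>f \<in> P i\<close> nonzero at \<open>b\<close>, a power of which carries \<open>x\<close>
  into \<open>N i\<close>; the product over \<open>i\<close> is then a denominator for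
  \<open>M\<close>.\<close>

lemma closure_primary_decomposition:
  fixes M :: "('n::finite cpoly ^ 'q::finite) set"
  assumes M: "is_D_submodule M" and dec: "irredundant_primary_decomposition M t N P"
  shows "willems_closure M = (\<Inter>i\<in>{i\<in>{1..t}. D_variety (P i) \<inter> integral_points \<noteq> {}}. N i)"
proof -
  have MN: "M = (\<Inter>i\<in>{1..t}. N i)" and prim: "\<And>i. i \<in> {1..t} \<Longrightarrow> is_primary_submodule (P i) (N i)"
    using dec unfolding irredundant_primary_decomposition_def by blast+
  have Nsub: "is_D_submodule (N i)" if "i \<in> {1..t}" for i
    using prim[OF that] by (simp add: is_primary_submodule_def)
  show ?thesis
  proof (intro equalityI subsetI)
    fix x assume x: "x \<in> willems_closure M"
    have "x \<in> N i" if i: "i \<in> {1..t}" and ne: "D_variety (P i) \<inter> integral_points \<noteq> {}" for i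
    proof -
      obtain b where b: "b \<in> D_variety (P i)" "b \<in> integral_points" using ne by blast
      obtain r where r: "r *s x \<in> M" "cpoly_eval r b \<noteq> 0"
        using x b(2) unfolding mem_willems_closure_iff[OF M] by metis
      have "r \<notin> P i" using b(1) r(2) unfolding D_variety_def by blast
      moreover have "r *s x \<in> N i" using r(1) i unfolding MN by (rule INT_D)
      ultimately show ?thesis by (rule primary_nonzerodivisor[OF prim[OF i]])
    qed
    then show "x \<in> (\<Inter>i\<in>{i\<in>{1..t}. D_variety (P i) \<inter> integral_points \<noteq> {}}. N i)" by simp
  next
    fix x assume x: "x \<in> (\<Inter>i\<in>{i\<in>{1..t}. D_variety (P i) \<inter> integral_points \<noteq> {}}. N i)"
    show "x \<in> willems_closure M"
      unfolding mem_willems_closure_iff[OF M]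
    proof
      fix b :: "complex ^ 'n" assume b: "b \<in> integral_points"
      have "\<exists>s. cpoly_eval s b \<noteq> 0 \<and> s *s x \<in> N i" if i: "i \<in> {1..t}" for i
      proof (cases "D_variety (P i) \<inter> integral_points = {}")
        case False
        then have "x \<in> N i" using x i by simp
        then show ?thesis by (intro exI[where x = 1]) simp
      next
        case True
        then obtain f where f: "f \<in> P i" "cpoly_eval f b \<noteq> 0" using b unfolding D_variety_def by blast
        obtain k where "f ^ k *s x \<in> N i" using primary_power_in[OF prim[OF i] f(1)] by metis
        then show ?thesis using f(2) by (intro exI[where x = "f ^ k"]) simp
      qed
      then obtain s where s: "\<And>i. i \<in> {1..t} \<Longrightarrow> cpoly_eval (s i) b \<noteq> 0"
        "\<And>i. i \<in> {1..t} \<Longrightarrow> s i *s x \<in> N i" by metis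
      have "(\<Prod>i\<in>{1..t}. s i) *s x \<in> N i" if i: "i \<in> {1..t}" for i
      proof -
        have "(\<Prod>i\<in>{1..t}. s i) *s x = (\<Prod>k\<in>{1..t} - {i}. s k) *s (s i *s x)"
          unfolding vmod.scale_scale using i by (simp only: prod.remove[OF _ i] finite_atLeastAtMost mult.commute)
        then show ?thesis using vmod.subspace_scale[OF Nsub[OF i] s(2)[OF i]] by metis
      qed
      then have "(\<Prod>i\<in>{1..t}. s i) *s x \<in> M" unfolding MN by (rule INT_I)
      moreover have "cpoly_eval (\<Prod>i\<in>{1..t}. s i) b \<noteq> 0" using s(1) by (simp add: prod_zero_iff)
      ultimately show "\<exists>r. r *s x \<in> M \<and> cpoly_eval r b \<noteq> 0" by (intro exI conjI)
    qed
  qed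
qed

lemma associated_prime_proper:
  assumes "P \<in> associated_primes M" and "P = {r. r *s x \<in> M}"
  shows "x \<notin> M"
proof
  assume "x \<in> M"
  then have "1 \<in> P" unfolding assms(2) by simp
  moreover have P: "is_D_prime P" using assms(1) by (simp add: associated_primes_def)
  ultimately have "r \<in> P" for r
    using cmod.subspace_scale[of P 1 r] by (simp add: is_D_prime_def)
  then show False using P by (auto simp: is_D_prime_def)
qed

text \<open>For the forward direction, \<open>P i\<close> is the annihilator of a class outside
  \<open>M\<close>. If \<open>M\<close> is closed, the local description supplies an integral point
  at which that whole annihilator vanishes.\<close>

lemma closed_iff_primes_meet_integral_points:
  fixes M :: "('n::finite cpoly ^ 'q::finite) set"
  assumes M: "is_D_submodule M" and dec: "irredundant_primary_decomposition M t N P"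
  shows "M = willems_closure M \<longleftrightarrow> (\<forall>i\<in>{1..t}. D_variety (P i) \<inter> integral_points \<noteq> {})"
proof
  assume closed: "M = willems_closure M"
  show "\<forall>i\<in>{1..t}. D_variety (P i) \<inter> integral_points \<noteq> {}"
  proof
    fix i assume "i \<in> {1..t}"
    then have P: "P i \<in> associated_primes M"
      using dec unfolding irredundant_primary_decomposition_def by blast
    then obtain x where x: "P i = {r. r *s x \<in> M}" unfolding associated_primes_def by auto
    have "x \<notin> willems_closure M" using associated_prime_proper[OF P x] closed by simp
    then obtain b where b: "b \<in> integral_points" "\<And>r. r *s x \<in> M \<Longrightarrow> cpoly_eval r b = 0"
      unfolding mem_willems_closure_iff[OF M] by metis
    then have "b \<in> D_variety (P i)" unfolding x D_variety_def by simp
    then show "D_variety (P i) \<inter> integral_points \<noteq> {}" using b(1) by blast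
  qed
next
  assume "\<forall>i\<in>{1..t}. D_variety (P i) \<inter> integral_points \<noteq> {}"
  then have "{i\<in>{1..t}. D_variety (P i) \<inter> integral_points \<noteq> {}} = {1..t}" by blast
  moreover have "M = (\<Inter>i\<in>{1..t}. N i)"
    using dec unfolding irredundant_primary_decomposition_def by blast
  ultimately show "M = willems_closure M"
    using closure_primary_decomposition[OF M dec] by simp
qed

subsection \<open>Behaviors that are images\<close>

lemma vapply_matrix:
  assumes "\<And>k. k \<in> K \<Longrightarrow> g k \<in> signals"
  shows "vapply x (\<chi> i. \<Sum>k\<in>K. D_apply (L i k) (g k)) = (\<Sum>k\<in>K. D_apply (\<Sum>i\<in>UNIV. x $ i * L i k) (g k))"
proof -
  have "vapply x (\<chi> i. \<Sum>k\<in>K. D_apply (L i k) (g k))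
      = (\<Sum>i\<in>UNIV. \<Sum>k\<in>K. D_apply (x $ i) (D_apply (L i k) (g k)))"
    unfolding vapply_def using assms
    by (intro sum.cong refl) (simp add: D_apply_fun_sum D_apply_signals)
  also have "\<dots> = (\<Sum>k\<in>K. \<Sum>i\<in>UNIV. D_apply (x $ i * L i k) (g k))"
    by (subst sum.swap) (intro sum.cong refl, simp add: D_apply_mult assms)
  finally show ?thesis by (simp add: D_apply_sum)
qed

lemma D_apply_exponential: "D_apply r (pexp a 0) = (\<lambda>x. cpoly_eval r (cpt a) * pexp a 0 x)"
proof (rule eigensignal_eval[OF pexp_in_signals])
  fix j
  show "D_apply (dvar (cpt a) j) (pexp a 0) = 0"
    using D_apply_dvar_power_pexp[of a j 1 0] by (simp add: taylor_factor_def zero_fun_def)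
qed

text \<open>Let \<open>P\<close> be the annihilator of the class of \<open>x\<close>, with
  \<open>r \<noteq> 0\<close> in it. On an image, \<open>r *s x\<close> acts through
  \<open>r\<close> times the row vector x L. This product kills all inputs, so the row vector is 0
  and \<open>x\<close> itself annihilates the behavior, which an integral point of \<open>P\<close>
  forbids.\<close>

lemma image_imp_primes_avoid_integral_points:
  fixes M :: "('n::finite cpoly ^ 'q::finite) set"
  assumes M: "is_D_submodule M" and im: "behavior_of M = operator_image p L"
    and P: "P \<in> associated_primes M" and "P \<noteq> {0}"
  shows "D_variety P \<inter> integral_points = {}"
proof (rule ccontr)
  assume "D_variety P \<inter> integral_points \<noteq> {}"
  then obtain b where b: "b \<in> D_variety P" "b \<in> integral_points" by blast
  obtain x where x: "P = {r. r *s x \<in> M}" using P unfolding associated_primes_def by auto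
  have "cpoly_eval r b = 0" if "r *s x \<in> M" for r
    using b(1) that unfolding x D_variety_def by simp
  then have notin: "x \<notin> willems_closure M"
    using b(2) unfolding mem_willems_closure_iff[OF M] by metis
  have "0 \<in> P" using P cmod.subspace_0 unfolding associated_primes_def is_D_prime_def by blast
  then obtain r where r: "r \<noteq> 0" "r *s x \<in> M" using \<open>P \<noteq> {0}\<close> unfolding x by auto
  define Q where "Q k = (\<Sum>i\<in>UNIV. x $ i * L i k)" for k
  have Q0: "Q k = 0" if k: "k < p" for k
  proof (rule ccontr)
    assume "Q k \<noteq> 0"
    then obtain c where c: "c \<in> integral_points" "cpoly_eval r c \<noteq> 0" "cpoly_eval (Q k) c \<noteq> 0"
      using cpoly_nonvanishing_pair[OF r(1)] by metis
    then obtain a where a: "c = cpt a" by (auto simp: integral_points_eq)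
    \<comment> \<open>Feed the exponential of frequency \<open>c\<close> into the
      \<open>k\<close>-th input and 0 elsewhere: after \<open>r *s x\<close> its value at the origin
      is r(c) Q_k(c), nonzero by the choice of \<open>c\<close>.\<close>
    define f :: "(real ^ 'n \<Rightarrow> complex) ^ 'q" where "f = (\<chi> i. \<Sum>k'\<in>{k}. D_apply (L i k') (pexp a 0))"
    have fs: "f $ i \<in> signals" for i by (simp add: f_def D_apply_signals pexp_in_signals)
    have "f \<in> operator_image p L"
      unfolding operator_image_def
    proof (intro CollectI exI[where x = "\<lambda>k'. if k' = k then pexp a 0 else 0"] conjI allI impI ext)
      fix i y
      have "(\<Sum>k'<p. D_apply (L i k') (if k' = k then pexp a 0 else 0) y) =
          (\<Sum>k'<p. if k' = k then D_apply (L i k) (pexp a 0) y else 0)"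
        by (intro sum.cong refl) (simp add: zero_fun_apply)
      then show "(f $ i) y = (\<Sum>k'<p. D_apply (L i k') (if k' = k then pexp a 0 else 0) y)"
        using k by (simp add: f_def)
    qed (simp add: pexp_in_signals signals_zero)
    then have "vapply (r *s x) f = 0"
      using r(2) unfolding im[symmetric] behavior_of_iff by metis
    moreover have "vapply (r *s x) f = D_apply r (D_apply (Q k) (pexp a 0))"
      unfolding vapply_scale[OF fs] unfolding f_def Q_def
      by (subst vapply_matrix) (simp_all add: pexp_in_signals)
    ultimately have "D_apply (r * Q k) (pexp a 0) 0 = 0"
      by (simp add: D_apply_mult pexp_in_signals zero_fun_apply)
    then show False using c by (simp add: D_apply_exponential a pexp_at_zero)
  qed
  have "x \<in> willems_closure M"
    unfolding willems_closure_iff im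
  proof
    fix f assume "f \<in> operator_image p L"
    then obtain g where g: "\<And>k. k < p \<Longrightarrow> g k \<in> signals"
      and fg: "\<And>i. f $ i = (\<lambda>y. \<Sum>k<p. D_apply (L i k) (g k) y)"
      unfolding operator_image_def by auto
    have "f = (\<chi> i. \<Sum>k<p. D_apply (L i k) (g k))"
      by (simp add: vec_eq_iff fg fun_eq_iff sum_fun_apply)
    then have "vapply x f = (\<Sum>k<p. D_apply (Q k) (g k))"
      using vapply_matrix[of "{..<p}" g x L] g by (simp add: Q_def)
    also have "\<dots> = 0" by (intro sum.neutral ballI) (simp add: Q0)
    finally show "vapply x f = 0" .
  qed
  with notin show False by simp
qed

section \<open>From torsion-closed closures to image representations\<close>

lemma closure_torsion_closed:
  fixes M :: "('n::finite cpoly ^ 'q::finite) set"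
  assumes M: "is_D_submodule M"
    and hyp: "\<forall>P\<in>associated_primes M. P \<noteq> {0} \<longrightarrow> D_variety P \<inter> integral_points = {}"
    and r: "r \<noteq> 0" "r *s x \<in> willems_closure M"
  shows "x \<in> willems_closure M"
  unfolding mem_willems_closure_iff[OF M]
proof (rule ballI, rule ccontr)
  fix b :: "complex ^ 'n" assume b: "b \<in> integral_points"
    and "\<not> (\<exists>r. r *s x \<in> M \<and> cpoly_eval r b \<noteq> 0)"
  then have ev: "\<And>r. r *s x \<in> M \<Longrightarrow> cpoly_eval r b = 0" by metis
  obtain s where s: "s *s (r *s x) \<in> M" "cpoly_eval s b \<noteq> 0"
    using r(2) b unfolding mem_willems_closure_iff[OF M] by metis
  define t where "t = s * r"
  have "s \<noteq> 0" using s(2) by auto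
  then have t: "t *s x \<in> M" "t \<noteq> 0"
    using s(1) cpoly_mult_nonzero[OF _ r(1)] by (simp_all add: t_def)
  obtain d where d: "cpoly_eval d b \<noteq> 0"
    and u: "\<And>t z. cpoly_eval t b \<noteq> 0 \<Longrightarrow> t *s z \<in> M \<Longrightarrow> d *s z \<in> M"
    using uniform_denominator[OF M, of b] by metis
  \<comment> \<open>The elements that vanish after localization at \<open>b\<close>. If
    \<open>x\<close> is not among them, a multiple of it has prime annihilator \<open>P\<close>,
    which turns out to be associated to \<open>M\<close>, to contain \<open>t \<noteq> 0\<close> and
    to have \<open>b\<close> on its variety, against the hypothesis.\<close>
  define Mb where "Mb = {z. d *s z \<in> M}"
  have Mb: "is_D_submodule Mb" unfolding Mb_def by (rule subspace_preimage_scale[OF M])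
  have "x \<notin> Mb" using ev[of d] d unfolding Mb_def by auto
  then obtain v where v: "{q. q *s (v *s x) \<in> Mb} \<in> associated_primes Mb"
    using exists_associated_prime[OF Mb] by metis
  define P where "P = {q. q *s (v *s x) \<in> Mb}"
  have prime: "is_D_prime P" using v unfolding P_def[symmetric] by (simp add: associated_primes_def)
  have vx: "v *s x \<notin> Mb" by (rule associated_prime_proper[OF v refl])
  \<comment> \<open>Multiplication by \<open>d\<close> moves the class from the quotient by
    \<open>Mb\<close> to the quotient by \<open>M\<close> without changing its annihilator.\<close>
  have P_eq: "P = {q. q *s (d *s (v *s x)) \<in> M}"
    unfolding P_def Mb_def by (simp only: mem_Collect_eq vmod.scale_scale mult.commute mult.left_commute)
  have "P \<in> associated_primes M"
    unfolding associated_primes_def using prime P_eq by (intro CollectI conjI exI)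
  moreover have "t \<in> P"
  proof -
    have "(d * v) *s (t *s x) \<in> M" by (rule vmod.subspace_scale[OF M t(1)])
    then show ?thesis
      unfolding P_eq by (simp only: mem_Collect_eq vmod.scale_scale mult.assoc mult.commute mult.left_commute)
  qed
  moreover have "b \<in> D_variety P"
  proof -
    \<comment> \<open>If \<open>q\<close> were nonzero at \<open>b\<close>, then
      \<open>q * d\<close> would be a denominator of \<open>v *s x\<close>, so \<open>d\<close>
      would already be one, contradicting \<open>vx\<close>.\<close>
    have "cpoly_eval q b = 0" if "q \<in> P" for q
    proof (rule ccontr)
      assume "cpoly_eval q b \<noteq> 0"
      then have "cpoly_eval (q * d) b \<noteq> 0" using d by simp
      moreover have "(q * d) *s (v *s x) \<in> M"
        using that unfolding P_eq by (simp only: mem_Collect_eq vmod.scale_scale mult.assoc)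
      ultimately have "d *s (v *s x) \<in> M" by (rule u)
      with vx show False unfolding Mb_def by simp
    qed
    then show ?thesis unfolding D_variety_def by simp
  qed
  ultimately show False using hyp t(2) b by blast
qed

text \<open>A finitely generated torsion-free module embeds into a free module: choose a maximal set of
  coordinates that are independent modulo \<open>C\<close> and clear denominators in the remaining ones.\<close>

lemma torsion_closed_eq_kernel:
  fixes C :: "('n::finite cpoly ^ 'q::finite) set"
  assumes C: "is_D_submodule C" and tc: "\<And>r x. r \<noteq> 0 \<Longrightarrow> r *s x \<in> C \<Longrightarrow> x \<in> C"
  shows "\<exists>L :: 'q \<Rightarrow> 'q \<Rightarrow> 'n cpoly. \<forall>r. r \<in> C \<longleftrightarrow> (\<forall>k. (\<Sum>j\<in>UNIV. r $ j * L j k) = 0)"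
proof -
  \<comment> \<open>Independence modulo \<open>C\<close> of the coordinate vectors in
    \<open>I\<close>, phrased as \<open>C\<close> containing no nonzero vector supported in
    \<open>I\<close>.\<close>
  define indep where "indep I \<longleftrightarrow> (\<forall>v\<in>C. (\<forall>i. i \<notin> I \<longrightarrow> v $ i = 0) \<longrightarrow> v = 0)" for I
  have "indep {}" by (auto simp: indep_def vec_eq_iff)
  then obtain I where I: "indep I" and max: "\<And>J. indep J \<Longrightarrow> I \<subseteq> J \<Longrightarrow> I = J"
    using finite_has_maximal[of "{I. indep I}"] by auto
  have "\<exists>d w. d \<noteq> 0 \<and> (\<forall>i. i \<notin> I \<longrightarrow> w $ i = 0) \<and> d *s axis j 1 - w \<in> C" for j
  proof (cases "j \<in> I")
    case True
    have "1 *s axis j 1 - axis j 1 \<in> C" by (simp add: vmod.subspace_0[OF C])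
    moreover have "\<forall>i. i \<notin> I \<longrightarrow> axis j (1 :: 'n cpoly) $ i = 0" using True by (auto simp: axis_def)
    ultimately show ?thesis by (intro exI[where x = 1] exI[where x = "axis j 1"] conjI) simp_all
  next
    case False
    then have "\<not> indep (insert j I)" using max[of "insert j I"] by blast
    then obtain v where v: "v \<in> C" "\<And>i. i \<notin> insert j I \<Longrightarrow> v $ i = 0" "v \<noteq> 0"
      unfolding indep_def by blast
    have "v $ j \<noteq> 0"
    proof
      assume "v $ j = 0"
      then have "\<forall>i. i \<notin> I \<longrightarrow> v $ i = 0" using v(2) by (metis insert_iff)
      then show False using I v(1,3) unfolding indep_def by blast
    qed
    moreover have "\<forall>i. i \<notin> I \<longrightarrow> ((v $ j) *s axis j 1 - v) $ i = 0"
      using v(2) by (auto simp: axis_def)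
    moreover have "(v $ j) *s axis j 1 - ((v $ j) *s axis j 1 - v) \<in> C" using v(1) by simp
    ultimately show ?thesis by (intro exI conjI)
  qed
  then obtain d w where d: "\<And>j. d j \<noteq> 0" and w: "\<And>j i. i \<notin> I \<Longrightarrow> w j $ i = 0"
    and dw: "\<And>j. d j *s axis j 1 - w j \<in> C" by metis
  \<comment> \<open>The product of the other denominators, so that \<open>e j * d j\<close> is the
    same \<open>D\<close> for every \<open>j\<close>.\<close>
  define e where "e j = (\<Prod>k\<in>UNIV - {j}. d k)" for j
  define D where "D = (\<Prod>k\<in>UNIV. d k)"
  have De: "D = e j * d j" for j
    unfolding D_def e_def by (subst prod.remove[of _ j]) (simp_all add: mult.commute)
  have D: "D \<noteq> 0" unfolding D_def by (rule cpoly_prod_nonzero[OF d])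
  define L where "L j k = e j * w j $ k" for j k
  \<comment> \<open>\<open>\<rho> r\<close> is \<open>D *s r\<close> rewritten modulo
    \<open>C\<close> in the coordinates \<open>I\<close>. Independence gives
    \<open>\<rho> r = 0\<close> for \<open>r \<in> C\<close>, and \<open>tc\<close> gives the
    converse.\<close>
  define \<rho> where "\<rho> r = (\<chi> k. \<Sum>j\<in>UNIV. r $ j * L j k)" for r :: "'n cpoly ^ 'q"
  have diff: "D *s r - \<rho> r \<in> C" for r
  proof -
    have "(\<Sum>j\<in>UNIV. (r $ j * e j) *s (d j *s axis j 1 - w j)) \<in> C"
      by (intro vmod.subspace_sum[OF C] vmod.subspace_scale[OF C] dw)
    moreover have "(\<Sum>j\<in>UNIV. (r $ j * e j) *s (d j *s axis j 1 - w j)) = D *s r - \<rho> r"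
    proof (rule vec_eq_iff[THEN iffD2], rule allI)
      fix k
      have "(\<Sum>j\<in>UNIV. (r $ j * e j) *s (d j *s axis j 1 - w j)) $ k =
          (\<Sum>j\<in>UNIV. (if j = k then D * r $ k else 0) - r $ j * L j k)"
        unfolding sum_component
      proof (rule sum.cong[OF refl])
        fix j
        have "((r $ j * e j) *s (d j *s axis j 1 - w j)) $ k = r $ j * e j * (d j * axis j 1 $ k - w j $ k)"
          by (simp only: vector_smult_component vector_minus_component)
        also have "\<dots> = r $ j * (e j * d j) * axis j 1 $ k - r $ j * L j k"
          by (simp only: L_def right_diff_distrib mult.assoc)
        also have "r $ j * (e j * d j) * axis j 1 $ k = (if j = k then D * r $ k else 0)"
          unfolding De[of j, symmetric] by (simp add: axis_def mult.commute[of _ D])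
        finally show "((r $ j * e j) *s (d j *s axis j 1 - w j)) $ k
            = (if j = k then D * r $ k else 0) - r $ j * L j k" .
      qed
      then show "(\<Sum>j\<in>UNIV. (r $ j * e j) *s (d j *s axis j 1 - w j)) $ k = (D *s r - \<rho> r) $ k"
        by (simp add: sum_subtractf \<rho>_def)
    qed
    ultimately show ?thesis by simp
  qed
  have supp: "\<rho> r $ i = 0" if "i \<notin> I" for r i
    using w[OF that] by (simp add: \<rho>_def L_def)
  have "r \<in> C \<longleftrightarrow> \<rho> r = 0" for r
  proof
    assume "r \<in> C"
    then have "D *s r - (D *s r - \<rho> r) \<in> C"
      by (intro vmod.subspace_diff[OF C] vmod.subspace_scale[OF C] diff)
    then have "\<rho> r \<in> C" by simp
    then show "\<rho> r = 0" using I supp unfolding indep_def by blast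
  next
    assume "\<rho> r = 0"
    then have "D *s r \<in> C" using diff[of r] by simp
    then show "r \<in> C" by (rule tc[OF D])
  qed
  then have "\<forall>r. r \<in> C \<longleftrightarrow> (\<forall>k. (\<Sum>j\<in>UNIV. r $ j * L j k) = 0)"
    by (simp add: \<rho>_def vec_eq_iff)
  then show ?thesis by (rule exI[where x = L])
qed

text \<open>Prescribe on rows the functional r L \<mapsto> (r F)(0), well defined by compatibility,
  and represent it by signals \<open>g\<close>. Then L g and F have equal values at the origin after
  every operator row, so they coincide.\<close>

lemma local_solvability:
  fixes L :: "'q::finite \<Rightarrow> 'q \<Rightarrow> 'n::finite cpoly"
  assumes b: "b \<in> integral_points" and F: "\<And>i. F $ i \<in> gen_signals b"
    and compat: "\<And>r. (\<And>k. (\<Sum>j\<in>UNIV. r $ j * L j k) = 0) \<Longrightarrow> vapply r F = 0"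
  shows "\<exists>g. (\<forall>k. g k \<in> gen_signals b) \<and> (\<forall>i. F $ i = (\<Sum>k\<in>UNIV. D_apply (L i k) (g k)))"
proof -
  have Fs: "F $ i \<in> signals" for i using gen_signals_signals[OF F] .
  define \<rho> where "\<rho> r = (\<chi> k. \<Sum>j\<in>UNIV. r $ j * L j k)" for r :: "'n cpoly ^ 'q"
  have \<rho>_add: "\<rho> r + \<rho> s = \<rho> (r + s)" for r s
    by (simp add: \<rho>_def vec_eq_iff distrib_right sum.distrib)
  have \<rho>_diff: "\<rho> r - \<rho> s = \<rho> (r - s)" for r s
    by (simp add: \<rho>_def vec_eq_iff left_diff_distrib sum_subtractf)
  have \<rho>_scale: "c *s \<rho> r = \<rho> (c *s r)" for c r
    unfolding \<rho>_def vec_eq_iff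
    by (simp only: vector_smult_component vec_lambda_beta sum_distrib_left mult.assoc simp_thms)
  have \<rho>_zero: "\<rho> 0 = 0" by (simp add: \<rho>_def vec_eq_iff)
  have ker: "vapply r F = 0" if "\<rho> r = 0" for r
    using that by (intro compat) (simp add: \<rho>_def vec_eq_iff)
  define \<phi> where "\<phi> v = vapply (SOME r. \<rho> r = v) F 0" for v
  have \<phi>: "\<phi> (\<rho> r) = vapply r F 0" for r
  proof -
    have "\<rho> (SOME r'. \<rho> r' = \<rho> r) = \<rho> r" by (rule someI) (rule refl)
    then have "\<rho> ((SOME r'. \<rho> r' = \<rho> r) - r) = 0" unfolding \<rho>_diff[symmetric] by simp
    then have "vapply ((SOME r'. \<rho> r' = \<rho> r) - r) F = 0" by (rule ker)
    then have "vapply (SOME r'. \<rho> r' = \<rho> r) F = vapply r F" unfolding vapply_diff by simp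
    then show ?thesis by (simp add: \<phi>_def)
  qed
  define U where "U = range \<rho>"
  \<comment> \<open>The rows r L for which \<open>r\<close> kills \<open>F\<close>. Some power of
    \<open>dvar b j\<close> kills all components of \<open>F\<close> and therefore moves
    \<open>U\<close> into \<open>W\<close>.\<close>
  define W where "W = \<rho> ` {r. vapply r F = 0}"
  have U: "is_D_submodule U"
    unfolding U_def
  proof (rule vmod.subspaceI)
    show "0 \<in> range \<rho>" using rangeI[of \<rho> 0] by (simp only: \<rho>_zero)
    show "x + y \<in> range \<rho>" if "x \<in> range \<rho>" "y \<in> range \<rho>" for x y
      using that by (elim rangeE) (simp only: \<rho>_add rangeI)
    show "c *s x \<in> range \<rho>" if "x \<in> range \<rho>" for c x
      using that by (elim rangeE) (simp only: \<rho>_scale rangeI)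
  qed
  have WI: "\<rho> r \<in> W" if "vapply r F = 0" for r unfolding W_def using that by (intro imageI CollectI)
  have W: "is_D_submodule W"
  proof (rule vmod.subspaceI)
    show "0 \<in> W" using WI[of 0] by (simp add: \<rho>_zero)
  next
    fix x y assume "x \<in> W" "y \<in> W"
    then obtain r s where "x = \<rho> r" "vapply r F = 0" "y = \<rho> s" "vapply s F = 0"
      unfolding W_def by (elim imageE CollectE)
    then show "x + y \<in> W" using WI[of "r + s"] by (simp only: \<rho>_add vapply_add add_0)
  next
    fix c x assume "x \<in> W"
    then obtain r where "x = \<rho> r" "vapply r F = 0" unfolding W_def by (elim imageE CollectE)
    then show "c *s x \<in> W" using WI[of "c *s r"] by (simp only: \<rho>_scale vapply_scale[OF Fs] D_apply_fun_zero)
  qed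
  have "W \<subseteq> U" unfolding U_def W_def by blast
  have "\<exists>g. (\<forall>i. g $ i \<in> gen_signals b) \<and> (\<forall>s\<in>U. vapply s g 0 = \<phi> s)"
  proof (rule signal_extension[OF b U W \<open>W \<subseteq> U\<close>])
    show "\<phi> (u + v) = \<phi> u + \<phi> v" if "u \<in> U" "v \<in> U" for u v
      using that unfolding U_def by (elim rangeE) (simp only: \<rho>_add \<phi> vapply_add plus_fun_apply)
    show "\<phi> (cpoly_const c *s u) = c * \<phi> u" if "u \<in> U" for c u
      using that unfolding U_def
      by (elim rangeE) (simp only: \<rho>_scale \<phi> vapply_scale[OF Fs] D_apply_const)
    show "\<phi> u = 0" if "u \<in> W" for u
      using that unfolding W_def by (elim imageE CollectE) (simp add: \<phi> zero_fun_apply)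
    show "\<exists>k. \<forall>u\<in>U. dvar b j ^ k *s u \<in> W" for j
    proof -
      have "\<exists>k. D_apply (dvar b j ^ k) (F $ i) = 0" for i
        using gen_signals_nilpotent[OF F] by blast
      then obtain k where k: "\<And>i. D_apply (dvar b j ^ k i) (F $ i) = 0" by metis
      define K where "K = (\<Sum>i\<in>UNIV. k i)"
      have kK: "k i \<le> K" for i unfolding K_def by (rule member_le_sum) auto
      have "vapply (dvar b j ^ K *s r) F = 0" for r
        unfolding vapply_def
      proof (rule sum.neutral, rule ballI)
        fix i
        have "D_apply ((dvar b j ^ K *s r) $ i) (F $ i) = D_apply (r $ i) (D_apply (dvar b j ^ K) (F $ i))"
          by (simp add: D_apply_mult[OF Fs, symmetric] mult.commute)
        also have "D_apply (dvar b j ^ K) (F $ i) = 0"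
          by (rule D_apply_power_zero_mono[OF Fs k kK])
        finally show "D_apply ((dvar b j ^ K *s r) $ i) (F $ i) = 0" by simp
      qed
      then have "dvar b j ^ K *s \<rho> r \<in> W" for r unfolding \<rho>_scale by (rule WI)
      then show ?thesis unfolding U_def by (intro exI[where x = K] ballI) (elim rangeE, simp)
    qed
  qed
  then obtain g where g: "\<And>k. g $ k \<in> gen_signals b" and gU: "\<And>s. s \<in> U \<Longrightarrow> vapply s g 0 = \<phi> s"
    by (elim exE conjE) metis
  have gs: "g $ k \<in> signals" for k using gen_signals_signals[OF g] .
  define h where "h = (\<chi> i. \<Sum>k\<in>UNIV. D_apply (L i k) (g $ k))"
  have h: "h $ i \<in> gen_signals b" for i
    unfolding h_def by (simp add: gen_signals_sum gen_signals_D_apply g)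
  have vh: "vapply r h = vapply (\<rho> r) g" for r
    unfolding h_def using vapply_matrix[of UNIV "\<lambda>k. g $ k" r L] gs
    by (simp add: \<rho>_def vapply_def)
  have eq0: "vapply r h 0 = vapply r F 0" for r
    unfolding vh using gU[of "\<rho> r"] \<phi> by (simp add: U_def)
  have "F $ i = h $ i" for i
  proof -
    let ?d = "h $ i + (\<lambda>x. (-1) * (F $ i) x)"
    have "?d = 0"
    proof (rule gen_signals_separated)
      show "?d \<in> gen_signals b" by (rule gen_signals_add[OF h gen_signals_scale[OF F]])
      fix q
      have "D_apply q ?d = D_apply q (h $ i) + (\<lambda>x. (-1) * D_apply q (F $ i) x)"
        using D_apply_fun_add[OF gen_signals_signals[OF h] signals_scale[OF Fs], of q i "-1" i]
        unfolding D_apply_fun_scale[OF Fs] .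
      then show "D_apply q ?d 0 = 0"
        using eq0[of "axis i q"] by (simp add: vapply_axis plus_fun_apply)
    qed
    then show ?thesis by (simp add: fun_eq_iff plus_fun_apply zero_fun_apply)
  qed
  then show ?thesis
    using g by (intro exI[where x = "\<lambda>k. g $ k"]) (simp add: h_def)
qed

text \<open>One matrix serves all frequencies, and the inputs are found frequency by frequency. A
  row that kills \<open>f\<close> kills each frequency component separately, by independence, so
  compatibility passes to the components.\<close>

lemma behavior_eq_image_of_kernel_matrix:
  fixes M :: "('n::finite cpoly ^ 'q::finite) set"
  assumes L: "\<And>r. r \<in> willems_closure M \<longleftrightarrow> (\<forall>k. (\<Sum>j\<in>UNIV. r $ j * L j k) = 0)"
  shows "f \<in> behavior_of M \<longleftrightarrow>
    (\<exists>g :: 'q \<Rightarrow> _. (\<forall>k. g k \<in> signals) \<and> (\<forall>i. f $ i = (\<Sum>k\<in>UNIV. D_apply (L i k) (g k))))"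
proof
  assume f: "f \<in> behavior_of M"
  have "\<exists>A F. finite A \<and> A \<subseteq> integral_points \<and> (\<forall>a. F a \<in> gen_signals a) \<and>
     (\<forall>a. a \<notin> A \<longrightarrow> F a = 0) \<and> f $ j = (\<Sum>a\<in>A. F a)" for j
    by (rule signals_decomposition[OF behavior_signals[OF f]])
  then obtain A F where A: "\<And>j. finite (A j)" "\<And>j. A j \<subseteq> integral_points"
    and F: "\<And>j a. F j a \<in> gen_signals a" "\<And>j a. a \<notin> A j \<Longrightarrow> F j a = 0"
    and fF: "\<And>j. f $ j = (\<Sum>a\<in>A j. F j a)" by metis
  define B where "B = (\<Union>j. A j)"
  have B: "finite B" "B \<subseteq> integral_points" using A by (auto simp: B_def)
  have fB: "f $ j = (\<Sum>a\<in>B. F j a)" for j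
    unfolding fF using B(1) F(2) by (intro sum.mono_neutral_left) (auto simp: B_def)
  define V where "V a = (\<chi> j. F j a)" for a
  have Vg: "V a $ j \<in> gen_signals a" for a j by (simp add: V_def F)
  have "\<exists>g. (\<forall>k. g k \<in> gen_signals a) \<and> (\<forall>i. V a $ i = (\<Sum>k\<in>UNIV. D_apply (L i k) (g k)))"
    if a: "a \<in> B" for a
  proof (rule local_solvability)
    show "a \<in> integral_points" using a B(2) by blast
    show "V a $ i \<in> gen_signals a" for i by (rule Vg)
    fix r assume "\<And>k. (\<Sum>j\<in>UNIV. r $ j * L j k) = 0"
    then have "r \<in> willems_closure M" using L by simp
    then have "vapply r f = 0" using f unfolding willems_closure_iff by (rule bspec)
    moreover have "vapply r f = (\<Sum>a\<in>B. vapply r (V a))"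
    proof -
      have "vapply r f = (\<Sum>j\<in>UNIV. \<Sum>a\<in>B. D_apply (r $ j) (F j a))"
        unfolding vapply_def fB
        by (intro sum.cong refl D_apply_fun_sum gen_signals_signals[OF F(1)])
      then show ?thesis by (simp add: vapply_def V_def sum.swap[of _ B])
    qed
    ultimately have "(\<Sum>a\<in>B. vapply r (V a)) = 0" by simp
    then show "vapply r (V a) = 0"
      using gen_signals_independent[OF B(1), of "\<lambda>a. vapply r (V a)"] vapply_gen_signals[OF Vg] a by blast
  qed
  then obtain g where g: "\<And>a k. a \<in> B \<Longrightarrow> g a k \<in> gen_signals a"
    and Vgk: "\<And>a i. a \<in> B \<Longrightarrow> V a $ i = (\<Sum>k\<in>UNIV. D_apply (L i k) (g a k))" by metis
  have gs: "g a k \<in> signals" if "a \<in> B" for a k using gen_signals_signals[OF g[OF that]] .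
  show "\<exists>g :: 'q \<Rightarrow> _. (\<forall>k. g k \<in> signals) \<and> (\<forall>i. f $ i = (\<Sum>k\<in>UNIV. D_apply (L i k) (g k)))"
  proof (intro exI[where x = "\<lambda>k. \<Sum>a\<in>B. g a k"] conjI allI)
    show "(\<Sum>a\<in>B. g a k) \<in> signals" for k by (rule signals_sum[OF gs])
    fix i
    have "f $ i = (\<Sum>a\<in>B. \<Sum>k\<in>UNIV. D_apply (L i k) (g a k))"
      unfolding fB by (intro sum.cong refl) (simp add: Vgk[symmetric] V_def)
    also have "\<dots> = (\<Sum>k\<in>UNIV. \<Sum>a\<in>B. D_apply (L i k) (g a k))" by (rule sum.swap)
    also have "\<dots> = (\<Sum>k\<in>UNIV. D_apply (L i k) (\<Sum>a\<in>B. g a k))"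
      by (intro sum.cong refl D_apply_fun_sum[symmetric] gs)
    finally show "f $ i = (\<Sum>k\<in>UNIV. D_apply (L i k) (\<Sum>a\<in>B. g a k))" .
  qed
next
  assume "\<exists>g :: 'q \<Rightarrow> _. (\<forall>k. g k \<in> signals) \<and> (\<forall>i. f $ i = (\<Sum>k\<in>UNIV. D_apply (L i k) (g k)))"
  then obtain g :: "'q \<Rightarrow> _" where g: "\<And>k. g k \<in> signals"
    and fg: "\<And>i. f $ i = (\<Sum>k\<in>UNIV. D_apply (L i k) (g k))" by blast
  have f: "f = (\<chi> i. \<Sum>k\<in>UNIV. D_apply (L i k) (g k))" by (simp add: vec_eq_iff fg)
  have "vapply r f = 0" if "r \<in> M" for r
  proof -
    have "r \<in> willems_closure M" using that subset_willems_closure by blast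
    then have "\<And>k. (\<Sum>j\<in>UNIV. r $ j * L j k) = 0" unfolding L by simp
    then show ?thesis unfolding f by (subst vapply_matrix) (simp_all add: g)
  qed
  moreover have "f $ i \<in> signals" for i unfolding fg by (intro signals_sum D_apply_signals g)
  ultimately show "f \<in> behavior_of M" unfolding behavior_of_iff by blast
qed

lemma primes_avoid_integral_points_imp_image:
  fixes M :: "('n::finite cpoly ^ 'q::finite) set"
  assumes M: "is_D_submodule M"
    and hyp: "\<forall>P\<in>associated_primes M. P \<noteq> {0} \<longrightarrow> D_variety P \<inter> integral_points = {}"
  shows "\<exists>p (L :: 'q \<Rightarrow> nat \<Rightarrow> 'n cpoly). behavior_of M = operator_image p L"
proof -
  have "\<exists>L :: 'q \<Rightarrow> 'q \<Rightarrow> 'n cpoly. \<forall>r. r \<in> willems_closure M \<longleftrightarrow> (\<forall>k. (\<Sum>j\<in>UNIV. r $ j * L j k) = 0)"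
    by (rule torsion_closed_eq_kernel[OF willems_closure_submodule]) (rule closure_torsion_closed[OF M hyp])
  then obtain L :: "'q \<Rightarrow> 'q \<Rightarrow> 'n cpoly" where
    "\<forall>r. r \<in> willems_closure M \<longleftrightarrow> (\<forall>k. (\<Sum>j\<in>UNIV. r $ j * L j k) = 0)" by (elim exE)
  then have L: "\<And>r. r \<in> willems_closure M \<longleftrightarrow> (\<forall>k. (\<Sum>j\<in>UNIV. r $ j * L j k) = 0)"
    by (rule spec)
  \<comment> \<open>The kernel matrix is square over \<open>'q\<close>; the enumeration
    \<open>e\<close> renumbers its columns by naturals as \<open>operator_image\<close>
    expects.\<close>
  define p where "p = CARD('q)"
  obtain e :: "nat \<Rightarrow> 'q" where e: "bij_betw e {..<p} UNIV"
    using ex_bij_betw_nat_finite[of "UNIV :: 'q set"] by (auto simp: p_def atLeast0LessThan finite)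
  have reindex: "(\<Sum>k\<in>UNIV. h k) = (\<Sum>k<p. h (e k))" for h :: "'q \<Rightarrow> real ^ 'n \<Rightarrow> complex"
    by (rule sum.reindex_bij_betw[OF e, symmetric])
  have "behavior_of M = operator_image p (\<lambda>i k. L i (e k))"
  proof (intro set_eqI iffI)
    fix f assume "f \<in> behavior_of M"
    then obtain g :: "'q \<Rightarrow> _" where g: "\<And>k. g k \<in> signals"
      and fg: "\<And>i. f $ i = (\<Sum>k\<in>UNIV. D_apply (L i k) (g k))"
      unfolding behavior_eq_image_of_kernel_matrix[OF L] by blast
    show "f \<in> operator_image p (\<lambda>i k. L i (e k))"
      unfolding operator_image_def
      by (intro CollectI exI[where x = "\<lambda>k. g (e k)"] conjI allI impI g ext)
         (simp add: fg reindex sum_fun_apply)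
  next
    fix f assume "f \<in> operator_image p (\<lambda>i k. L i (e k))"
    then obtain g where g: "\<And>k. k < p \<Longrightarrow> g k \<in> signals"
      and fg: "\<And>i. f $ i = (\<lambda>x. \<Sum>k<p. D_apply (L i (e k)) (g k) x)"
      unfolding operator_image_def by auto
    define g' where "g' k = g (inv_into {..<p} e k)" for k
    have g': "g' (e k) = g k" if "k < p" for k
      using e that by (simp add: g'_def bij_betw_def inv_into_f_f)
    have "g' k \<in> signals" for k
      unfolding g'_def using bij_betw_imp_surj_on[OF e] inv_into_into[of k e "{..<p}"] by (intro g) auto
    moreover have "f $ i = (\<Sum>k\<in>UNIV. D_apply (L i k) (g' k))" for i
      unfolding reindex fg by (rule ext) (simp add: sum_fun_apply g')
    ultimately show "f \<in> behavior_of M"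
      unfolding behavior_eq_image_of_kernel_matrix[OF L] by blast
  qed
  then show ?thesis by (intro exI)
qed

theorem mainTheorem7:
  fixes M :: "('n::finite cpoly ^ 'q::finite) set"
  assumes "CARD('n) \<ge> 2"
    and "is_D_submodule M"
  shows
    "(willems_closure M =
        {x. \<not> (\<exists>b\<in>integral_points. {r. r *s x \<in> M} \<subseteq> point_ideal b)} \<and>
      is_D_submodule (willems_closure M) \<and>
      M \<subseteq> willems_closure M \<and>
      quotient_support (willems_closure M) M \<inter> integral_points = {} \<and>
      (\<forall>M'. is_D_submodule M' \<and> M \<subseteq> M' \<and> quotient_support M' M \<inter> integral_points = {} \<longrightarrow>
         M' \<subseteq> willems_closure M)) \<and>
     (\<forall>t N P. irredundant_primary_decomposition M t N P \<longrightarrow>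
        (\<forall>r\<le>t. (\<forall>i\<in>{1..r}. D_variety (P i) \<inter> integral_points \<noteq> {}) \<and>
               (\<forall>i\<in>{r+1..t}. D_variety (P i) \<inter> integral_points = {}) \<longrightarrow>
               willems_closure M = (\<Inter>i\<in>{1..r}. N i)) \<and>
        (M = willems_closure M \<longleftrightarrow>
           (\<forall>i\<in>{1..t}. D_variety (P i) \<inter> integral_points \<noteq> {}))) \<and>
     ((\<exists>p (L :: 'q \<Rightarrow> nat \<Rightarrow> 'n cpoly). behavior_of M = operator_image p L) \<longleftrightarrow>
        (\<forall>P\<in>associated_primes M. P \<noteq> {0} \<longrightarrow> D_variety P \<inter> integral_points = {}))"
proof (intro conjI allI impI)
  note M = assms(2)
  show "willems_closure M = {x. \<not> (\<exists>b\<in>integral_points. {r. r *s x \<in> M} \<subseteq> point_ideal b)}"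
    unfolding point_ideal_eq by (intro set_eqI) (auto simp: mem_willems_closure_iff[OF M])
  show "is_D_submodule (willems_closure M)" by (rule willems_closure_submodule)
  show "M \<subseteq> willems_closure M" by (rule subset_willems_closure)
  show "quotient_support (willems_closure M) M \<inter> integral_points = {}"
    by (rule closure_support_avoids_integral_points[OF M])
  show "M' \<subseteq> willems_closure M"
    if "is_D_submodule M' \<and> M \<subseteq> M' \<and> quotient_support M' M \<inter> integral_points = {}" for M'
    using that by (intro closure_largest[OF M]) simp
next
  fix t N P r
  assume dec: "irredundant_primary_decomposition M t N P" and "r \<le> t"
    and r: "(\<forall>i\<in>{1..r}. D_variety (P i) \<inter> integral_points \<noteq> {}) \<and>
      (\<forall>i\<in>{r+1..t}. D_variety (P i) \<inter> integral_points = {})"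
  have "{i\<in>{1..t}. D_variety (P i) \<inter> integral_points \<noteq> {}} = {1..r}"
  proof (intro set_eqI iffI)
    fix i assume i: "i \<in> {i\<in>{1..t}. D_variety (P i) \<inter> integral_points \<noteq> {}}"
    then have "i \<notin> {r+1..t}" using r by blast
    then show "i \<in> {1..r}" using i by auto
  next
    fix i assume "i \<in> {1..r}"
    then show "i \<in> {i\<in>{1..t}. D_variety (P i) \<inter> integral_points \<noteq> {}}" using r \<open>r \<le> t\<close> by auto
  qed
  then show "willems_closure M = (\<Inter>i\<in>{1..r}. N i)"
    using closure_primary_decomposition[OF assms(2) dec] by simp
next
  fix t N P
  assume "irredundant_primary_decomposition M t N P"
  then show "M = willems_closure M \<longleftrightarrow> (\<forall>i\<in>{1..t}. D_variety (P i) \<inter> integral_points \<noteq> {})"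
    by (rule closed_iff_primes_meet_integral_points[OF assms(2)])
next
  show "(\<exists>p (L :: 'q \<Rightarrow> nat \<Rightarrow> 'n cpoly). behavior_of M = operator_image p L) \<longleftrightarrow>
      (\<forall>P\<in>associated_primes M. P \<noteq> {0} \<longrightarrow> D_variety P \<inter> integral_points = {})"
  proof
    assume "\<exists>p (L :: 'q \<Rightarrow> nat \<Rightarrow> 'n cpoly). behavior_of M = operator_image p L"
    then obtain p L where "behavior_of M = operator_image p (L :: 'q \<Rightarrow> nat \<Rightarrow> 'n cpoly)" by (elim exE)
    then show "\<forall>P\<in>associated_primes M. P \<noteq> {0} \<longrightarrow> D_variety P \<inter> integral_points = {}"
      using image_imp_primes_avoid_integral_points[OF assms(2)] by metis
  next
    assume "\<forall>P\<in>associated_primes M. P \<noteq> {0} \<longrightarrow> D_variety P \<inter> integral_points = {}"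
    then show "\<exists>p (L :: 'q \<Rightarrow> nat \<Rightarrow> 'n cpoly). behavior_of M = operator_image p L"
      by (rule primes_avoid_integral_points_imp_image[OF assms(2)])
  qed
qed

end
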